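(* Assume that there exist positive constants $\bar c_0,\bar\kappa_0,\bar c_1,\bar\kappa_1$ such that $\inf_{|\delta|\le\bar c_0}\mathcal{U}'(\Theta+\delta)\ge\bar\kappa_0>0$ and $\sup_{|\delta|\le\bar c_1}|\mathcal{U}''(\Theta+\delta)|\le\bar\kappa_1$, that $\sup_{t\in\mathbb{R}}|\mathcal{U}'(t)|<\infty$, and that there exists a positive constant $\bar\eta<1$ such that $\bar\eta\le n/m\le1/\bar\eta$. Then $$\sup_{z\in\mathbb{R}}\left|\mathbb{P}\left\{\frac{\sqrt N(\hat\Theta-\Theta)}{\tilde\sigma_\Theta}\le z\right\}-\Phi(z)\right|\le\frac{C_1\log N}{\sqrt N},$$ where $C_1<\infty$ is a positive constant independent of $N$. Moreover, let $\{\delta_N\}$ be a sequence of positive constants satisfying $\sqrt N\,\delta_N\to\infty$. Then $$\left|\frac{\mathbb{P}\{\sqrt N(\hat\Theta-\Theta)/\tilde\sigma_\Theta\ge z\}}{1-\Phi(z)}-1\right|\le C_2\left\{\frac{1+z^3}{\sqrt N}+(1+z)\delta_N+2(z\vee1)\sqrt{2\pi}\exp\left(\frac{z^2}{2}-\sqrt N\,\delta_N\right)\right\},$$ uniformly for $0<z\le o(\delta_N^{-1}\wedge N^{1/4}\sqrt{\delta_N})$ (that is, for every sequence $a_N=o(\delta_N^{-1}\wedge N^{1/4}\sqrt{\delta_N})$ the bound holds for all $0<z\le a_N$), where $C_2<\infty$ is a positive constant independent of $z$ and $N$. In particular, when $\delta_N\asymp N^{-1/6}$, $$\left|\frac{\mathbb{P}\{\sqrt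 N(\hat\Theta-\Theta)/\tilde\sigma_\Theta\ge z\}}{1-\Phi(z)}-1\right|\to0$$ uniformly for $0<z\le o(N^{1/6})$.
   Context: Let $X_i=\theta+\xi_i$, $i\in[n]=\{1,\dots,n\}$, and $Y_j=\theta^\circ+\varepsilon_j$, $j\in[m]$, be two independent samples of real random variables, where $\xi_1,\dots,\xi_n$ are i.i.d. with cumulative distribution function $F(t)=\mathbb{P}(\xi_1\le t)$ and $\varepsilon_1,\dots,\varepsilon_m$ are i.i.d. with cumulative distribution function $G(t)=\mathbb{P}(\varepsilon_1\le t)$ (distributions not depending on $n,m$). Let $\Theta=\theta-\theta^\circ$ and $\mathcal{U}(t)=\mathbb{P}(X_1-Y_1\le t)$. It is assumed that $\Theta=\inf\{t\in\mathbb{R}:\mathcal{U}(t)\ge1/2\}$ (the median of $\xi_1-\varepsilon_1$ is $0$). The two-sample Hodges–Lehmann estimator is $\hat\Theta=\mathrm{median}\{X_i-Y_j:i\in[n],j\in[m]\}=\inf\{t\in\mathbb{R}:(nm)^{-1}\sum_{i=1}^n\sum_{j=1}^m\mathbb{I}\{X_i-Y_j\le t\}\ge1/2\}$. Write $N=nm/(n+m)$ and $$\tilde\sigma_\Theta^2=\frac{1}{\{\mathcal{U}'(\Theta)\}^2}\left(\frac{n}{n+m}\mathrm{Var}\{F(\varepsilon_1)\}+\frac{m}{n+m}\mathrm{Var}\{G(\xi_1)\}\right).$$ $\Phi$ is the standard normal distribution function; $a\wedge b=\min(a,b)$, $a\vee b=\max(a,b)$; $a_N\asymp b_N$ means that $a_N/b_N$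 is bounded above and below by positive constants. Asymptotic statements are as $N\to\infty$. *)

theory Defs
  imports "HOL-Probability.Probability"
begin

(* The families xi (the noise of the X-sample) and eps (the noise of the Y-sample), indexed from 0,
   are jointly independent: the sum type nat + nat indexes all the variables together.
   Samples of sizes n and m are the initial segments {..<n} and {..<m}. *)
definition two_sample_noise ::
    "'a measure \<Rightarrow> (nat \<Rightarrow> 'a \<Rightarrow> real) \<Rightarrow> (nat \<Rightarrow> 'a \<Rightarrow> real) \<Rightarrow> bool" where
  "two_sample_noise M xi eps \<longleftrightarrow>
     prob_space M \<and>
     prob_space.indep_vars M (\<lambda>_. borel) (case_sum xi eps) UNIV \<and>
     (\<forall>i. distr M borel (xi i) = distr M borel (xi 0)) \<and>
     (\<forall>j. distr M borel (eps j) = distr M borel (eps 0))"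

definition diff_cdf :: "'a measure \<Rightarrow> ('a \<Rightarrow> real) \<Rightarrow> ('a \<Rightarrow> real) \<Rightarrow> real \<Rightarrow> real" where
  "diff_cdf M X Y t = measure M {\<omega> \<in> space M. X \<omega> - Y \<omega> \<le> t}"

definition hodges_lehmann :: "nat \<Rightarrow> nat \<Rightarrow> (nat \<Rightarrow> real) \<Rightarrow> (nat \<Rightarrow> real) \<Rightarrow> real" where
  "hodges_lehmann n m x y =
     Inf {t. (\<Sum>i<n. \<Sum>j<m. of_bool (x i - y j \<le> t)) / (real n * real m) \<ge> 1 / 2}"

definition eff_size :: "nat \<Rightarrow> nat \<Rightarrow> real" where
  "eff_size n m = real n * real m / (real n + real m)"

(* v is the value of the density of X_1 - Y_1 at the true shift. *)
definition hl_sd ::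
    "'a measure \<Rightarrow> ('a \<Rightarrow> real) \<Rightarrow> ('a \<Rightarrow> real) \<Rightarrow> real \<Rightarrow> nat \<Rightarrow> nat \<Rightarrow> real" where
  "hl_sd M \<xi> \<epsilon> v n m =
     (let F = cdf (distr M borel \<xi>); G = cdf (distr M borel \<epsilon>) in
      sqrt (1 / v\<^sup>2 *
        (real n / (real n + real m) * prob_space.variance M (\<lambda>\<omega>. F (\<epsilon> \<omega>)) +
         real m / (real n + real m) * prob_space.variance M (\<lambda>\<omega>. G (\<xi> \<omega>)))))"

abbreviation std_normal_cdf :: "real \<Rightarrow> real" where
  "std_normal_cdf \<equiv> cdf std_normal_distribution"

end

theory Submission
  imports Defs "HOL-Probability.Probability" "HOL-Real_Asymp.Real_Asymp"
begin

text \<open>The estimator exceeds a level exactly when less than half of the pairs have a difference below that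
  level, so its distribution function is read off the two-sample U-statistic that counts such pairs.
  Write the level as \<open>\<Theta> + u\<close> and let \<open>V u\<close> be the probability that \<open>\<xi> - \<epsilon> \<le> u\<close>. The Hoeffding
  decomposition splits the counting statistic into \<open>V u\<close>, a sum of independent bounded centred summands
  (the conditional probabilities given one coordinate), and a completely degenerate remainder
  (\<open>hoeffding_decomposition\<close>). After division by the standard deviation of the linear part, exceeding the
  level at \<open>z\<close> standard deviations becomes the event that linear part plus remainder is larger than a
  threshold. By Taylor expansion of \<open>V\<close>, and because the variance of the linear part is a Lipschitz
  function of \<open>u\<close>, this threshold is \<open>z + O(z\<^sup>2 / \<surd>N)\<close> (\<open>threshold_bounds\<close>).

  The remainder has exponential tails on the scale \<open>1 / \<surd>N\<close> (\<open>degenerate_chaos_tail\<close>): conditionally on one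
  sample it is a sum of centred terms in the other one, and the inequality \<open>exp x \<le> x + exp (x\<^sup>2)\<close> turns its
  exponential moment into the exponential moment of the square of a subgaussian sum. Hence the
  remainder moves the threshold by at most \<open>w\<close> outside an event of probability \<open>O(exp (- c \<surd>N w))\<close>. The choice
  \<open>w = const \<sqdot> log N / \<surd>N\<close> gives the Berry--Esseen bound, and \<open>w = const \<sqdot> \<delta>\<close> gives the moderate
  deviation bound.

  For the linear part, a sum \<open>S\<close> with unit variance and summands bounded by \<open>B = O(1 / \<surd>N)\<close>, both bounds come from
  one estimate: the law of \<open>S\<close> tilted by \<open>exp (\<lambda> S)\<close> differs from the normal law with mean \<open>\<lambda>\<close> and variance
  1 by \<open>O(B (1 + \<lambda>\<^sup>2 + log (1 / B)))\<close> in Kolmogorov distance, as long as \<open>B \<lambda>\<^sup>2\<close> is small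
  (\<open>cdf_tilted_approx\<close>). The case \<open>\<lambda> = 0\<close> is a
  Berry--Esseen bound. The choice \<open>\<lambda> = x\<close>, followed by undoing the tilt on \<open>S > x\<close>, gives a Cramer type
  expansion of the tail at \<open>x\<close> (\<open>cramer_moderate_deviation\<close>). The estimate is proved by convolving both
  laws with a Gaussian of width \<open>B \<surd>(log (1 / B))\<close> up to a constant, which makes Fourier inversion absolutely
  convergent and costs a shift of order \<open>B log (1 / B)\<close>.

  The resulting extra factor \<open>log N\<close> is harmless. In the first assertion it is part of the claim. In the
  second one \<open>log N / \<surd>N \<le> 4 \<delta> + 4 exp (- \<surd>N \<delta>)\<close> holds for every \<open>\<delta> > 0\<close>, so that the bound claimed
  there always dominates \<open>(1 + z) log N / \<surd>N\<close>, up to a constant factor.\<close>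

section \<open>The standard normal tail\<close>

interpretation std_normal: real_distribution std_normal_distribution
  by (rule real_dist_normal_dist)

lemma std_normal_cdf_increment:
  assumes "a \<le> b"
  shows std_normal_cdf_increment_le:
      "(\<And>x. a \<le> x \<Longrightarrow> x \<le> b \<Longrightarrow> std_normal_density x \<le> K) \<Longrightarrow> std_normal_cdf b - std_normal_cdf a \<le> K * (b - a)"
    and std_normal_cdf_increment_ge:
      "(\<And>x. a \<le> x \<Longrightarrow> x \<le> b \<Longrightarrow> K \<le> std_normal_density x) \<Longrightarrow> 0 \<le> K \<Longrightarrow>
        K * (b - a) \<le> std_normal_cdf b - std_normal_cdf a"
proof -
  have eq: "std_normal_cdf b - std_normal_cdf a = measure std_normal_distribution {a<..b}"
    using std_normal.cdf_diff_eq[of a b] assms by (cases "a = b") auto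
  have em: "emeasure std_normal_distribution {a<..b}
      = (\<integral>\<^sup>+x. ennreal (std_normal_density x) * indicator {a<..b} x \<partial>lborel)"
    by (subst emeasure_density) auto
  { assume K: "\<And>x. a \<le> x \<Longrightarrow> x \<le> b \<Longrightarrow> std_normal_density x \<le> K"
    have K0: "0 \<le> K" using K[of a] assms normal_density_nonneg[of 0 1 a] by linarith
    have "emeasure std_normal_distribution {a<..b} \<le> (\<integral>\<^sup>+x. ennreal K * indicator {a<..b} x \<partial>lborel)"
      unfolding em using K by (intro nn_integral_mono) (auto split: split_indicator intro!: ennreal_leI)
    also have "\<dots> = ennreal (K * (b - a))"
      using assms K0 by (simp add: nn_integral_cmult_indicator ennreal_mult)
    finally have "measure std_normal_distribution {a<..b} \<le> K * (b - a)"
      using K0 assms by (simp add: std_normal.emeasure_eq_measure)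
    then show "std_normal_cdf b - std_normal_cdf a \<le> K * (b - a)" using eq by simp }
  { assume K: "\<And>x. a \<le> x \<Longrightarrow> x \<le> b \<Longrightarrow> K \<le> std_normal_density x" and K0: "0 \<le> K"
    have "ennreal (K * (b - a)) = (\<integral>\<^sup>+x. ennreal K * indicator {a<..b} x \<partial>lborel)"
      using assms K0 by (simp add: nn_integral_cmult_indicator ennreal_mult)
    also have "\<dots> \<le> emeasure std_normal_distribution {a<..b}"
      unfolding em using K by (intro nn_integral_mono) (auto split: split_indicator intro!: ennreal_leI)
    finally have "K * (b - a) \<le> measure std_normal_distribution {a<..b}"
      using K0 assms by (simp add: std_normal.emeasure_eq_measure)
    then show "K * (b - a) \<le> std_normal_cdf b - std_normal_cdf a" using eq by simp }
qed

lemma std_normal_density_le_1: "std_normal_density x \<le> 1"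
proof -
  have "1 \<le> sqrt (2 * pi)" using pi_gt3 by (intro real_le_rsqrt) auto
  moreover have "exp (- x\<^sup>2 / 2) \<le> 1" by simp
  ultimately have "exp (- x\<^sup>2 / 2) / sqrt (2 * pi) \<le> 1 / 1" by (intro frac_le) auto
  then show ?thesis by (simp add: std_normal_density_def)
qed

lemma std_normal_cdf_Lipschitz: "\<bar>std_normal_cdf x - std_normal_cdf y\<bar> \<le> \<bar>x - y\<bar>"
proof (cases x y rule: linorder_cases)
  case less
  then show ?thesis
    using std_normal_cdf_increment_le[of x y 1] std_normal_density_le_1 std_normal.cdf_nondecreasing[of x y] by auto
next
  case greater
  then show ?thesis
    using std_normal_cdf_increment_le[of y x 1] std_normal_density_le_1 std_normal.cdf_nondecreasing[of y x] by auto
qed simp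

text \<open>Mills ratio: already the mass on \<open>{z<..z + 1/(1+z)}\<close>, where the density has dropped by at most a
  constant factor, is of the order of the whole tail.\<close>
lemma std_normal_density_le_tail:
  assumes "0 \<le> z"
  shows "std_normal_density z \<le> 5 * (1 + z) * (1 - std_normal_cdf z)"
proof -
  define h where "h = 1 / (1 + z)"
  have h: "0 < h" "h \<le> 1" "z * h \<le> 1" "h * (1 + z) = 1" using assms by (auto simp: h_def field_simps)
  have "std_normal_density z / 5 \<le> std_normal_density x" if "z \<le> x" "x \<le> z + h" for x
  proof -
    have "x\<^sup>2 \<le> (z + h)\<^sup>2" using that assms by (intro power_mono) auto
    also have "\<dots> = z\<^sup>2 + 2 * (z * h) + h\<^sup>2" by (simp add: power2_eq_square algebra_simps)
    also have "\<dots> \<le> z\<^sup>2 + 3" using h power_le_one[of h 2] by linarith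
    finally have *: "- z\<^sup>2/2 - 3/2 \<le> - x\<^sup>2 / 2" by simp
    have "exp (- z\<^sup>2/2) / 5 \<le> exp (- z\<^sup>2/2) * exp (-3/2)"
    proof -
      \<comment> \<open>The exponent drops by at most 3/2 on the interval.\<close>
      have "exp (3/2::real) \<le> 5"
      proof -
        have "exp (3/2::real) ^ 2 = exp 1 ^ 3" by (simp flip: exp_of_nat_mult)
        also have "\<dots> \<le> 2.72 ^ 3" using e_less_272 by (intro power_mono) auto
        also have "\<dots> \<le> 5 ^ 2" by (simp add: power3_eq_cube)
        finally show ?thesis by (rule power2_le_imp_le) simp
      qed
      then show ?thesis by (simp add: exp_minus field_simps)
    qed
    also have "\<dots> = exp (- z\<^sup>2/2 - 3/2)" by (simp flip: exp_add)
    also have "\<dots> \<le> exp (- x\<^sup>2/2)" using * by simp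
    finally have "exp (- z\<^sup>2/2) / 5 \<le> exp (- x\<^sup>2/2)" .
    then have "1 / sqrt (2*pi) * (exp (- z\<^sup>2/2) / 5) \<le> 1 / sqrt (2*pi) * exp (- x\<^sup>2/2)"
      by (intro mult_left_mono) auto
    then show ?thesis by (simp add: std_normal_density_def)
  qed
  then have "std_normal_density z / 5 * h \<le> std_normal_cdf (z + h) - std_normal_cdf z"
    using std_normal_cdf_increment_ge[of z "z + h" "std_normal_density z / 5"] h by simp
  also have "\<dots> \<le> 1 - std_normal_cdf z" using std_normal.cdf_bounded_prob by auto
  finally have "std_normal_density z / 5 * (h * (1 + z)) \<le> (1 - std_normal_cdf z) * (1 + z)"
    using mult_right_mono[of _ _ "1 + z"] assms by (metis add_nonneg_nonneg mult.assoc zero_le_one)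
  then have "std_normal_density z / 5 \<le> (1 - std_normal_cdf z) * (1 + z)" using h(4) by simp
  then show ?thesis by (simp add: algebra_simps)
qed

lemma std_normal_tail_pos: "0 < 1 - std_normal_cdf z"
proof -
  have "0 < 5 * (1 + max z 0) * (1 - std_normal_cdf (max z 0))"
    using std_normal_density_le_tail[of "max z 0"] normal_density_pos[of 1 0 "max z 0"] by linarith
  moreover have "0 < 5 * (1 + max z 0)" by simp
  ultimately have "0 < 1 - std_normal_cdf (max z 0)" by (rule zero_less_mult_pos)
  then show ?thesis using std_normal.cdf_nondecreasing[of z "max z 0"] by auto
qed

text \<open>Density and tail differ by the factor \<open>1 + z\<close> only; this is what turns the exponential bound for the
  degenerate remainder into a relative error.\<close>
lemma std_normal_tail_ge:
  assumes "0 \<le> z"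
  shows "exp (- z\<^sup>2 / 2) \<le> 15 * (1 + z) * (1 - std_normal_cdf z)"
proof -
  have "sqrt (2 * pi) \<le> 3"
    using pi_less_4 by (intro real_le_lsqrt) auto
  then have "exp (- z\<^sup>2 / 2) \<le> 3 * std_normal_density z"
    by (simp add: std_normal_density_def field_simps)
  also have "\<dots> \<le> 3 * (5 * (1 + z) * (1 - std_normal_cdf z))"
    using std_normal_density_le_tail[OF assms] by (intro mult_left_mono) auto
  finally show ?thesis by linarith
qed

lemma std_normal_tail_eq: "measure std_normal_distribution {z<..} = 1 - std_normal_cdf z"
proof -
  have "UNIV - {..z} = {z<..}" by auto
  then show ?thesis using std_normal.prob_compl[of "{..z}"] by (simp add: cdf_def)
qed

text \<open>For \<open>y > z \<ge> 0\<close> the standard normal density at \<open>y\<close> is at most \<open>exp (- z\<^sup>2/2)\<close> times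
  the density of the normal law centred at \<open>z\<close>.\<close>
lemma std_normal_tail_le:
  assumes "0 \<le> z"
  shows "1 - std_normal_cdf z \<le> exp (- z\<^sup>2 / 2)" and "std_normal_cdf (- z) \<le> exp (- z\<^sup>2 / 2)"
proof -
  have gen: "measure std_normal_distribution A \<le> exp (- z\<^sup>2 / 2)"
    if A[measurable]: "A \<in> sets borel" and c: "\<And>y. y \<in> A \<Longrightarrow> z \<le> c * y" and c1: "c\<^sup>2 = 1"
    for A and c :: real
  proof -
    have "std_normal_density y \<le> exp (- z\<^sup>2 / 2) * normal_density (c * z) 1 y" if "y \<in> A" for y
    proof -
      have "z * z \<le> z * (c * y)" using c[OF that] assms by (intro mult_left_mono)
      moreover have "(y - c * z)\<^sup>2 = y\<^sup>2 - 2 * (z * (c * y)) + z\<^sup>2"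
        using c1 by (simp add: power2_diff power_mult_distrib algebra_simps)
      ultimately have "- y\<^sup>2 / 2 \<le> - z\<^sup>2 / 2 + - (y - c * z)\<^sup>2 / 2"
        unfolding power2_eq_square[of z] by linarith
      then have "exp (- y\<^sup>2 / 2) \<le> exp (- z\<^sup>2 / 2) * exp (- (y - c * z)\<^sup>2 / 2)"
        by (simp flip: exp_add)
      then show ?thesis by (simp add: normal_density_def divide_right_mono)
    qed
    then have "emeasure std_normal_distribution A
        \<le> (\<integral>\<^sup>+y. ennreal (exp (- z\<^sup>2 / 2)) * ennreal (normal_density (c * z) 1 y) \<partial>lborel)"
      by (subst emeasure_density) (auto intro!: nn_integral_mono ennreal_leI split: split_indicator
            simp flip: ennreal_mult)
    also have "\<dots> = ennreal (exp (- z\<^sup>2 / 2))"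
      by (subst nn_integral_cmult) (auto simp: nn_integral_eq_integral)
    finally show ?thesis by (simp add: std_normal.emeasure_eq_measure)
  qed
  show "1 - std_normal_cdf z \<le> exp (- z\<^sup>2 / 2)" using gen[of "{z<..}" 1] by (simp add: std_normal_tail_eq)
  show "std_normal_cdf (- z) \<le> exp (- z\<^sup>2 / 2)" using gen[of "{..-z}" "-1"] by (simp add: cdf_def)
qed

text \<open>On the scale \<open>1/(1+z)\<close> the normal density varies by a constant factor only.\<close>
lemma std_normal_cdf_relative_change:
  assumes "0 \<le> z" "(1 + z) * \<bar>x - z\<bar> \<le> 1"
  shows "\<bar>std_normal_cdf x - std_normal_cdf z\<bar> \<le> 15 * ((1 + z) * \<bar>x - z\<bar>) * (1 - std_normal_cdf z)"
proof -
  define K where "K = exp 1 * std_normal_density z"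
  have dens: "std_normal_density y \<le> K" if "min x z \<le> y" "y \<le> max x z" for y
  proof -
    have "\<bar>y - z\<bar> \<le> \<bar>x - z\<bar>" using that by auto
    then have "z * (z - y) \<le> z * \<bar>x - z\<bar>" using assms(1) by (intro mult_left_mono) auto
    also have "\<dots> \<le> (1 + z) * \<bar>x - z\<bar>" by (intro mult_right_mono) auto
    also have "\<dots> \<le> 1" by (rule assms(2))
    finally have "z * (z - y) \<le> 1" .
    moreover have "y\<^sup>2 = z\<^sup>2 - 2 * (z * (z - y)) + (z - y)\<^sup>2" by (simp add: power2_eq_square algebra_simps)
    ultimately have "- y\<^sup>2 / 2 \<le> 1 - z\<^sup>2 / 2" using zero_le_power2[of "z - y"] by linarith
    then have "exp (- y\<^sup>2/2) \<le> exp 1 * exp (- z\<^sup>2/2)" by (simp flip: exp_add)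
    then show ?thesis by (simp add: K_def std_normal_density_def divide_right_mono)
  qed
  have "\<bar>std_normal_cdf x - std_normal_cdf z\<bar> \<le> K * \<bar>x - z\<bar>"
  proof (cases "x \<le> z")
    case True
    then show ?thesis using std_normal_cdf_increment_le[of x z K] dens std_normal.cdf_nondecreasing[of x z]
      by (auto simp: min_def max_def split: if_splits)
  next
    case False
    then show ?thesis using std_normal_cdf_increment_le[of z x K] dens std_normal.cdf_nondecreasing[of z x]
      by (auto simp: min_def max_def split: if_splits)
  qed
  also have "K * \<bar>x - z\<bar> \<le> (3 * (5 * (1 + z) * (1 - std_normal_cdf z))) * \<bar>x - z\<bar>"
    unfolding K_def using std_normal_density_le_tail[OF assms(1)] exp_le normal_density_nonneg[of 0 1 z]
    by (intro mult_right_mono mult_mono) auto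
  finally show ?thesis by (simp add: algebra_simps)
qed

section \<open>Gaussian smoothing and inversion of characteristic functions\<close>

text \<open>In the inversion formula for an interval \<open>{a<..x}\<close> the kernel is at most \<open>2 / \<bar>t\<bar>\<close>, uniformly in \<open>a\<close>, and \<open>a\<close> can
  then be sent to \<open>-\<infinity>\<close>. The factor \<open>\<bar>t\<bar>\<close> in the hypothesis cancels the singularity of the kernel at 0.\<close>
lemma cdf_diff_le_char_integral:
  fixes g :: "real \<Rightarrow> real"
  assumes "real_distribution \<mu>" "real_distribution \<nu>"
    and atomless: "\<And>x. measure \<mu> {x} = 0" "\<And>x. measure \<nu> {x} = 0"
    and g: "integrable lborel g"
    and bound: "\<And>t. t \<noteq> 0 \<Longrightarrow> cmod (char \<mu> t - char \<nu> t) \<le> \<bar>t\<bar> * g t"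
  shows "\<bar>cdf \<mu> x - cdf \<nu> x\<bar> \<le> (1 / pi) * (\<integral>t. g t \<partial>lborel)"
proof -
  interpret M: real_distribution \<mu> by fact
  interpret N: real_distribution \<nu> by fact
  have main: "\<bar>measure \<mu> {a<..x} - measure \<nu> {a<..x}\<bar> \<le> (1 / pi) * (\<integral>t. g t \<partial>lborel)" if "a \<le> x" for a
  proof -
    define K where "K t = (iexp (-(t * a)) - iexp (-(t * x))) / (\<i> * t)" for t :: real
    have [measurable]: "K \<in> borel_measurable borel" unfolding K_def by measurable
    have K1: "cmod (K t) \<le> x - a" if "t \<noteq> 0" for t
      using Levy_Inversion_aux2[of "-x" "-a" t] that \<open>a \<le> x\<close> by (simp add: K_def algebra_simps)
    have K2: "cmod (K t) \<le> 2 / \<bar>t\<bar>" for t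
    proof -
      have "cmod (iexp (-(t * a)) - iexp (-(t * x))) \<le> cmod (iexp (-(t * a))) + cmod (iexp (-(t * x)))"
        by (rule norm_triangle_ineq4)
      also have "\<dots> = 2" using norm_exp_i_times[of "-(t*a)"] norm_exp_i_times[of "-(t*x)"] by simp
      finally show ?thesis by (simp add: K_def norm_divide norm_mult divide_right_mono)
    qed
    define A where "A T \<phi> = 1 / (2 * pi) * (CLBINT t=-ereal T..ereal T. K t * \<phi> t)" for T \<phi>
    have lim: "(\<lambda>T. A (real T) (char \<mu>) - A (real T) (char \<nu>)) \<longlonglongrightarrow> of_real (measure \<mu> {a<..x} - measure \<nu> {a<..x})"
      using tendsto_diff[OF M.Levy_Inversion[OF that atomless(1) atomless(1)] N.Levy_Inversion[OF that atomless(2) atomless(2)]]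
      by (simp add: A_def K_def)
    have int: "integrable lborel (\<lambda>t. indicator {-T<..<T} t *\<^sub>R (K t * \<phi> t))"
      if [measurable]: "\<phi> \<in> borel_measurable borel" and "\<And>t. cmod (\<phi> t) \<le> 1" for \<phi> and T :: real
    proof (rule integrableI_bounded_set_indicator[where B="x - a"])
      show "AE t in lborel. t \<in> {-T<..<T} \<longrightarrow> cmod (K t * \<phi> t) \<le> x - a"
      proof (rule AE_I[where N="{0}"])
        have "cmod (K t * \<phi> t) \<le> x - a" if "t \<noteq> 0" for t
          using mult_mono[OF K1[OF that] \<open>\<And>t. cmod (\<phi> t) \<le> 1\<close>[of t]] \<open>a \<le> x\<close> by (simp add: norm_mult)
        then show "{t \<in> space lborel. \<not> (t \<in> {- T<..<T} \<longrightarrow> cmod (K t * \<phi> t) \<le> x - a)} \<subseteq> {0}"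
          by auto
      qed auto
    qed (use emeasure_bounded_finite[of "{-T<..<T}"] in auto)
    have A_bound: "cmod (A (real T) (char \<mu>) - A (real T) (char \<nu>)) \<le> (1 / pi) * (\<integral>t. g t \<partial>lborel)" for T
    proof -
      let ?T = "real T"
      have eq: "A ?T \<phi> = 1 / (2 * pi) * (\<integral>t. indicator {-?T<..<?T} t *\<^sub>R (K t * \<phi> t) \<partial>lborel)" for \<phi>
        by (simp add: A_def interval_lebesgue_integral_def set_lebesgue_integral_def)
      define D where "D t = indicator {-?T<..<?T} t *\<^sub>R (K t * char \<mu> t)
          - indicator {-?T<..<?T} t *\<^sub>R (K t * char \<nu> t)" for t
      have "A ?T (char \<mu>) - A ?T (char \<nu>) = 1 / (2 * pi) * (\<integral>t. D t \<partial>lborel)"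
        unfolding eq D_def
        by (subst Bochner_Integration.integral_diff[OF int int])
           (auto simp: M.cmod_char_le_1 N.cmod_char_le_1 right_diff_distrib)
      then have "cmod (A ?T (char \<mu>) - A ?T (char \<nu>)) = 1 / (2 * pi) * cmod (\<integral>t. D t \<partial>lborel)"
        by (simp only: norm_mult) (simp add: norm_divide)
      also have "\<dots> \<le> 1 / (2 * pi) * (\<integral>t. 2 * g t \<partial>lborel)"
      proof (intro mult_left_mono order_trans[OF integral_norm_bound integral_mono_AE])
        show "AE t in lborel. cmod (D t) \<le> 2 * g t"
        proof (rule AE_I[where N="{0}"], rule subsetI)
          fix t assume t: "t \<in> {t \<in> space lborel. \<not> cmod (D t) \<le> 2 * g t}"
          show "t \<in> {0}"
          proof (rule ccontr)
            assume "t \<notin> {0}"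
            then have t0: "t \<noteq> 0" by simp
            have g0: "0 \<le> g t" using order_trans[OF norm_ge_zero bound[OF t0]] t0 by (simp add: zero_le_mult_iff)
            have "cmod (K t * char \<mu> t - K t * char \<nu> t) = cmod (K t) * cmod (char \<mu> t - char \<nu> t)"
              by (simp add: norm_mult flip: right_diff_distrib)
            also have "\<dots> \<le> 2 / \<bar>t\<bar> * (\<bar>t\<bar> * g t)"
              by (intro mult_mono K2 bound t0) auto
            also have "\<dots> = 2 * g t" using t0 by simp
            finally show False using t g0 by (auto simp: D_def split: split_indicator_asm)
          qed
        qed auto
      qed (use g int in \<open>auto simp: D_def M.cmod_char_le_1 N.cmod_char_le_1\<close>)
      finally show ?thesis by simp
    qed
    have "cmod (of_real (measure \<mu> {a<..x} - measure \<nu> {a<..x})) \<le> (1 / pi) * (\<integral>t. g t \<partial>lborel)"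
      by (rule LIMSEQ_le_const2[OF tendsto_norm[OF lim]]) (use A_bound in auto)
    then show ?thesis by (simp only: norm_of_real)
  qed
  have lim0: "((\<lambda>a. \<bar>(cdf \<mu> x - cdf \<mu> a) - (cdf \<nu> x - cdf \<nu> a)\<bar>) \<longlongrightarrow> \<bar>(cdf \<mu> x - 0) - (cdf \<nu> x - 0)\<bar>) at_bot"
    by (intro tendsto_intros M.cdf_lim_at_bot N.cdf_lim_at_bot)
  have ev: "\<forall>\<^sub>F a in at_bot. \<bar>(cdf \<mu> x - cdf \<mu> a) - (cdf \<nu> x - cdf \<nu> a)\<bar> \<le> (1 / pi) * (\<integral>t. g t \<partial>lborel)"
    using eventually_le_at_bot[of "x - 1"]
  proof eventually_elim
    case (elim a)
    then have "a < x" by simp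
    then show ?case using main[of a] by (simp add: M.cdf_diff_eq N.cdf_diff_eq)
  qed
  show ?thesis using tendsto_upperbound[OF lim0 ev] by simp
qed

definition gaussian_blur :: "real \<Rightarrow> real measure \<Rightarrow> real measure" where
  "gaussian_blur \<tau> \<mu> = distr (\<mu> \<Otimes>\<^sub>M std_normal_distribution) borel (\<lambda>(s, g). s + \<tau> * g)"

context
  fixes \<mu> :: "real measure" and \<tau> :: real
  assumes mu: "real_distribution \<mu>" and tau: "\<tau> > 0"
begin

interpretation mu: real_distribution \<mu> by (rule mu)
interpretation pr: pair_prob_space \<mu> std_normal_distribution ..

lemma real_distribution_gaussian_blur: "real_distribution (gaussian_blur \<tau> \<mu>)"
  unfolding gaussian_blur_def by (rule pr.real_distribution_distr) measurable

lemma char_gaussian_blur: "char (gaussian_blur \<tau> \<mu>) t = char \<mu> t * exp (- (\<tau> * t)\<^sup>2 / 2)"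
proof -
  have "char (gaussian_blur \<tau> \<mu>) t = (\<integral>p. iexp (t * (fst p + \<tau> * snd p)) \<partial>(\<mu> \<Otimes>\<^sub>M std_normal_distribution))"
    unfolding gaussian_blur_def char_def by (subst integral_distr) (auto simp: case_prod_beta)
  also have "\<dots> = (\<integral>s. (\<integral>g. iexp (t * s) * iexp (\<tau> * t * g) \<partial>std_normal_distribution) \<partial>\<mu>)"
    by (subst pr.integral_fst'[symmetric])
       (auto intro!: pr.integrable_const_bound[where B=1] Bochner_Integration.integral_cong simp: algebra_simps simp flip: exp_add)
  also have "\<dots> = char \<mu> t * char std_normal_distribution (\<tau> * t)"
    by (simp add: char_def)
  finally show ?thesis by (simp add: char_std_normal_distribution)
qed

lemma gaussian_blur_atomless: "measure (gaussian_blur \<tau> \<mu>) {x} = 0"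
proof -
  let ?A = "{p. fst p + \<tau> * snd p = x}"
  have "{p \<in> space (\<mu> \<Otimes>\<^sub>M std_normal_distribution). fst p + \<tau> * snd p = x} \<in> sets (\<mu> \<Otimes>\<^sub>M std_normal_distribution)"
    by measurable
  then have [measurable]: "?A \<in> sets (\<mu> \<Otimes>\<^sub>M std_normal_distribution)"
    by (simp add: space_pair_measure)
  have "emeasure (gaussian_blur \<tau> \<mu>) {x} = emeasure (\<mu> \<Otimes>\<^sub>M std_normal_distribution) ?A"
    unfolding gaussian_blur_def by (subst emeasure_distr) (auto intro!: arg_cong2[where f=emeasure] simp: space_pair_measure)
  also have "\<dots> = (\<integral>\<^sup>+s. emeasure std_normal_distribution (Pair s -` ?A) \<partial>\<mu>)"
    by (rule std_normal.emeasure_pair_measure_alt) measurable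
  also have "\<dots> = (\<integral>\<^sup>+s. 0 \<partial>\<mu>)"
  proof (rule nn_integral_cong)
    fix s
    have "Pair s -` ?A = {(x - s) / \<tau>}" using tau by (auto simp: field_simps)
    moreover have "emeasure std_normal_distribution {y} = 0" for y :: real
      by (subst emeasure_density) (auto simp: nn_integral_0_iff_AE intro!: AE_I[where N="{y}"])
    ultimately show "emeasure std_normal_distribution (Pair s -` ?A) = 0" by simp
  qed
  finally show ?thesis by (simp add: measure_def)
qed

text \<open>The added Gaussian term exceeds \<open>\<tau> r\<close> only with probability \<open>2 exp (- r\<^sup>2 / 2)\<close>, so blurring can be undone
  at the price of a shift by \<open>\<tau> r\<close>.\<close>
lemma cdf_gaussian_blur:
  assumes "0 \<le> r"
  shows "cdf \<mu> x \<le> cdf (gaussian_blur \<tau> \<mu>) (x + \<tau> * r) + 2 * exp (- r\<^sup>2 / 2)"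
    and "cdf (gaussian_blur \<tau> \<mu>) x \<le> cdf \<mu> (x + \<tau> * r) + 2 * exp (- r\<^sup>2 / 2)"
proof -
  let ?P = "measure (\<mu> \<Otimes>\<^sub>M std_normal_distribution)"
  let ?T = "UNIV \<times> {y::real. r < \<bar>y\<bar>}"
  have prS: "?P (A \<times> B) = measure \<mu> A * measure std_normal_distribution B"
    if "A \<in> sets borel" "B \<in> sets borel" for A B
    using that by (simp add: measure_def std_normal.emeasure_pair_measure_Times enn2real_mult)
  have sp: "space (\<mu> \<Otimes>\<^sub>M std_normal_distribution) = UNIV" by (simp add: space_pair_measure)
  have cm: "cdf \<mu> y = ?P ({..y} \<times> UNIV)" for y
    by (subst prS) (auto simp: cdf_def std_normal.prob_space[simplified])
  have cb: "cdf (gaussian_blur \<tau> \<mu>) y = ?P {p. fst p + \<tau> * snd p \<le> y}" for y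
    unfolding gaussian_blur_def cdf_def
    by (subst measure_distr) (auto intro!: arg_cong2[where f=measure] simp: sp)
  have "{p \<in> space (\<mu> \<Otimes>\<^sub>M std_normal_distribution). fst p + \<tau> * snd p \<le> y} \<in> sets (\<mu> \<Otimes>\<^sub>M std_normal_distribution)" for y
    by measurable
  then have [measurable]: "{p. fst p + \<tau> * snd p \<le> y} \<in> sets (\<mu> \<Otimes>\<^sub>M std_normal_distribution)" for y
    by (simp add: sp)
  then have [simp]: "{p. fst p + \<tau> * snd p \<le> y} \<in> sets (borel \<Otimes>\<^sub>M borel)" for y
    by (simp cong: sets_pair_measure_cong)
  have [measurable]: "{y::real. r < \<bar>y\<bar>} \<in> sets borel" by measurable
  have tail: "?P ?T \<le> 2 * exp (- r\<^sup>2 / 2)"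
  proof -
    have "?P ?T = measure std_normal_distribution {y. r < \<bar>y\<bar>}" 
      using mu.prob_space by (subst prS) auto
    also have "\<dots> \<le> measure std_normal_distribution ({..- r} \<union> {r<..})"
      by (intro std_normal.finite_measure_mono) auto
    also have "\<dots> \<le> measure std_normal_distribution {..-r} + measure std_normal_distribution {r<..}"
      by (rule measure_Un_le) auto
    also have "measure std_normal_distribution {r<..} = 1 - std_normal_cdf r"
      by (rule std_normal_tail_eq)
    finally show ?thesis using std_normal_tail_le[OF assms] by (simp add: cdf_def)
  qed
  have "?P ({..x} \<times> UNIV) \<le> ?P ({p. fst p + \<tau> * snd p \<le> x + \<tau> * r} \<union> ?T)"
  proof (intro pr.finite_measure_mono subsetI)
    fix p :: "real \<times> real" assume "p \<in> {..x} \<times> UNIV"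
    then show "p \<in> {p. fst p + \<tau> * snd p \<le> x + \<tau> * r} \<union> ?T"
      using tau by (cases p) (auto simp: not_less intro!: add_mono)
  qed measurable
  also have "\<dots> \<le> ?P {p. fst p + \<tau> * snd p \<le> x + \<tau> * r} + ?P ?T"
    by (rule measure_Un_le) auto
  finally show "cdf \<mu> x \<le> cdf (gaussian_blur \<tau> \<mu>) (x + \<tau> * r) + 2 * exp (- r\<^sup>2 / 2)"
    using tail by (simp add: cm cb)
  have "?P {p. fst p + \<tau> * snd p \<le> x} \<le> ?P ({..x + \<tau> * r} \<times> UNIV \<union> ?T)"
  proof (intro pr.finite_measure_mono subsetI)
    fix p :: "real \<times> real" assume "p \<in> {p. fst p + \<tau> * snd p \<le> x}"
    then show "p \<in> {..x + \<tau> * r} \<times> UNIV \<union> ?T"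
      using tau mult_left_mono[of "- snd p" r \<tau>] by (cases p) (auto simp: not_less abs_le_iff)
  qed measurable
  also have "\<dots> \<le> ?P ({..x + \<tau> * r} \<times> UNIV) + ?P ?T"
    by (rule measure_Un_le) auto
  finally show "cdf (gaussian_blur \<tau> \<mu>) x \<le> cdf \<mu> (x + \<tau> * r) + 2 * exp (- r\<^sup>2 / 2)"
    using tail by (simp add: cm cb)
qed

end

text \<open>Both laws are blurred, compared by Fourier inversion, and unblurred. The Gaussian factor in the hypothesis
  makes the frequencies integrable at which nothing is known about the characteristic functions; the
  error terms are the two shifts and the four tails.\<close>
lemma gaussian_smoothing_inequality:
  fixes g :: "real \<Rightarrow> real"
  assumes mu: "real_distribution \<mu>" and nu: "real_distribution \<nu>"
    and Lip: "\<And>x y. \<bar>cdf \<nu> x - cdf \<nu> y\<bar> \<le> \<bar>x - y\<bar>"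
    and "\<tau> > 0" "r \<ge> 0"
    and g: "integrable lborel g"
    and bound: "\<And>t. t \<noteq> 0 \<Longrightarrow> cmod (char \<mu> t - char \<nu> t) * exp (- (\<tau> * t)\<^sup>2 / 2) \<le> \<bar>t\<bar> * g t"
  shows "\<bar>cdf \<mu> x - cdf \<nu> x\<bar> \<le> (1 / pi) * (\<integral>t. g t \<partial>lborel) + 2 * \<tau> * r + 4 * exp (- r\<^sup>2 / 2)"
proof -
  have I: "\<bar>cdf (gaussian_blur \<tau> \<mu>) x - cdf (gaussian_blur \<tau> \<nu>) x\<bar> \<le> (1 / pi) * (\<integral>t. g t \<partial>lborel)" for x
  proof (rule cdf_diff_le_char_integral)
    fix t :: real assume "t \<noteq> 0"
    have "cmod (char (gaussian_blur \<tau> \<mu>) t - char (gaussian_blur \<tau> \<nu>) t)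
        = cmod ((char \<mu> t - char \<nu> t) * complex_of_real (exp (- (\<tau> * t)\<^sup>2 / 2)))"
      using \<open>\<tau> > 0\<close> by (simp add: char_gaussian_blur mu nu algebra_simps)
    also have "\<dots> \<le> \<bar>t\<bar> * g t"
      unfolding norm_mult norm_of_real using bound[OF \<open>t \<noteq> 0\<close>] by simp
    finally show "cmod (char (gaussian_blur \<tau> \<mu>) t - char (gaussian_blur \<tau> \<nu>) t) \<le> \<bar>t\<bar> * g t" .
  qed (use assms in \<open>auto simp: real_distribution_gaussian_blur gaussian_blur_atomless\<close>)
  let ?w = "\<tau> * r"
  have w: "0 \<le> ?w" using assms by simp
  note bm = cdf_gaussian_blur[OF mu \<open>\<tau> > 0\<close> \<open>r \<ge> 0\<close>] and bn = cdf_gaussian_blur[OF nu \<open>\<tau> > 0\<close> \<open>r \<ge> 0\<close>]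
  have "cdf \<mu> x \<le> cdf \<nu> (x + ?w + ?w) + (1 / pi) * (\<integral>t. g t \<partial>lborel) + 4 * exp (- r\<^sup>2 / 2)"
    using bm(1)[of x] I[of "x + ?w"] bn(2)[of "x + ?w"] by linarith
  moreover have "cdf \<nu> (x - ?w - ?w) \<le> cdf \<mu> x + (1 / pi) * (\<integral>t. g t \<partial>lborel) + 4 * exp (- r\<^sup>2 / 2)"
    using bn(1)[of "x - ?w - ?w"] I[of "x - ?w"] bm(2)[of "x - ?w"] by simp
  ultimately show ?thesis
    using Lip[of "x + ?w + ?w" x] Lip[of x "x - ?w - ?w"] w by linarith
qed

section \<open>Exponential moments of one bounded summand\<close>

lemma exp_Taylor_half:
  fixes z :: "'a :: {real_normed_field, banach}"
  assumes "norm z \<le> 1 / 2"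
  shows "norm (exp z - 1 - z) \<le> (norm z)\<^sup>2"
    and "norm (exp z - 1 - z - z\<^sup>2 / 2) \<le> norm z ^ 3"
proof -
  have tail: "norm (\<Sum>n. inverse (fact (n + k)) *\<^sub>R z ^ (n + k)) \<le> norm z ^ k" if "k \<ge> 2" for k
  proof -
    have le: "norm (inverse (fact (n + k)) *\<^sub>R z ^ (n + k)) \<le> norm z ^ k * ((1 / 2) * (1 / 2) ^ n)" for n
    proof -
      have "fact 2 \<le> (fact (n + k) :: real)" using that by (intro fact_mono) auto
      then have "inverse (fact (n + k)) \<le> (1 / 2 :: real)" by (simp add: field_simps)
      moreover have "norm z ^ n \<le> (1 / 2) ^ n" using assms by (intro power_mono) auto
      ultimately have "inverse (fact (n + k)) * (norm z ^ n * norm z ^ k) \<le> 1 / 2 * ((1 / 2) ^ n * norm z ^ k)"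
        by (intro mult_mono mult_right_mono) auto
      then show ?thesis by (simp add: norm_power norm_mult power_add mult_ac)
    qed
    have sums: "(\<lambda>n. norm z ^ k * ((1 / 2) * (1 / 2) ^ n)) sums (norm z ^ k * ((1 / 2) * (1 / (1 - 1 / 2))))"
      by (intro sums_mult geometric_sums) auto
    have "norm (\<Sum>n. inverse (fact (n + k)) *\<^sub>R z ^ (n + k)) \<le> (\<Sum>n. norm z ^ k * ((1 / 2) * (1 / 2) ^ n))"
      using le sums_summable[OF sums] by (intro norm_suminf_le)
    also have "\<dots> = norm z ^ k" using sums_unique[OF sums] by simp
    finally show ?thesis .
  qed
  show "norm (exp z - 1 - z) \<le> (norm z)\<^sup>2"
    using exp_first_terms[of z 2] tail[of 2] by (simp add: eval_nat_numeral)
  show "norm (exp z - 1 - z - z\<^sup>2 / 2) \<le> norm z ^ 3"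
    using exp_first_terms[of z 3] tail[of 3] by (simp add: eval_nat_numeral scaleR_conv_of_real algebra_simps)
qed

lemma norm_prod_minus_1_le_exp:
  fixes f :: "'i \<Rightarrow> 'b :: real_normed_field"
  shows "norm ((\<Prod>i\<in>A. 1 + f i) - 1) \<le> exp (\<Sum>i\<in>A. norm (f i)) - 1"
proof (induction A rule: infinite_finite_induct)
  case (insert x A)
  let ?P = "\<Prod>i\<in>A. 1 + f i" and ?S = "\<Sum>i\<in>A. norm (f i)"
  have "norm ((\<Prod>i\<in>insert x A. 1 + f i) - 1) = norm ((?P - 1) * (1 + f x) + f x)"
    using insert by (simp add: algebra_simps)
  also have "\<dots> \<le> norm (?P - 1) * norm (1 + f x) + norm (f x)"
    by (metis norm_mult norm_triangle_ineq)
  also have "\<dots> \<le> (exp ?S - 1) * (1 + norm (f x)) + norm (f x)"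
    using insert.IH norm_triangle_ineq[of 1 "f x"] by (intro add_mono mult_mono) (auto intro!: sum_nonneg)
  also have "\<dots> = exp ?S * (1 + norm (f x)) - 1" by (simp add: algebra_simps)
  also have "\<dots> \<le> exp ?S * exp (norm (f x)) - 1" by (simp add: exp_ge_add_one_self)
  finally show ?case using insert by (simp add: exp_add mult.commute)
qed auto

lemma exp_minus_1_le: "exp (x::real) - 1 \<le> x * exp x"
  using exp_ge_add_one_self[of "- x"] mult_right_mono[of "1 - x" "exp (- x)" "exp x"]
  by (simp add: algebra_simps exp_minus)

lemma gaussian_integral:
  fixes a :: real
  assumes "a > 0"
  shows "has_bochner_integral lborel (\<lambda>t. exp (- (a * t\<^sup>2))) (sqrt (pi / a))"
proof -
  define \<sigma> where "\<sigma> = sqrt (1 / (2 * a))"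
  have s: "\<sigma> > 0" "\<sigma>\<^sup>2 = 1 / (2 * a)" using assms by (auto simp: \<sigma>_def)
  have "has_bochner_integral lborel (normal_density 0 \<sigma>) 1"
    using s by (simp add: has_bochner_integral_iff)
  then have "has_bochner_integral lborel (\<lambda>t. sqrt (pi / a) * normal_density 0 \<sigma> t) (sqrt (pi / a) * 1)"
    by (rule has_bochner_integral_mult_right)
  moreover have "sqrt (pi / a) * normal_density 0 \<sigma> t = exp (- (a * t\<^sup>2))" for t
    using assms s by (simp add: normal_density_def)
  ultimately show ?thesis by simp
qed

lemma (in prob_space) abs_expectation_diff_le:
  fixes f g :: "'a \<Rightarrow> 'b :: {banach, second_countable_topology}"
  assumes "integrable M f" "integrable M g" "integrable M h" "\<And>\<omega>. \<omega> \<in> space M \<Longrightarrow> norm (f \<omega> - g \<omega>) \<le> h \<omega>"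
  shows "norm (expectation f - expectation g) \<le> expectation h"
proof -
  have "norm (expectation f - expectation g) = norm (expectation (\<lambda>\<omega>. f \<omega> - g \<omega>))"
    using assms by simp
  also have "\<dots> \<le> expectation h"
    using assms by (intro order_trans[OF integral_norm_bound integral_mono]) auto
  finally show ?thesis .
qed

text \<open>A single summand. The tilt parameter \<open>la\<close> below is always so small that \<open>la X\<close> stays in \<open>[-1/2, 1/2]\<close>, where
  the exponential function is close to its Taylor polynomials.\<close>
locale bounded_centred_variable = prob_space +
  fixes X :: "'a \<Rightarrow> real" and B :: real
  assumes measurable_X[measurable]: "X \<in> borel_measurable M"
    and B_pos: "0 < B"
    and bounded_X: "\<And>\<omega>. \<omega> \<in> space M \<Longrightarrow> \<bar>X \<omega>\<bar> \<le> B"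
    and centred_X: "expectation X = 0"
begin

definition "v = expectation (\<lambda>\<omega>. (X \<omega>)\<^sup>2)"

lemma exp_X_le: "\<omega> \<in> space M \<Longrightarrow> exp (la * X \<omega>) \<le> exp (\<bar>la\<bar> * B)"
proof -
  assume "\<omega> \<in> space M"
  then have "\<bar>la * X \<omega>\<bar> \<le> \<bar>la\<bar> * B"
    unfolding abs_mult using bounded_X by (intro mult_left_mono) auto
  then show ?thesis by simp
qed

lemma integrable_tilted [simp]:
  "integrable M (\<lambda>\<omega>. X \<omega> ^ k * exp (la * X \<omega>))"
proof (rule integrable_const_bound[where B = "B ^ k * exp (\<bar>la\<bar> * B)"])
  show "AE \<omega> in M. norm (X \<omega> ^ k * exp (la * X \<omega>)) \<le> B ^ k * exp (\<bar>la\<bar> * B)"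
  proof (rule AE_I2)
    fix \<omega> assume w: "\<omega> \<in> space M"
    have "\<bar>X \<omega>\<bar> ^ k * exp (la * X \<omega>) \<le> B ^ k * exp (\<bar>la\<bar> * B)"
      using bounded_X[OF w] exp_X_le[OF w, of la] B_pos by (intro mult_mono power_mono) auto
    then show "norm (X \<omega> ^ k * exp (la * X \<omega>)) \<le> B ^ k * exp (\<bar>la\<bar> * B)"
      by (simp add: abs_mult power_abs)
  qed
qed measurable

lemma integrable_powers [simp]: "integrable M (\<lambda>\<omega>. X \<omega> ^ k)" "integrable M X"
  "integrable M (\<lambda>\<omega>. exp (la * X \<omega>))" "integrable M (\<lambda>\<omega>. X \<omega> * exp (la * X \<omega>))"
  using integrable_tilted[of k 0] integrable_tilted[of 1 0] integrable_tilted[of 0 la]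
    integrable_tilted[of 1 la] by simp_all

lemma v_nonneg: "0 \<le> v" unfolding v_def by (intro integral_nonneg_AE) auto

lemma v_le: "v \<le> B\<^sup>2"
proof -
  have "v \<le> expectation (\<lambda>_. B\<^sup>2)" unfolding v_def
    using bounded_X by (intro integral_mono) (auto simp: abs_le_square_iff[symmetric] B_pos less_imp_le)
  then show ?thesis by (simp add: prob_space)
qed

context
  fixes la :: real
  assumes lam: "0 \<le> la" "la * B \<le> 1 / 2"
begin

lemma small_exponent: "\<omega> \<in> space M \<Longrightarrow> \<bar>la * X \<omega>\<bar> \<le> 1 / 2"
  using bounded_X[of \<omega>] lam mult_left_mono[of "\<bar>X \<omega>\<bar>" B la] by (simp add: abs_mult)

lemma lam_v: "la * v \<le> B / 2" "0 \<le> la * v"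
proof -
  have "la * v \<le> la * B\<^sup>2" using lam v_le by (intro mult_left_mono)
  also have "\<dots> = (la * B) * B" by (simp add: power2_eq_square)
  also have "\<dots> \<le> 1 / 2 * B" using lam B_pos by (intro mult_right_mono) auto
  finally show "la * v \<le> B / 2" by simp
qed (use lam v_nonneg in auto)

text \<open>Moments and Fourier transform of the law tilted by \<open>exp (la X)\<close>, without the normalising factor
  \<open>tilted_moment 0\<close>.\<close>
definition "tilted_moment k = expectation (\<lambda>\<omega>. X \<omega> ^ k * exp (la * X \<omega>))"

text \<open>The bounds for the moments of order 0, 1 and 2 say that the tilted law looks, up to relative errors of order
  \<open>la B\<close>, like a Gaussian with mean \<open>la v\<close> and variance \<open>v\<close>.\<close>
lemma tilted_moment_0: "\<bar>tilted_moment 0 - 1\<bar> \<le> la\<^sup>2 * v" "1 \<le> tilted_moment 0" "\<bar>tilted_moment 0 - 1 - la\<^sup>2 * v / 2\<bar> \<le> la ^ 3 * (B * v)"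
proof -
  have E1: "expectation (\<lambda>\<omega>. 1 + la * X \<omega>) = 1"
    using centred_X by (simp add: prob_space)
  have E2: "expectation (\<lambda>\<omega>. 1 + la * X \<omega> + la\<^sup>2 * (X \<omega>)\<^sup>2 / 2) = 1 + la\<^sup>2 * v / 2"
    using centred_X by (simp add: prob_space v_def)
  have "norm (tilted_moment 0 - expectation (\<lambda>\<omega>. 1 + la * X \<omega>)) \<le> expectation (\<lambda>\<omega>. la\<^sup>2 * (X \<omega>)\<^sup>2)"
    unfolding tilted_moment_def
  proof (rule abs_expectation_diff_le)
    fix \<omega> assume "\<omega> \<in> space M"
    then show "norm (X \<omega> ^ 0 * exp (la * X \<omega>) - (1 + la * X \<omega>)) \<le> la\<^sup>2 * (X \<omega>)\<^sup>2"
      using exp_Taylor_half(1)[of "la * X \<omega>"] small_exponent by (simp add: power_mult_distrib algebra_simps)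
  qed (auto)
  then show "\<bar>tilted_moment 0 - 1\<bar> \<le> la\<^sup>2 * v" by (simp add: E1 v_def)
  have "expectation (\<lambda>\<omega>. 1 + la * X \<omega>) \<le> tilted_moment 0" unfolding tilted_moment_def
    by (intro integral_mono) (auto intro: exp_ge_add_one_self)
  then show "1 \<le> tilted_moment 0" by (simp add: E1)
  have "norm (tilted_moment 0 - expectation (\<lambda>\<omega>. 1 + la * X \<omega> + la\<^sup>2 * (X \<omega>)\<^sup>2 / 2)) \<le> expectation (\<lambda>\<omega>. la ^ 3 * (B * (X \<omega>)\<^sup>2))"
    unfolding tilted_moment_def
  proof (rule abs_expectation_diff_le)
    fix \<omega> assume w: "\<omega> \<in> space M"
    have "norm (X \<omega> ^ 0 * exp (la * X \<omega>) - (1 + la * X \<omega> + la\<^sup>2 * (X \<omega>)\<^sup>2 / 2)) \<le> \<bar>la * X \<omega>\<bar> ^ 3"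
      using exp_Taylor_half(2)[of "la * X \<omega>"] small_exponent[OF w] by (simp add: power_mult_distrib algebra_simps)
    also have "\<dots> = la ^ 3 * (\<bar>X \<omega>\<bar> * (X \<omega>)\<^sup>2)"
      using lam by (simp add: abs_mult power_mult_distrib power3_eq_cube power2_eq_square)
    also have "\<dots> \<le> la ^ 3 * (B * (X \<omega>)\<^sup>2)"
      using lam bounded_X[OF w] by (intro mult_left_mono mult_right_mono) auto
    finally show "norm (X \<omega> ^ 0 * exp (la * X \<omega>) - (1 + la * X \<omega> + la\<^sup>2 * (X \<omega>)\<^sup>2 / 2)) \<le> la ^ 3 * (B * (X \<omega>)\<^sup>2)" .
  qed (auto)
  then show "\<bar>tilted_moment 0 - 1 - la\<^sup>2 * v / 2\<bar> \<le> la ^ 3 * (B * v)" unfolding E2 by (simp add: v_def algebra_simps)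
qed

lemma exp_small: "\<omega> \<in> space M \<Longrightarrow> \<bar>exp (la * X \<omega>) - 1\<bar> \<le> 2 * \<bar>la * X \<omega>\<bar>"
proof -
  assume w: "\<omega> \<in> space M"
  let ?y = "la * X \<omega>"
  have "?y\<^sup>2 = \<bar>?y\<bar> * \<bar>?y\<bar>" by (metis abs_mult_self_eq power2_eq_square)
  also have "\<dots> \<le> 1 * \<bar>?y\<bar>" using small_exponent[OF w] by (intro mult_right_mono) auto
  finally have "?y\<^sup>2 \<le> \<bar>?y\<bar>" by simp
  then show ?thesis using exp_Taylor_half(1)[of ?y] small_exponent[OF w] unfolding real_norm_def power2_abs by linarith
qed

lemma tilted_moment_1: "\<bar>tilted_moment 1 - la * v\<bar> \<le> la\<^sup>2 * (B * v)"
proof -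
  have E: "expectation (\<lambda>\<omega>. X \<omega> + la * (X \<omega>)\<^sup>2) = la * v"
    using centred_X by (simp add: v_def)
  have "norm (tilted_moment 1 - expectation (\<lambda>\<omega>. X \<omega> + la * (X \<omega>)\<^sup>2)) \<le> expectation (\<lambda>\<omega>. la\<^sup>2 * (B * (X \<omega>)\<^sup>2))"
    unfolding tilted_moment_def
  proof (rule abs_expectation_diff_le)
    fix \<omega> assume w: "\<omega> \<in> space M"
    have "X \<omega> ^ 1 * exp (la * X \<omega>) - (X \<omega> + la * (X \<omega>)\<^sup>2) = X \<omega> * (exp (la * X \<omega>) - 1 - la * X \<omega>)"
      by (simp add: algebra_simps power2_eq_square)
    also have "norm \<dots> \<le> B * (la * X \<omega>)\<^sup>2"
      unfolding norm_mult using exp_Taylor_half(1)[of "la * X \<omega>"] small_exponent[OF w] bounded_X[OF w] B_pos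
      by (intro mult_mono) (auto simp only: real_norm_def power2_abs)
    finally show "norm (X \<omega> ^ 1 * exp (la * X \<omega>) - (X \<omega> + la * (X \<omega>)\<^sup>2)) \<le> la\<^sup>2 * (B * (X \<omega>)\<^sup>2)"
      by (simp add: power_mult_distrib mult_ac)
  qed auto
  then show ?thesis by (simp add: E v_def)
qed

lemma tilted_moment_2: "\<bar>tilted_moment 2 - v\<bar> \<le> 2 * la * (B * v)"
proof -
  have "norm (tilted_moment 2 - v) \<le> expectation (\<lambda>\<omega>. 2 * la * (B * (X \<omega>)\<^sup>2))"
    unfolding tilted_moment_def v_def
  proof (rule abs_expectation_diff_le)
    fix \<omega> assume w: "\<omega> \<in> space M"
    have "(X \<omega>)\<^sup>2 * exp (la * X \<omega>) - (X \<omega>)\<^sup>2 = (X \<omega>)\<^sup>2 * (exp (la * X \<omega>) - 1)"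
      by (simp add: algebra_simps)
    also have "norm \<dots> \<le> (X \<omega>)\<^sup>2 * (2 * \<bar>la * X \<omega>\<bar>)"
      using exp_small[OF w] by (auto simp: abs_mult intro!: mult_left_mono)
    also have "\<dots> \<le> (X \<omega>)\<^sup>2 * (2 * (la * B))"
      unfolding abs_mult using bounded_X[OF w] lam by (intro mult_mono) auto
    finally show "norm ((X \<omega>)\<^sup>2 * exp (la * X \<omega>) - (X \<omega>)\<^sup>2) \<le> 2 * la * (B * (X \<omega>)\<^sup>2)"
      by (simp add: mult_ac)
  qed auto
  then show ?thesis by (simp add: v_def)
qed

definition "tilted_fourier t = expectation (\<lambda>\<omega>. iexp (t * X \<omega>) * exp (la * X \<omega>))"

lemma integrable_tilted_fourier: "integrable M (\<lambda>\<omega>. iexp (t * X \<omega>) * complex_of_real (exp (la * X \<omega>)))"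
  using exp_X_le[of _ la]
  by (intro integrable_const_bound[where B = "exp (\<bar>la\<bar> * B)"]) (auto simp: norm_mult)

lemma tilted_fourier_Taylor: "cmod (tilted_fourier t - (tilted_moment 0 + \<i> * t * tilted_moment 1 - t\<^sup>2 * tilted_moment 2 / 2)) \<le> \<bar>t\<bar> ^ 3 * (B * v) / 3"
proof -
  let ?P = "\<lambda>\<omega>. (1 + \<i> * (t * X \<omega>) - (t * X \<omega>)\<^sup>2 / 2) * exp (la * X \<omega>)"
  have P: "?P = (\<lambda>\<omega>. complex_of_real (X \<omega> ^ 0 * exp (la * X \<omega>)) + \<i> * t * complex_of_real (X \<omega> ^ 1 * exp (la * X \<omega>))
      - t\<^sup>2 / 2 * complex_of_real (X \<omega> ^ 2 * exp (la * X \<omega>)))"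
    by (auto simp: algebra_simps power2_eq_square)
  have lin: "integrable M (\<lambda>\<omega>. complex_of_real (f0 \<omega>) + c * complex_of_real (f1 \<omega>) - d * complex_of_real (f2 \<omega>))"
      "expectation (\<lambda>\<omega>. complex_of_real (f0 \<omega>) + c * complex_of_real (f1 \<omega>) - d * complex_of_real (f2 \<omega>))
        = expectation f0 + c * expectation f1 - d * expectation f2"
    if "integrable M f0" "integrable M f1" "integrable M f2" for f0 f1 f2 :: "'a \<Rightarrow> real" and c d :: complex
    using that by auto
  note lin' = lin[OF integrable_tilted[of 0 la] integrable_tilted[of 1 la] integrable_tilted[of 2 la],
      of "\<i> * t" "t\<^sup>2 / 2"]
  have EP: "expectation ?P = tilted_moment 0 + \<i> * t * tilted_moment 1 - t\<^sup>2 * tilted_moment 2 / 2"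
    using lin'(2) unfolding P tilted_moment_def by simp
  have "norm (tilted_fourier t - expectation ?P) \<le> expectation (\<lambda>\<omega>. \<bar>t\<bar> ^ 3 * (B * (X \<omega>)\<^sup>2) / 3)"
    unfolding tilted_fourier_def
  proof (rule abs_expectation_diff_le[OF integrable_tilted_fourier])
    show "integrable M ?P" using lin'(1) unfolding P by simp
    fix \<omega> assume w: "\<omega> \<in> space M"
    have "(\<Sum>k\<le>2. (\<i> * complex_of_real (t * X \<omega>)) ^ k / fact k) = 1 + \<i> * (t * X \<omega>) - (t * X \<omega>)\<^sup>2 / 2"
      by (simp add: numeral_2_eq_2 power2_eq_square algebra_simps)
    then have "cmod (iexp (t * X \<omega>) - (1 + \<i> * (t * X \<omega>) - (t * X \<omega>)\<^sup>2 / 2)) \<le> \<bar>t * X \<omega>\<bar> ^ 3 / 6"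
      using iexp_approx1[of "t * X \<omega>" 2] by (simp add: eval_nat_numeral)
    moreover have "exp (la * X \<omega>) \<le> 2"
      using exp_small[OF w] small_exponent[OF w] by simp
    ultimately have "cmod ((iexp (t * X \<omega>) - (1 + \<i> * (t * X \<omega>) - (t * X \<omega>)\<^sup>2 / 2)) * exp (la * X \<omega>)) \<le> \<bar>t * X \<omega>\<bar> ^ 3 / 6 * 2"
      unfolding norm_mult by (intro mult_mono) auto
    also have "\<dots> = \<bar>t\<bar> ^ 3 * (\<bar>X \<omega>\<bar> * (X \<omega>)\<^sup>2) / 3"
      by (simp add: abs_mult power_mult_distrib power3_eq_cube power2_eq_square)
    also have "\<dots> \<le> \<bar>t\<bar> ^ 3 * (B * (X \<omega>)\<^sup>2) / 3"
      using bounded_X[OF w] by (intro divide_right_mono mult_left_mono mult_right_mono) auto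
    finally show "norm (iexp (t * X \<omega>) * exp (la * X \<omega>) - ?P \<omega>) \<le> \<bar>t\<bar> ^ 3 * (B * (X \<omega>)\<^sup>2) / 3"
      by (simp add: algebra_simps)
  qed auto
  then show ?thesis unfolding EP by (simp add: v_def)
qed

text \<open>Comparison with the Gaussian characteristic function \<open>exp y\<close> in relative terms: the ratios of the summands
  can then be multiplied. Every term of the error carries a factor \<open>\<bar>t\<bar>\<close>, which is what the inversion formula
  needs near frequency 0.\<close>
lemma tilted_fourier_approx:
  fixes t :: real and y :: complex
  assumes t: "\<bar>t\<bar> * B \<le> 1 / 2"
  defines "y \<equiv> \<i> * complex_of_real (la * v * t) - complex_of_real (v * t\<^sup>2 / 2)"
  shows "cmod (tilted_fourier t / (tilted_moment 0 * exp y) - 1) \<le> 10 * B * v * \<bar>t\<bar> * (la + \<bar>t\<bar>)\<^sup>2"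
proof -
  define q where "q = la + \<bar>t\<bar>"
  define W where "W = B * v * \<bar>t\<bar> * q\<^sup>2"
  have q: "0 \<le> q" using lam by (simp add: q_def)
  have vt: "v * \<bar>t\<bar> \<le> B / 2" "0 \<le> v * \<bar>t\<bar>"
  proof -
    have "v * \<bar>t\<bar> \<le> B\<^sup>2 * \<bar>t\<bar>" using v_le by (intro mult_right_mono) auto
    also have "\<dots> = B * (\<bar>t\<bar> * B)" by (simp add: power2_eq_square)
    also have "\<dots> \<le> B * (1 / 2)" using t B_pos by (intro mult_left_mono) auto
    finally show "v * \<bar>t\<bar> \<le> B / 2" by simp
  qed (use v_nonneg in auto)
  have ny: "cmod y \<le> (la * v) * \<bar>t\<bar> + (v * \<bar>t\<bar>) * \<bar>t\<bar> / 2"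
  proof -
    have "cmod y \<le> cmod (\<i> * complex_of_real (la * v * t)) + cmod (complex_of_real (v * t\<^sup>2 / 2))"
      unfolding y_def by (rule norm_triangle_ineq4)
    also have "\<dots> = (la * v) * \<bar>t\<bar> + (v * \<bar>t\<bar>) * \<bar>t\<bar> / 2"
      using lam v_nonneg by (simp add: norm_mult norm_divide abs_mult power2_eq_square)
    finally show ?thesis .
  qed
  have y_half: "cmod y \<le> 1 / 2"
  proof -
    have "(la * v) * \<bar>t\<bar> \<le> (B / 2) * \<bar>t\<bar>" "(v * \<bar>t\<bar>) * \<bar>t\<bar> \<le> (B / 2) * \<bar>t\<bar>"
      using mult_right_mono[OF lam_v(1), of "\<bar>t\<bar>"] mult_right_mono[OF vt(1), of "\<bar>t\<bar>"] by auto
    then show ?thesis using ny t by (simp add: algebra_simps)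
  qed
  have y2: "(cmod y)\<^sup>2 \<le> W / 2"
  proof -
    have "cmod y \<le> (v * \<bar>t\<bar>) * q"
    proof -
      have "0 \<le> (v * \<bar>t\<bar>) * \<bar>t\<bar>" by (rule mult_nonneg_nonneg[OF vt(2)]) simp
      moreover have "(v * \<bar>t\<bar>) * q = (la * v) * \<bar>t\<bar> + (v * \<bar>t\<bar>) * \<bar>t\<bar>" by (simp add: q_def algebra_simps)
      ultimately show ?thesis using ny by linarith
    qed
    then have "(cmod y)\<^sup>2 \<le> ((v * \<bar>t\<bar>) * q)\<^sup>2" by (intro power_mono) auto
    also have "\<dots> = (v * \<bar>t\<bar>) * ((v * \<bar>t\<bar>) * q\<^sup>2)" by (simp add: power2_eq_square)
    also have "\<dots> \<le> (B / 2) * ((v * \<bar>t\<bar>) * q\<^sup>2)" using vt by (intro mult_right_mono) auto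
    finally show ?thesis by (simp add: W_def mult_ac)
  qed
  have la2v: "la\<^sup>2 * v \<le> la * (B / 2)" using mult_left_mono[OF lam_v(1) lam(1)] by (simp add: power2_eq_square)
  have A0_2: "tilted_moment 0 \<le> 2" using tilted_moment_0(1) la2v lam by linarith
  have e1: "cmod (complex_of_real (tilted_moment 0) * (exp y - 1 - y)) \<le> W"
  proof -
    have "tilted_moment 0 * cmod (exp y - 1 - y) \<le> 2 * (W / 2)"
      using A0_2 tilted_moment_0(2) exp_Taylor_half(1)[OF y_half] y2 by (intro mult_mono) auto
    then show ?thesis using tilted_moment_0(2) by (simp add: norm_mult)
  qed
  have e2: "cmod (\<i> * complex_of_real (t * (tilted_moment 1 - tilted_moment 0 * (la * v)))) \<le> \<bar>t\<bar> * (3 / 2 * (la\<^sup>2 * (B * v)))"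
  proof -
    have "tilted_moment 1 - tilted_moment 0 * (la * v) = (tilted_moment 1 - la * v) - (la * v) * (tilted_moment 0 - 1)" by (simp add: algebra_simps)
    also have "\<bar>\<dots>\<bar> \<le> \<bar>tilted_moment 1 - la * v\<bar> + \<bar>(la * v) * (tilted_moment 0 - 1)\<bar>" by (rule abs_triangle_ineq4)
    also have "\<bar>(la * v) * (tilted_moment 0 - 1)\<bar> \<le> (B / 2) * (la\<^sup>2 * v)"
      unfolding abs_mult using lam_v tilted_moment_0(1) lam v_nonneg B_pos by (intro mult_mono) (auto simp: abs_mult)
    finally have "\<bar>tilted_moment 1 - tilted_moment 0 * (la * v)\<bar> \<le> 3 / 2 * (la\<^sup>2 * (B * v))" using tilted_moment_1 by (simp add: algebra_simps)
    then have "\<bar>t\<bar> * \<bar>tilted_moment 1 - tilted_moment 0 * (la * v)\<bar> \<le> \<bar>t\<bar> * (3 / 2 * (la\<^sup>2 * (B * v)))"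
      by (rule mult_left_mono) simp
    then show ?thesis by (simp only: norm_mult norm_ii norm_of_real abs_mult mult_1)
  qed
  have e3: "cmod (complex_of_real (t\<^sup>2 / 2 * (tilted_moment 2 - tilted_moment 0 * v))) \<le> t\<^sup>2 / 2 * (5 / 2 * (la * (B * v)))"
  proof -
    have "tilted_moment 2 - tilted_moment 0 * v = (tilted_moment 2 - v) - v * (tilted_moment 0 - 1)" by (simp add: algebra_simps)
    also have "\<bar>\<dots>\<bar> \<le> \<bar>tilted_moment 2 - v\<bar> + \<bar>v * (tilted_moment 0 - 1)\<bar>" by (rule abs_triangle_ineq4)
    also have "\<bar>v * (tilted_moment 0 - 1)\<bar> \<le> v * (la\<^sup>2 * v)"
      unfolding abs_mult using tilted_moment_0(1) v_nonneg by (intro mult_mono) auto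
    also have "v * (la\<^sup>2 * v) \<le> v * (la * (B / 2))" using la2v v_nonneg by (intro mult_left_mono)
    finally have "\<bar>tilted_moment 2 - tilted_moment 0 * v\<bar> \<le> 5 / 2 * (la * (B * v))" using tilted_moment_2 by (simp add: algebra_simps)
    then show ?thesis unfolding norm_of_real abs_mult by (intro mult_mono) auto
  qed
  \<comment> \<open>The Taylor remainder of the transform, the errors in mean and second moment, and the Taylor remainder of \<open>exp y\<close>.\<close>
  have "tilted_fourier t - tilted_moment 0 * exp y = (tilted_fourier t - (tilted_moment 0 + \<i> * t * tilted_moment 1 - t\<^sup>2 * tilted_moment 2 / 2))
      + \<i> * complex_of_real (t * (tilted_moment 1 - tilted_moment 0 * (la * v))) - complex_of_real (t\<^sup>2 / 2 * (tilted_moment 2 - tilted_moment 0 * v))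
      - complex_of_real (tilted_moment 0) * (exp y - 1 - y)"
    unfolding y_def by (simp add: algebra_simps)
  also have "cmod \<dots> \<le> \<bar>t\<bar> ^ 3 * (B * v) / 3 + \<bar>t\<bar> * (3 / 2 * (la\<^sup>2 * (B * v)))
      + t\<^sup>2 / 2 * (5 / 2 * (la * (B * v))) + W"
  proof -
    have tri: "cmod (a + b - c - d) \<le> cmod a + cmod b + cmod c + cmod d" for a b c d
      using norm_triangle_ineq4[of "a + b - c" d] norm_triangle_ineq4[of "a + b" c] norm_triangle_ineq[of a b] by linarith
    show ?thesis by (rule order_trans[OF tri]) (intro add_mono tilted_fourier_Taylor e1 e2 e3)
  qed
  also have "\<dots> = B * v * \<bar>t\<bar> * (\<bar>t\<bar>\<^sup>2 / 3 + 3 / 2 * la\<^sup>2 + 5 / 4 * \<bar>t\<bar> * la) + W"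
  proof -
    have "s ^ 3 * c / 3 + s * (3 / 2 * (la\<^sup>2 * c)) + s\<^sup>2 / 2 * (5 / 2 * (la * c))
        = c * s * (s\<^sup>2 / 3 + 3 / 2 * la\<^sup>2 + 5 / 4 * s * la)" for s c
      by (simp add: algebra_simps power3_eq_cube power2_eq_square)
    from this[of "\<bar>t\<bar>" "B * v"] show ?thesis unfolding power2_abs mult.assoc by linarith
  qed
  also have "\<dots> \<le> B * v * \<bar>t\<bar> * (4 * q\<^sup>2) + W"
  proof (intro add_mono mult_left_mono order_refl)
    have "0 \<le> \<bar>t\<bar> * la" using lam by simp
    then have "t\<^sup>2 / 3 + 3 / 2 * la\<^sup>2 + 5 / 4 * (\<bar>t\<bar> * la) \<le> 4 * (la\<^sup>2 + t\<^sup>2 + 2 * (\<bar>t\<bar> * la))"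
    proof -
      have gen: "a / 3 + 3 / 2 * b + 5 / 4 * p \<le> 4 * (b + a + 2 * p)" if "0 \<le> a" "0 \<le> b" "0 \<le> p" for a b p :: real
      proof -
        have "a / 3 \<le> 4 * a" "3 / 2 * b \<le> 4 * b" "5 / 4 * p \<le> 8 * p" using that by simp_all
        then have "a / 3 + 3 / 2 * b + 5 / 4 * p \<le> 4 * a + 4 * b + 8 * p" by (intro add_mono)
        also have "\<dots> = 4 * (b + a + 2 * p)" by (simp add: algebra_simps)
        finally show ?thesis .
      qed
      show ?thesis by (rule gen[OF zero_le_power2 zero_le_power2 \<open>0 \<le> \<bar>t\<bar> * la\<close>])
    qed
    then show "\<bar>t\<bar>\<^sup>2 / 3 + 3 / 2 * la\<^sup>2 + 5 / 4 * \<bar>t\<bar> * la \<le> 4 * q\<^sup>2"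
      unfolding q_def power2_sum power2_abs by (simp only: mult.assoc mult.commute[of la "\<bar>t\<bar>"])
  qed (use B_pos v_nonneg in auto)
  also have "\<dots> = 5 * W" by (simp add: W_def)
  finally have main: "cmod (tilted_fourier t - tilted_moment 0 * exp y) \<le> 5 * W" .
  have "1 / 2 \<le> cmod (exp y)"
  proof -
    have "(v * \<bar>t\<bar>) * \<bar>t\<bar> \<le> (B / 2) * \<bar>t\<bar>" by (rule mult_right_mono[OF vt(1)]) simp
    then have "v * t\<^sup>2 / 2 \<le> 1 / 2" using t by (simp add: power2_eq_square algebra_simps)
    then have "1 / 2 \<le> 1 + - (v * t\<^sup>2 / 2)" by simp
    also have "\<dots> \<le> exp (- (v * t\<^sup>2 / 2))" by (rule exp_ge_add_one_self)
    finally show ?thesis by (simp add: norm_exp_eq_Re y_def)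
  qed
  then have den: "1 / 2 \<le> cmod (tilted_moment 0 * exp y)"
    using tilted_moment_0(2) mult_mono[of 1 "tilted_moment 0" "1/2" "cmod (exp y)"] by (simp add: norm_mult)
  then have nz: "tilted_moment 0 * exp y \<noteq> 0" by (metis norm_zero not_le zero_less_divide_1_iff zero_less_numeral)
  have W0: "0 \<le> W" using B_pos v_nonneg by (auto simp: W_def)
  have "tilted_fourier t / (tilted_moment 0 * exp y) - 1 = (tilted_fourier t - tilted_moment 0 * exp y) / (tilted_moment 0 * exp y)"
    using nz by (simp add: diff_divide_distrib)
  then have "cmod (tilted_fourier t / (tilted_moment 0 * exp y) - 1) = cmod (tilted_fourier t - tilted_moment 0 * exp y) / cmod (tilted_moment 0 * exp y)"
    by (simp only: norm_divide)
  also have "\<dots> \<le> 5 * W / (1 / 2)" using main den W0 by (intro frac_le) auto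
  finally show ?thesis by (simp add: W_def q_def mult_ac)
qed

lemma tilted_moment_0_approx: "\<bar>tilted_moment 0 / exp (la\<^sup>2 * v / 2) - 1\<bar> \<le> 2 * la ^ 3 * (B * v)"
proof -
  let ?y = "la\<^sup>2 * v / 2"
  have y: "?y \<le> la * (B / 2) / 2" "0 \<le> ?y"
    using mult_left_mono[OF lam_v(1) lam(1)] v_nonneg by (auto simp: power2_eq_square)
  have yh: "norm ?y \<le> 1 / 2" using y lam unfolding real_norm_def by linarith
  have "?y\<^sup>2 = la * (la * v) * ?y / 2" by (simp add: power2_eq_square)
  also have "\<dots> \<le> la * (B / 2) * ?y / 2"
    using lam_v(1) lam(1) y by (intro divide_right_mono mult_right_mono mult_left_mono) auto
  also have "\<dots> = la ^ 3 * (B * v) / 8" by (simp add: power2_eq_square power3_eq_cube)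
  finally have y2: "?y\<^sup>2 \<le> la ^ 3 * (B * v) / 8" .
  have nn: "0 \<le> la ^ 3 * (B * v)" using lam B_pos v_nonneg by simp
  have "\<bar>exp ?y - 1 - ?y\<bar> \<le> ?y\<^sup>2" using exp_Taylor_half(1)[OF yh] unfolding real_norm_def power2_abs .
  then have "\<bar>tilted_moment 0 - exp ?y\<bar> \<le> 2 * la ^ 3 * (B * v)"
    using tilted_moment_0(3) y2 nn by linarith
  then have "\<bar>tilted_moment 0 - exp ?y\<bar> / exp ?y \<le> 2 * la ^ 3 * (B * v) / 1"
    using y nn by (intro frac_le) (auto simp: mult.assoc)
  moreover have "tilted_moment 0 / exp ?y - 1 = (tilted_moment 0 - exp ?y) / exp ?y" by (simp add: diff_divide_distrib)
  ultimately have "\<bar>tilted_moment 0 / exp ?y - 1\<bar> \<le> 2 * la ^ 3 * (B * v) / 1"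
    by (simp only: abs_divide abs_exp_cancel)
  then show ?thesis by simp
qed

lemmas tilted_char_approx = tilted_fourier_approx[unfolded tilted_fourier_def tilted_moment_def power_0 mult_1]
lemmas mgf_approx = tilted_moment_0_approx[unfolded tilted_moment_def power_0 mult_1]

end
end

section \<open>Berry--Esseen and moderate deviation bounds for bounded summands\<close>

definition unit_normal :: "real \<Rightarrow> real measure" where
  "unit_normal a = density lborel (normal_density a 1)"

lemma unit_normal_eq_distr: "unit_normal a = distr std_normal_distribution borel (\<lambda>x. a + x)"
proof -
  have "distributed std_normal_distribution lborel (\<lambda>x. x) std_normal_density"
    by (auto simp: distributed_def distr_id2)
  from std_normal.normal_density_affine[OF this, of 1 a]
  have "unit_normal a = distr std_normal_distribution lborel (\<lambda>x. a + x)"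
    by (simp add: distributed_def unit_normal_def)
  also have "\<dots> = distr std_normal_distribution borel (\<lambda>x. a + x)"
    by (rule distr_cong) auto
  finally show ?thesis .
qed

lemma real_distribution_unit_normal: "real_distribution (unit_normal a)"
  unfolding unit_normal_eq_distr by (rule std_normal.real_distribution_distr) simp

lemma cdf_unit_normal: "cdf (unit_normal a) x = std_normal_cdf (x - a)"
proof -
  have "(\<lambda>y. a + y) -` {..x} = {..x - a}" by auto
  then show ?thesis by (simp add: cdf_def unit_normal_eq_distr measure_distr)
qed

lemma char_unit_normal: "char (unit_normal a) t = exp (\<i> * complex_of_real (a * t) - complex_of_real (t\<^sup>2 / 2))"
proof -
  have "char (unit_normal a) t = (\<integral>x. iexp (t * a) * iexp (t * x) \<partial>std_normal_distribution)"
    unfolding char_def unit_normal_eq_distr by (subst integral_distr) (auto simp: algebra_simps simp flip: exp_add)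
  also have "\<dots> = iexp (t * a) * char std_normal_distribution t" by (simp add: char_def)
  also have "char std_normal_distribution t = exp (complex_of_real (- (t\<^sup>2) / 2))"
    by (simp only: char_std_normal_distribution exp_of_real)
  finally show ?thesis by (simp add: algebra_simps flip: exp_add)
qed

text \<open>Integration by parts: on \<open>{x<..}\<close> the function \<open>exp (- a s)\<close> is a mixture of the indicators of \<open>{x<..u}\<close> with
  weights \<open>a exp (- a u)\<close>, and the two laws give such an interval masses that differ by at most \<open>2 D\<close>.\<close>
lemma exp_tail_compare:
  assumes mu: "real_distribution \<mu>" and nu: "real_distribution \<nu>" and a: "0 < a"
    and D: "\<And>u. \<bar>cdf \<mu> u - cdf \<nu> u\<bar> \<le> D"
  shows "(\<integral>\<^sup>+s. ennreal (indicator {x<..} s * exp (- a * s)) \<partial>\<mu>)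
    \<le> (\<integral>\<^sup>+s. ennreal (indicator {x<..} s * exp (- a * s)) \<partial>\<nu>) + ennreal (2 * D * exp (- a * x))"
proof -
  have D0: "0 \<le> D" using D[of 0] by linarith
  have exp_int: "(\<integral>\<^sup>+u. ennreal (a * exp (- a * u)) * indicator {s..} u \<partial>lborel) = ennreal (exp (- a * s))" for s
  proof -
    have "(\<integral>\<^sup>+u. ennreal (a * exp (- a * u)) * indicator {s..} u \<partial>lborel) = ennreal (0 - - exp (- a * s))"
    proof (rule nn_integral_FTC_atLeast)
      show "((\<lambda>u. - exp (- a * u)) \<longlongrightarrow> 0) at_top"
        using a by real_asymp
    qed (use a in \<open>auto intro!: derivative_eq_intros\<close>)
    then show ?thesis by simp
  qed
  have parts: "(\<integral>\<^sup>+s. ennreal (indicator {x<..} s * exp (- a * s)) \<partial>\<kappa>)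
      = (\<integral>\<^sup>+u. ennreal (a * exp (- a * u) * (cdf \<kappa> u - cdf \<kappa> x)) * indicator {x<..} u \<partial>lborel)"
    if "real_distribution \<kappa>" for \<kappa>
  proof -
    interpret K: real_distribution \<kappa> by fact
    interpret pair_sigma_finite lborel \<kappa> ..
    let ?k = "\<lambda>u s. ennreal (a * exp (- a * u)) * indicator {s..} u * indicator {x<..} s :: ennreal"
    have kk: "?k u s = ennreal (a * exp (- a * u)) * indicator {p. x < snd p \<and> snd p \<le> fst p} (u, s)" for u s
      by (auto split: split_indicator)
    have "(\<integral>\<^sup>+s. ennreal (indicator {x<..} s * exp (- a * s)) \<partial>\<kappa>) = (\<integral>\<^sup>+s. (\<integral>\<^sup>+u. ?k u s \<partial>lborel) \<partial>\<kappa>)"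
    proof (rule nn_integral_cong)
      fix s
      have "(\<integral>\<^sup>+u. ?k u s \<partial>lborel) = ennreal (exp (- a * s)) * indicator {x<..} s"
        unfolding exp_int[symmetric] by (rule nn_integral_multc) measurable
      then show "ennreal (indicator {x<..} s * exp (- a * s)) = (\<integral>\<^sup>+u. ?k u s \<partial>lborel)"
        by (auto split: split_indicator)
    qed
    also have "\<dots> = (\<integral>\<^sup>+u. (\<integral>\<^sup>+s. ?k u s \<partial>\<kappa>) \<partial>lborel)"
      by (rule Fubini') (unfold kk, measurable)
    also have "\<dots> = (\<integral>\<^sup>+u. ennreal (a * exp (- a * u) * (cdf \<kappa> u - cdf \<kappa> x)) * indicator {x<..} u \<partial>lborel)"
    proof (rule nn_integral_cong)
      fix u
      have "(\<integral>\<^sup>+s. ?k u s \<partial>\<kappa>) = (\<integral>\<^sup>+s. ennreal (a * exp (- a * u)) * indicator {x<..u} s \<partial>\<kappa>)"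
        by (intro nn_integral_cong) (auto split: split_indicator)
      also have "\<dots> = ennreal (a * exp (- a * u)) * emeasure \<kappa> {x<..u}"
        by (rule nn_integral_cmult_indicator) simp
      also have "\<dots> = ennreal (a * exp (- a * u) * (cdf \<kappa> u - cdf \<kappa> x)) * indicator {x<..} u"
      proof (cases "x < u")
        case True
        then show ?thesis using a K.cdf_diff_eq[OF True]
          by (simp add: K.emeasure_eq_measure flip: ennreal_mult)
      qed simp
      finally show "(\<integral>\<^sup>+s. ?k u s \<partial>\<kappa>) = \<dots>" .
    qed
    finally show ?thesis .
  qed
  interpret Nu: real_distribution \<nu> by fact
  have [measurable]: "cdf \<nu> \<in> borel_measurable borel"
    using Nu.cdf_nondecreasing by (intro borel_measurable_mono) (auto simp: mono_def)
  have "(\<integral>\<^sup>+s. ennreal (indicator {x<..} s * exp (- a * s)) \<partial>\<mu>)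
      \<le> (\<integral>\<^sup>+u. ennreal (a * exp (- a * u) * (cdf \<nu> u - cdf \<nu> x)) * indicator {x<..} u
          + ennreal (2 * D) * (ennreal (a * exp (- a * u)) * indicator {x..} u) \<partial>lborel)"
    unfolding parts[OF mu]
  proof (rule nn_integral_mono)
    fix u
    have "a * exp (- a * u) * (cdf \<mu> u - cdf \<mu> x) \<le> a * exp (- a * u) * ((cdf \<nu> u - cdf \<nu> x) + 2 * D)"
      using D[of u] D[of x] a by (intro mult_left_mono) auto
    then have "a * exp (- a * u) * (cdf \<mu> u - cdf \<mu> x) \<le> a * exp (- a * u) * (cdf \<nu> u - cdf \<nu> x) + 2 * D * (a * exp (- a * u))"
      by (simp add: algebra_simps)
    then show "ennreal (a * exp (- a * u) * (cdf \<mu> u - cdf \<mu> x)) * indicator {x<..} u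
        \<le> ennreal (a * exp (- a * u) * (cdf \<nu> u - cdf \<nu> x)) * indicator {x<..} u
          + ennreal (2 * D) * (ennreal (a * exp (- a * u)) * indicator {x..} u)"
      using a D0 Nu.cdf_nondecreasing[of x u]
      by (cases "x < u") (auto simp flip: ennreal_mult ennreal_plus intro!: ennreal_leI)
  qed
  also have "\<dots> = (\<integral>\<^sup>+s. ennreal (indicator {x<..} s * exp (- a * s)) \<partial>\<nu>)
      + (\<integral>\<^sup>+u. ennreal (2 * D) * (ennreal (a * exp (- a * u)) * indicator {x..} u) \<partial>lborel)"
    unfolding parts[OF nu] by (rule nn_integral_add) measurable
  also have "(\<integral>\<^sup>+u. ennreal (2 * D) * (ennreal (a * exp (- a * u)) * indicator {x..} u) \<partial>lborel)
      = ennreal (2 * D) * ennreal (exp (- a * x))"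
    unfolding exp_int[symmetric] by (rule nn_integral_cmult) measurable
  finally show ?thesis using D0 by (simp flip: ennreal_mult)
qed

text \<open>The hypothesis \<open>B \<le> 1/2\<close> keeps \<open>ln (1 / B)\<close> away from 0.\<close>
locale centred_bounded_sum = prob_space +
  fixes I :: "'i set" and X :: "'i \<Rightarrow> 'a \<Rightarrow> real" and B :: real
  assumes finite_I: "finite I"
    and indep_X: "indep_vars (\<lambda>_. borel) X I"
    and B_pos: "0 < B" and B_half: "B \<le> 1 / 2"
    and bounded_X: "\<And>i \<omega>. i \<in> I \<Longrightarrow> \<omega> \<in> space M \<Longrightarrow> \<bar>X i \<omega>\<bar> \<le> B"
    and centred_X: "\<And>i. i \<in> I \<Longrightarrow> expectation (X i) = 0"
    and unit_variance: "(\<Sum>i\<in>I. expectation (\<lambda>\<omega>. (X i \<omega>)\<^sup>2)) = 1"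
begin

definition "S \<omega> = (\<Sum>i\<in>I. X i \<omega>)"

definition "mgf la = expectation (\<lambda>\<omega>. exp (la * S \<omega>))"

definition "tilted la = distr (density M (\<lambda>\<omega>. exp (la * S \<omega>) / mgf la)) borel S"

lemma measurable_X: "i \<in> I \<Longrightarrow> X i \<in> borel_measurable M"
  using indep_X by (auto simp: indep_vars_def)

lemma measurable_S[measurable]: "S \<in> borel_measurable M"
  unfolding S_def using measurable_X by (intro borel_measurable_sum)

lemma summand: "i \<in> I \<Longrightarrow> bounded_centred_variable M (X i) B"
  by unfold_locales (auto intro: measurable_X B_pos bounded_X centred_X)

abbreviation "var i \<equiv> bounded_centred_variable.v M (X i)"

lemma var_sum: "(\<Sum>i\<in>I. var i) = 1" and var_nonneg: "i \<in> I \<Longrightarrow> 0 \<le> var i"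
proof -
  have "var i = expectation (\<lambda>\<omega>. (X i \<omega>)\<^sup>2)" if "i \<in> I" for i
    by (rule bounded_centred_variable.v_def[OF summand[OF that]])
  then show "(\<Sum>i\<in>I. var i) = 1" using unit_variance by (simp cong: sum.cong)
  show "i \<in> I \<Longrightarrow> 0 \<le> var i" by (rule bounded_centred_variable.v_nonneg[OF summand])
qed

lemma S_bounded: "\<omega> \<in> space M \<Longrightarrow> \<bar>S \<omega>\<bar> \<le> real (card I) * B"
  unfolding S_def using bounded_X sum_bounded_above[of I "\<lambda>i. \<bar>X i \<omega>\<bar>" B]
  by (auto intro!: order_trans[OF sum_abs])

lemma exp_S_le: "\<omega> \<in> space M \<Longrightarrow> exp (la * S \<omega>) \<le> exp (\<bar>la\<bar> * (real (card I) * B))"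
proof -
  assume "\<omega> \<in> space M"
  then have "\<bar>la * S \<omega>\<bar> \<le> \<bar>la\<bar> * (real (card I) * B)"
    unfolding abs_mult using S_bounded by (intro mult_left_mono) auto
  then show ?thesis by simp
qed

lemma integrable_exp_S [simp]: "integrable M (\<lambda>\<omega>. exp (la * S \<omega>))"
  using exp_S_le[of _ la] by (intro integrable_const_bound[where B="exp (\<bar>la\<bar> * (real (card I) * B))"]) auto

lemma mgf_prod: "mgf la = (\<Prod>i\<in>I. expectation (\<lambda>\<omega>. exp (la * X i \<omega>)))"
proof -
  have "mgf la = expectation (\<lambda>\<omega>. \<Prod>i\<in>I. exp (la * X i \<omega>))"
    unfolding mgf_def S_def by (simp add: sum_distrib_left exp_sum finite_I)
  also have "\<dots> = (\<Prod>i\<in>I. expectation (\<lambda>\<omega>. exp (la * X i \<omega>)))"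
  proof (rule indep_vars_lebesgue_integral[OF finite_I])
    show "indep_vars (\<lambda>_. borel) (\<lambda>i \<omega>. exp (la * X i \<omega>)) I"
      by (rule indep_vars_compose2[OF indep_X]) measurable
  qed (auto intro: bounded_centred_variable.integrable_powers summand)
  finally show ?thesis .
qed

lemma char_prod: "expectation (\<lambda>\<omega>. iexp (t * S \<omega>) * exp (la * S \<omega>))
    = (\<Prod>i\<in>I. expectation (\<lambda>\<omega>. iexp (t * X i \<omega>) * exp (la * X i \<omega>)))"
proof -
  have "expectation (\<lambda>\<omega>. iexp (t * S \<omega>) * exp (la * S \<omega>))
      = expectation (\<lambda>\<omega>. \<Prod>i\<in>I. iexp (t * X i \<omega>) * exp (la * X i \<omega>))"
    unfolding S_def by (simp add: sum_distrib_left exp_sum finite_I prod.distrib)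
  also have "\<dots> = (\<Prod>i\<in>I. expectation (\<lambda>\<omega>. iexp (t * X i \<omega>) * exp (la * X i \<omega>)))"
  proof (rule indep_vars_lebesgue_integral[OF finite_I])
    show "indep_vars (\<lambda>_. borel) (\<lambda>i \<omega>. iexp (t * X i \<omega>) * complex_of_real (exp (la * X i \<omega>))) I"
      by (rule indep_vars_compose2[OF indep_X]) measurable
  next
    fix i assume i: "i \<in> I"
    interpret bounded_centred_variable M "X i" B by (rule summand[OF i])
    show "integrable M (\<lambda>\<omega>. iexp (t * X i \<omega>) * complex_of_real (exp (la * X i \<omega>)))"
      using exp_X_le[of _ la]
      by (intro integrable_const_bound[where B = "exp (\<bar>la\<bar> * B)"]) (auto simp: norm_mult)
  qed
  finally show ?thesis .
qed

lemma mgf_pos: "0 < mgf la"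
proof -
  have "0 < expectation (\<lambda>\<omega>. exp (la * X i \<omega>))" if "i \<in> I" for i
  proof -
    interpret bounded_centred_variable M "X i" B by (rule summand[OF that])
    have "expectation (\<lambda>\<omega>. 1 + la * X i \<omega>) \<le> expectation (\<lambda>\<omega>. exp (la * X i \<omega>))"
      by (intro integral_mono) (auto intro: exp_ge_add_one_self)
    then show ?thesis using centred_X by (simp add: prob_space)
  qed
  then show ?thesis unfolding mgf_prod by (intro prod_pos)
qed

lemma tilted_integral:
  fixes f :: "real \<Rightarrow> 'b :: {banach, second_countable_topology}"
  assumes [measurable]: "f \<in> borel_measurable borel"
  shows "(\<integral>x. f x \<partial>tilted la) = expectation (\<lambda>\<omega>. (exp (la * S \<omega>) / mgf la) *\<^sub>R f (S \<omega>))"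
  unfolding tilted_def using mgf_pos[of la]
  by (subst integral_distr) (auto simp: integral_density less_imp_le)

lemma real_distribution_tilted: "real_distribution (tilted la)"
proof -
  have "prob_space (density M (\<lambda>\<omega>. exp (la * S \<omega>) / mgf la))"
  proof (rule prob_spaceI)
    have "emeasure (density M (\<lambda>\<omega>. exp (la * S \<omega>) / mgf la)) (space M) = (\<integral>\<^sup>+\<omega>. ennreal (exp (la * S \<omega>) / mgf la) \<partial>M)"
      by (subst emeasure_density) (auto intro!: nn_integral_cong)
    also have "\<dots> = ennreal (expectation (\<lambda>\<omega>. exp (la * S \<omega>) / mgf la))"
      using mgf_pos[of la] by (intro nn_integral_eq_integral) (auto simp: less_imp_le)
    also have "expectation (\<lambda>\<omega>. exp (la * S \<omega>) / mgf la) = 1"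
      using mgf_pos[of la] by (simp add: mgf_def)
    finally show "emeasure (density M (\<lambda>\<omega>. exp (la * S \<omega>) / mgf la))
      (space (density M (\<lambda>\<omega>. exp (la * S \<omega>) / mgf la))) = 1" by simp
  qed
  then interpret D: prob_space "density M (\<lambda>\<omega>. exp (la * S \<omega>) / mgf la)" .
  show ?thesis unfolding tilted_def by (rule D.real_distribution_distr) simp
qed

lemma char_tilted: "char (tilted la) t
    = (\<Prod>i\<in>I. expectation (\<lambda>\<omega>. iexp (t * X i \<omega>) * exp (la * X i \<omega>)) / expectation (\<lambda>\<omega>. exp (la * X i \<omega>)))"
proof -
  have "char (tilted la) t = expectation (\<lambda>\<omega>. iexp (t * S \<omega>) * exp (la * S \<omega>) / mgf la)"
    unfolding char_def by (subst tilted_integral) (auto simp: scaleR_conv_of_real mult_ac)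
  also have "\<dots> = expectation (\<lambda>\<omega>. iexp (t * S \<omega>) * exp (la * S \<omega>)) / mgf la"
    by simp
  finally show ?thesis by (simp only: char_prod mgf_prod of_real_prod prod_dividef)
qed

context
  fixes la :: real
  assumes lam: "0 \<le> la" "20 * B * la\<^sup>2 \<le> 1"
begin

lemma lam_B: "la * B \<le> 1 / 2"
proof (rule power2_le_imp_le)
  have "(la * B)\<^sup>2 = (20 * B * la\<^sup>2) * B / 20" by (simp add: power2_eq_square)
  also have "\<dots> \<le> 1 * (1 / 2) / 20" using lam B_pos B_half by (intro divide_right_mono mult_mono) auto
  also have "\<dots> \<le> (1 / 2)\<^sup>2" by (simp add: power2_eq_square)
  finally show "(la * B)\<^sup>2 \<le> (1 / 2)\<^sup>2" .
qed simp

text \<open>Multiplying the ratios of the summands gives a relative error \<open>exp \<rho> - 1\<close>. For the admitted frequencies and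
  tilts \<open>\<rho> \<le> \<bar>t\<bar> + t\<^sup>2 / 4\<close>, so the Gaussian factor \<open>exp (- t\<^sup>2 / 2)\<close> still dominates \<open>exp \<rho>\<close>.\<close>
lemma char_tilted_diff:
  assumes t: "\<bar>t\<bar> * (80 * B) \<le> 1"
  shows "cmod (char (tilted la) t - char (unit_normal la) t)
    \<le> \<bar>t\<bar> * (180 * B * (la\<^sup>2 + 16) * exp (- (1 / 16 * t\<^sup>2)))"
proof -
  define y where "y i = \<i> * complex_of_real (la * var i * t) - complex_of_real (var i * t\<^sup>2 / 2)" for i
  define E where "E = exp (\<i> * complex_of_real (la * t) - complex_of_real (t\<^sup>2 / 2))"
  define r where "r i = expectation (\<lambda>\<omega>. iexp (t * X i \<omega>) * exp (la * X i \<omega>))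
      / (expectation (\<lambda>\<omega>. exp (la * X i \<omega>)) * exp (y i)) - 1" for i
  define \<rho> where "\<rho> = 10 * B * \<bar>t\<bar> * (la + \<bar>t\<bar>)\<^sup>2"
  have tB: "\<bar>t\<bar> * B \<le> 1 / 2" using t by simp
  have r: "cmod (r i) \<le> var i * \<rho>" if "i \<in> I" for i
    using bounded_centred_variable.tilted_char_approx[OF summand[OF that] lam(1) lam_B tB]
    by (simp add: r_def y_def \<rho>_def mult_ac)
  have "(\<Sum>i\<in>I. y i) = \<i> * complex_of_real (la * (\<Sum>i\<in>I. var i) * t) - complex_of_real ((\<Sum>i\<in>I. var i) * t\<^sup>2 / 2)"
    unfolding y_def by (simp add: sum_subtractf sum_distrib_left sum_distrib_right sum_divide_distrib mult_ac)
  then have E: "(\<Prod>i\<in>I. exp (y i)) = E" by (simp add: var_sum E_def flip: exp_sum[OF finite_I])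
  have "char (tilted la) t = (\<Prod>i\<in>I. exp (y i) * (1 + r i))"
    unfolding char_tilted r_def by (intro prod.cong) auto
  also have "\<dots> = E * (\<Prod>i\<in>I. 1 + r i)" by (simp add: prod.distrib E)
  finally have "char (tilted la) t - char (unit_normal la) t = E * ((\<Prod>i\<in>I. 1 + r i) - 1)"
    by (simp add: char_unit_normal E_def algebra_simps)
  then have "cmod (char (tilted la) t - char (unit_normal la) t) = cmod E * cmod ((\<Prod>i\<in>I. 1 + r i) - 1)"
    by (simp only: norm_mult)
  also have "\<dots> \<le> exp (- t\<^sup>2 / 2) * (\<rho> * exp \<rho>)"
  proof (intro mult_mono)
    show "cmod E \<le> exp (- t\<^sup>2 / 2)" by (simp add: E_def norm_exp_eq_Re)
    have "cmod ((\<Prod>i\<in>I. 1 + r i) - 1) \<le> exp (\<Sum>i\<in>I. cmod (r i)) - 1" by (rule norm_prod_minus_1_le_exp)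
    also have "(\<Sum>i\<in>I. cmod (r i)) \<le> (\<Sum>i\<in>I. var i * \<rho>)" using r by (rule sum_mono)
    also have "\<dots> = \<rho>" by (simp add: var_sum flip: sum_distrib_right)
    also have "exp \<rho> - 1 \<le> \<rho> * exp \<rho>" by (rule exp_minus_1_le)
    finally show "cmod ((\<Prod>i\<in>I. 1 + r i) - 1) \<le> \<rho> * exp \<rho>" by simp
  qed auto
  also have "\<dots> \<le> \<bar>t\<bar> * (180 * B * (la\<^sup>2 + 16) * exp (- (1 / 16 * t\<^sup>2)))"
  proof -
    have "(la + \<bar>t\<bar>)\<^sup>2 \<le> 2 * (la\<^sup>2 + t\<^sup>2)"
      using zero_le_power2[of "la - \<bar>t\<bar>"] by (simp add: power2_sum power2_diff)
    then have "10 * B * \<bar>t\<bar> * (la + \<bar>t\<bar>)\<^sup>2 \<le> 10 * B * \<bar>t\<bar> * (2 * (la\<^sup>2 + t\<^sup>2))"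
      using B_pos by (intro mult_left_mono) auto
    also have "\<dots> = 20 * B * \<bar>t\<bar> * (la\<^sup>2 + t\<^sup>2)" by simp
    finally have \<rho>1: "\<rho> \<le> 20 * B * \<bar>t\<bar> * (la\<^sup>2 + t\<^sup>2)" unfolding \<rho>_def .
    also have "\<dots> = (20 * B * la\<^sup>2) * \<bar>t\<bar> + (\<bar>t\<bar> * (80 * B)) * (t\<^sup>2 / 4)" by (simp add: algebra_simps)
    also have "\<dots> \<le> 1 * \<bar>t\<bar> + 1 * (t\<^sup>2 / 4)" using lam t by (intro add_mono mult_right_mono) auto
    finally have \<rho>2: "\<rho> \<le> \<bar>t\<bar> + t\<^sup>2 / 4" by simp
    have "\<bar>t\<bar> \<le> 2 + t\<^sup>2 / 8" using zero_le_power2[of "\<bar>t\<bar> - 4"] by (simp add: power2_diff)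
    then have "- t\<^sup>2 / 2 + \<rho> \<le> 2 + - (t\<^sup>2 / 8)" using \<rho>2 by simp
    then have ex: "exp (- t\<^sup>2 / 2) * exp \<rho> \<le> exp 2 * exp (- (t\<^sup>2 / 8))" by (simp flip: exp_add)
    have "t\<^sup>2 / 16 \<le> exp (t\<^sup>2 / 16)" using exp_ge_add_one_self[of "t\<^sup>2 / 16"] by linarith
    moreover have "1 \<le> exp (t\<^sup>2 / 16)" by simp
    then have "la\<^sup>2 * 1 \<le> la\<^sup>2 * exp (t\<^sup>2 / 16)" by (intro mult_left_mono) auto
    ultimately have lt: "la\<^sup>2 + t\<^sup>2 \<le> (la\<^sup>2 + 16) * exp (t\<^sup>2 / 16)" by (simp add: algebra_simps)
    have e9: "exp (2::real) \<le> 9"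
    proof -
      have "exp (2::real) = exp 1 ^ 2" by (simp flip: exp_of_nat_mult)
      also have "\<dots> \<le> 3 ^ 2" using exp_le by (intro power_mono) auto
      finally show ?thesis by simp
    qed
    have "exp (- t\<^sup>2 / 2) * (\<rho> * exp \<rho>) = \<rho> * (exp (- t\<^sup>2 / 2) * exp \<rho>)" by simp
    also have "\<dots> \<le> (20 * B * \<bar>t\<bar> * ((la\<^sup>2 + 16) * exp (t\<^sup>2 / 16))) * (9 * exp (- (t\<^sup>2 / 8)))"
    proof (rule mult_mono)
      show "\<rho> \<le> 20 * B * \<bar>t\<bar> * ((la\<^sup>2 + 16) * exp (t\<^sup>2 / 16))"
        by (rule order_trans[OF \<rho>1 mult_left_mono[OF lt]]) (use B_pos in simp)
      show "exp (- t\<^sup>2 / 2) * exp \<rho> \<le> 9 * exp (- (t\<^sup>2 / 8))"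
        by (rule order_trans[OF ex mult_right_mono[OF e9]]) simp
    qed (use B_pos in auto)
    also have "\<dots> = \<bar>t\<bar> * (180 * B * (la\<^sup>2 + 16) * (exp (t\<^sup>2 / 16) * exp (- (t\<^sup>2 / 8))))" by simp
    also have "exp (t\<^sup>2 / 16) * exp (- (t\<^sup>2 / 8)) = exp (- (1 / 16 * t\<^sup>2))" by (simp flip: exp_add)
    finally show ?thesis .
  qed
  finally show ?thesis .
qed

lemma ln_inverse_B: "1 / 2 \<le> ln (1 / B)"
proof -
  have "exp (1 / 2 :: real) \<le> 2"
    using exp_bound_half[of "1/2::real"] by simp
  also have "2 \<le> 1 / B" using B_pos B_half by (simp add: field_simps)
  finally show ?thesis using B_pos ln_ge_iff[of "1 / B" "1 / 2"] by simp
qed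

text \<open>Up to the frequency \<open>1 / (80 B)\<close> the estimate \<open>char_tilted_diff\<close> applies. The width \<open>\<tau>\<close> of the blur is chosen so that
  beyond this frequency half of the Gaussian exponent already yields a factor \<open>B\<close> and the other half is left for
  integration; \<open>r\<close> is chosen so that the Gaussian tails are of size \<open>B\<close> as well. The shift \<open>2 \<tau> r\<close> accounts for
  the term \<open>B ln (1 / B)\<close>.\<close>
lemma cdf_tilted_approx: "\<bar>cdf (tilted la) u - std_normal_cdf (u - la)\<bar> \<le> 9000 * B * (1 + la\<^sup>2 + ln (1 / B))"
proof -
  define l where "l = ln (1 / B)"
  define \<tau> where "\<tau> = 160 * B * sqrt l"
  define r where "r = sqrt (2 * l)"
  define g where "g t = 180 * B * (la\<^sup>2 + 16) * exp (- (1 / 16 * t\<^sup>2)) + 160 * B\<^sup>2 * exp (- (\<tau>\<^sup>2 / 4 * t\<^sup>2))" for t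
  have l: "1 / 2 \<le> l" unfolding l_def by (rule ln_inverse_B)
  have \<tau>: "0 < \<tau>" "\<tau>\<^sup>2 = 25600 * B\<^sup>2 * l" using l B_pos by (auto simp: \<tau>_def power_mult_distrib)
  have r: "0 \<le> r" "r\<^sup>2 = 2 * l" using l by (auto simp: r_def)
  have exp_l: "exp (- l) = B" using B_pos by (simp add: l_def ln_div exp_minus)
  have G: "has_bochner_integral lborel g
      (180 * B * (la\<^sup>2 + 16) * sqrt (pi / (1 / 16)) + 160 * B\<^sup>2 * sqrt (pi / (\<tau>\<^sup>2 / 4)))"
    unfolding g_def using \<tau>(1) by (intro has_bochner_integral_add has_bochner_integral_mult_right gaussian_integral) auto
  have "\<bar>cdf (tilted la) u - cdf (unit_normal la) u\<bar> \<le> (1 / pi) * (\<integral>t. g t \<partial>lborel) + 2 * \<tau> * r + 4 * exp (- r\<^sup>2 / 2)"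
  proof (rule gaussian_smoothing_inequality[OF real_distribution_tilted real_distribution_unit_normal])
    show "\<bar>cdf (unit_normal la) x - cdf (unit_normal la) y\<bar> \<le> \<bar>x - y\<bar>" for x y
      using std_normal_cdf_Lipschitz[of "x - la" "y - la"] by (simp add: cdf_unit_normal)
    show "integrable lborel g" using G by (simp add: has_bochner_integral_iff)
    fix t :: real assume t0: "t \<noteq> 0"
    show "cmod (char (tilted la) t - char (unit_normal la) t) * exp (- (\<tau> * t)\<^sup>2 / 2) \<le> \<bar>t\<bar> * g t"
    proof (cases "\<bar>t\<bar> * (80 * B) \<le> 1")
      case True
      have "cmod (char (tilted la) t - char (unit_normal la) t) * exp (- (\<tau> * t)\<^sup>2 / 2)
          \<le> (\<bar>t\<bar> * (180 * B * (la\<^sup>2 + 16) * exp (- (1 / 16 * t\<^sup>2)))) * 1"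
        using char_tilted_diff[OF True] B_pos by (intro mult_mono) auto
      also have "\<dots> \<le> \<bar>t\<bar> * g t" unfolding g_def by (simp add: algebra_simps)
      finally show ?thesis .
    next
      case False
      then have t: "1 < 80 * B * \<bar>t\<bar>" by (simp add: not_le mult_ac)
      have "1 * 1 \<le> (80 * B * \<bar>t\<bar>) * (80 * B * \<bar>t\<bar>)" using t by (intro mult_mono) auto
      also have "\<dots> = 6400 * B\<^sup>2 * t\<^sup>2" by (simp add: power2_eq_square)
      finally have "l * 1 \<le> l * (6400 * B\<^sup>2 * t\<^sup>2)" using l by (intro mult_left_mono) auto
      then have "l \<le> \<tau>\<^sup>2 / 4 * t\<^sup>2" unfolding \<tau>(2) by (simp add: mult_ac)
      then have "- (\<tau> * t)\<^sup>2 / 2 \<le> - l + - (\<tau>\<^sup>2 / 4 * t\<^sup>2)" by (simp add: power_mult_distrib)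
      then have e: "exp (- (\<tau> * t)\<^sup>2 / 2) \<le> B * exp (- (\<tau>\<^sup>2 / 4 * t\<^sup>2))"
        by (subst exp_l[symmetric]) (simp flip: exp_add)
      have "cmod (char (tilted la) t - char (unit_normal la) t) \<le> 1 + 1"
        using real_distribution.cmod_char_le_1[OF real_distribution_tilted]
          real_distribution.cmod_char_le_1[OF real_distribution_unit_normal]
        by (intro order_trans[OF norm_triangle_ineq4] add_mono) auto
      also have "\<dots> \<le> \<bar>t\<bar> * (160 * B)" using t by simp
      finally have "cmod (char (tilted la) t - char (unit_normal la) t) * exp (- (\<tau> * t)\<^sup>2 / 2)
          \<le> (\<bar>t\<bar> * (160 * B)) * (B * exp (- (\<tau>\<^sup>2 / 4 * t\<^sup>2)))"
        using e B_pos by (intro mult_mono) auto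
      also have "\<dots> = \<bar>t\<bar> * (160 * B\<^sup>2 * exp (- (\<tau>\<^sup>2 / 4 * t\<^sup>2)))" by (simp add: power2_eq_square)
      also have "\<dots> \<le> \<bar>t\<bar> * g t" using B_pos unfolding g_def by (intro mult_left_mono) auto
      finally show ?thesis .
    qed
  qed (use \<tau> r in auto)
  also have "(\<integral>t. g t \<partial>lborel) = 180 * B * (la\<^sup>2 + 16) * sqrt (pi / (1 / 16)) + 160 * B\<^sup>2 * sqrt (pi / (\<tau>\<^sup>2 / 4))"
    using G by (simp add: has_bochner_integral_iff)
  also have "sqrt (pi / (1 / 16)) = 4 * sqrt pi" by (simp add: real_sqrt_mult)
  also have "160 * B\<^sup>2 * sqrt (pi / (\<tau>\<^sup>2 / 4)) = 2 * B * sqrt pi / sqrt l"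
    using B_pos l by (simp add: \<tau>_def real_sqrt_divide real_sqrt_mult power2_eq_square field_simps)
  also have "2 * \<tau> * r = 320 * sqrt 2 * B * l"
    using l by (simp add: \<tau>_def r_def real_sqrt_mult)
  also have "exp (- r\<^sup>2 / 2) = B" using exp_l by (simp add: r)
  finally have "\<bar>cdf (tilted la) u - cdf (unit_normal la) u\<bar>
      \<le> (1 / pi) * (180 * B * (la\<^sup>2 + 16) * (4 * sqrt pi) + 2 * B * sqrt pi / sqrt l) + 320 * sqrt 2 * B * l + 4 * B" .
  also have "\<dots> \<le> (1 / 3) * (180 * B * (la\<^sup>2 + 16) * (4 * 2) + 2 * B * 2 / (1 / 2)) + 320 * 2 * B * l + 4 * B"
  proof (intro add_mono mult_mono order_refl frac_le mult_left_mono)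
    show "sqrt pi \<le> 2" using pi_less_4 by (intro real_le_lsqrt) auto
    then show "sqrt pi \<le> 2" .
    show "(1 / 2) \<le> sqrt l" using l by (intro real_le_rsqrt) (auto simp: power2_eq_square)
    show "sqrt 2 \<le> 2" by (intro real_le_lsqrt) auto
  qed (use B_pos l pi_gt3 in auto)
  also have "\<dots> = B * (480 * la\<^sup>2 + 7680 + 8 / 3 + 640 * l + 4)" by (simp add: algebra_simps)
  also have "\<dots> \<le> B * (9000 * (1 + la\<^sup>2 + l))"
  proof (rule mult_left_mono)
    have "480 * a + 7680 + 8 / 3 + 640 * l + 4 \<le> 9000 * (1 + a + l)" if "0 \<le> a" for a
      using that l by (simp add: field_simps)
    then show "480 * la\<^sup>2 + 7680 + 8 / 3 + 640 * l + 4 \<le> 9000 * (1 + la\<^sup>2 + l)" by simp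
  qed (use B_pos in simp)
  finally show ?thesis by (simp add: cdf_unit_normal l_def mult_ac)
qed

end

lemma berry_esseen: "\<bar>prob {\<omega> \<in> space M. S \<omega> \<le> u} - std_normal_cdf u\<bar> \<le> 9000 * B * (1 + ln (1 / B))"
proof -
  have "mgf 0 = 1" by (simp add: mgf_def prob_space)
  then have "tilted 0 = distr M borel S" by (simp add: tilted_def density_1)
  then have "cdf (tilted 0) u = prob {\<omega> \<in> space M. S \<omega> \<le> u}"
    by (simp add: cdf_def measure_distr vimage_def Int_def conj_commute)
  then show ?thesis using cdf_tilted_approx[of 0 u] by simp
qed

text \<open>The exponents of the summands deviate from those of a Gaussian by \<open>O(B la\<^sup>3)\<close> in total.\<close>
lemma mgf_normal_approx:
  assumes "0 \<le> la" "20 * B * la\<^sup>2 \<le> 1" "B * la ^ 3 \<le> 1"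
  shows "\<bar>mgf la * exp (- la\<^sup>2 / 2) - 1\<bar> \<le> 18 * (B * la ^ 3)"
proof -
  define r where "r i = expectation (\<lambda>\<omega>. exp (la * X i \<omega>)) / exp (la\<^sup>2 * var i / 2) - 1" for i
  define \<rho> where "\<rho> = 2 * (B * la ^ 3)"
  have \<rho>: "0 \<le> \<rho>" "\<rho> \<le> 2" using assms B_pos by (auto simp: \<rho>_def)
  have r: "norm (r i) \<le> var i * \<rho>" if "i \<in> I" for i
    using bounded_centred_variable.mgf_approx[OF summand[OF that] assms(1) lam_B[OF assms(1,2)]]
    by (simp add: r_def \<rho>_def mult_ac)
  have "(\<Prod>i\<in>I. exp (la\<^sup>2 * var i / 2)) = exp (la\<^sup>2 / 2)"
  proof -
    have "(\<Sum>i\<in>I. la\<^sup>2 * var i / 2) = la\<^sup>2 * (\<Sum>i\<in>I. var i) / 2"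
      by (simp only: sum_distrib_left sum_divide_distrib)
    then show ?thesis by (simp add: var_sum flip: exp_sum[OF finite_I])
  qed
  then have "(\<Prod>i\<in>I. 1 + r i) = mgf la / exp (la\<^sup>2 / 2)"
    unfolding mgf_prod by (simp add: r_def prod_dividef)
  then have "mgf la * exp (- la\<^sup>2 / 2) = (\<Prod>i\<in>I. 1 + r i)"
    by (simp add: exp_minus inverse_eq_divide)
  then have "\<bar>mgf la * exp (- la\<^sup>2 / 2) - 1\<bar> \<le> exp (\<Sum>i\<in>I. norm (r i)) - 1"
    using norm_prod_minus_1_le_exp[of r I] by simp
  also have "(\<Sum>i\<in>I. norm (r i)) \<le> (\<Sum>i\<in>I. var i * \<rho>)" using r by (rule sum_mono)
  also have "\<dots> = \<rho>" by (simp add: var_sum flip: sum_distrib_right)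
  also have "exp \<rho> - 1 \<le> \<rho> * exp \<rho>" by (rule exp_minus_1_le)
  also have "\<dots> \<le> \<rho> * 9"
  proof (rule mult_left_mono)
    have "exp \<rho> \<le> exp (2::real)" using \<rho> by simp
    also have "exp (2::real) = exp 1 ^ 2" by (simp flip: exp_of_nat_mult)
    also have "\<dots> \<le> 3 ^ 2" using exp_le by (intro power_mono) auto
    finally show "exp \<rho> \<le> 9" by simp
  qed (use \<rho> in auto)
  finally show ?thesis by (simp add: \<rho>_def)
qed

text \<open>Undoing the tilt with \<open>la = x\<close>: the tail of \<open>S\<close> is \<open>mgf x\<close> times the integral of \<open>exp (- x s)\<close> over \<open>{x<..}\<close> with
  respect to the tilted law. For the normal law with mean \<open>x\<close> this integral is exactly \<open>exp (- x\<^sup>2 / 2)\<close> times the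
  normal tail. Replacing one law by the other costs \<open>2 D exp (- x\<^sup>2)\<close>, which relative to that value is
  of order \<open>D (1 + x)\<close> by \<open>std_normal_tail_ge\<close>.\<close>
lemma cramer_positive:
  assumes x: "0 < x" "20 * B * x\<^sup>2 \<le> 1" "B * x ^ 3 \<le> 1"
  shows "\<bar>prob {\<omega> \<in> space M. S \<omega> > x} - (1 - std_normal_cdf x)\<bar>
    \<le> 5200000 * B * (1 + x) * (1 + x\<^sup>2 + ln (1 / B)) * (1 - std_normal_cdf x)"
proof -
  define T where "T = 1 - std_normal_cdf x"
  define p where "p = prob {\<omega> \<in> space M. S \<omega> > x}"
  define D where "D = 9000 * B * (1 + x\<^sup>2 + ln (1 / B))"
  have x0: "0 \<le> x" using x by simp
  have T: "0 < T" unfolding T_def by (rule std_normal_tail_pos)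
  have l: "1 / 2 \<le> ln (1 / B)" by (rule ln_inverse_B[OF x0 x(2)])
  have D0: "0 \<le> D" unfolding D_def using B_pos B_half l by (intro mult_nonneg_nonneg add_nonneg_nonneg) auto
  let ?h = "\<lambda>s. ennreal (indicator {x<..} s * exp (- x * s))"
  have approx: "\<bar>cdf (tilted x) u - cdf (unit_normal x) u\<bar> \<le> D" for u
    unfolding D_def cdf_unit_normal by (rule cdf_tilted_approx[OF x0 x(2)])
  have ht: "(\<integral>\<^sup>+s. ?h s \<partial>tilted x) = ennreal (p / mgf x)"
  proof -
    have "(\<integral>\<^sup>+s. ?h s \<partial>tilted x) = (\<integral>\<^sup>+\<omega>. ennreal (exp (x * S \<omega>) / mgf x) * ?h (S \<omega>) \<partial>M)"
      unfolding tilted_def by (simp add: nn_integral_distr nn_integral_density)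
    also have "\<dots> = (\<integral>\<^sup>+\<omega>. ennreal (1 / mgf x) * indicator {\<omega> \<in> space M. S \<omega> > x} \<omega> \<partial>M)"
      using mgf_pos[of x] by (intro nn_integral_cong) (auto split: split_indicator simp: exp_minus simp flip: ennreal_mult)
    also have "\<dots> = ennreal (1 / mgf x) * emeasure M {\<omega> \<in> space M. S \<omega> > x}"
      by (rule nn_integral_cmult_indicator) measurable
    also have "\<dots> = ennreal (p / mgf x)"
      using mgf_pos[of x] by (simp add: p_def emeasure_eq_measure flip: ennreal_mult)
    finally show ?thesis .
  qed
  have hn: "(\<integral>\<^sup>+s. ?h s \<partial>unit_normal x) = ennreal (exp (- x\<^sup>2 / 2) * T)"
  proof -
    have eq: "normal_density x 1 s * exp (- x * s) = exp (- x\<^sup>2 / 2) * std_normal_density s" for s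
      by (simp add: normal_density_def power2_diff field_simps flip: exp_add)
    have "(\<integral>\<^sup>+s. ?h s \<partial>unit_normal x) = (\<integral>\<^sup>+s. ennreal (normal_density x 1 s) * ?h s \<partial>lborel)"
      unfolding unit_normal_def by (simp add: nn_integral_density)
    also have "\<dots> = (\<integral>\<^sup>+s. ennreal (exp (- x\<^sup>2 / 2)) * (ennreal (std_normal_density s) * indicator {x<..} s) \<partial>lborel)"
      using eq by (intro nn_integral_cong) (auto split: split_indicator simp flip: ennreal_mult)
    also have "\<dots> = ennreal (exp (- x\<^sup>2 / 2)) * emeasure std_normal_distribution {x<..}"
      by (subst nn_integral_cmult) (auto simp: emeasure_density)
    also have "\<dots> = ennreal (exp (- x\<^sup>2 / 2) * T)"
      by (simp add: std_normal.emeasure_eq_measure std_normal_tail_eq T_def flip: ennreal_mult')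
    finally show ?thesis .
  qed
  define m where "m = mgf x * exp (- x\<^sup>2 / 2)"
  define e where "e = p / mgf x - exp (- x\<^sup>2 / 2) * T"
  have m0: "0 < m" using mgf_pos[of x] by (simp add: m_def)
  have "ennreal (p / mgf x) \<le> ennreal (exp (- x\<^sup>2 / 2) * T + 2 * D * exp (- x * x))"
  proof -
    have "ennreal (p / mgf x) \<le> ennreal (exp (- x\<^sup>2 / 2) * T) + ennreal (2 * D * exp (- x * x))"
      using exp_tail_compare[OF real_distribution_tilted real_distribution_unit_normal x(1) approx, where x = x]
      unfolding ht hn .
    then show ?thesis using T D0 by (subst ennreal_plus) auto
  qed
  moreover have "0 \<le> exp (- x\<^sup>2 / 2) * T + 2 * D * exp (- x * x)"
    using T D0 by (intro add_nonneg_nonneg mult_nonneg_nonneg) auto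
  ultimately have e1: "e \<le> 2 * D * exp (- x * x)" unfolding e_def by (simp only: ennreal_le_iff)
  have "ennreal (exp (- x\<^sup>2 / 2) * T) \<le> ennreal (p / mgf x + 2 * D * exp (- x * x))"
  proof -
    have approx': "\<bar>cdf (unit_normal x) u - cdf (tilted x) u\<bar> \<le> D" for u
      using approx[of u] by (simp add: abs_minus_commute)
    have "ennreal (exp (- x\<^sup>2 / 2) * T) \<le> ennreal (p / mgf x) + ennreal (2 * D * exp (- x * x))"
      using exp_tail_compare[OF real_distribution_unit_normal real_distribution_tilted x(1) approx', where x = x]
      unfolding ht hn .
    then show ?thesis using D0 mgf_pos[of x] by (subst ennreal_plus) (auto simp: p_def)
  qed
  moreover have "0 \<le> p / mgf x + 2 * D * exp (- x * x)"
    using D0 mgf_pos[of x] by (intro add_nonneg_nonneg mult_nonneg_nonneg divide_nonneg_nonneg) (auto simp: p_def)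
  ultimately have e2: "- e \<le> 2 * D * exp (- x * x)" unfolding e_def by (simp only: ennreal_le_iff)
  have "\<bar>e\<bar> \<le> 2 * D * exp (- x * x)" using e1 e2 by (simp add: abs_le_iff)
  also have "exp (- x * x) = exp (- x\<^sup>2 / 2) * exp (- x\<^sup>2 / 2)"
    by (simp add: power2_eq_square flip: exp_add)
  finally have e: "\<bar>e\<bar> * exp (x\<^sup>2 / 2) \<le> 2 * D * exp (- x\<^sup>2 / 2)"
    by (simp add: exp_minus field_simps)
  have "p = mgf x * (e + exp (- x\<^sup>2 / 2) * T)" using mgf_pos[of x] by (simp add: e_def field_simps)
  also have "\<dots> = m * T + m * (e * exp (x\<^sup>2 / 2))"
    by (simp add: m_def exp_minus field_simps)
  finally have "\<bar>p - T\<bar> = \<bar>(m - 1) * T + m * (e * exp (x\<^sup>2 / 2))\<bar>" by (simp add: algebra_simps)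
  also have "\<dots> \<le> \<bar>(m - 1) * T\<bar> + \<bar>m * (e * exp (x\<^sup>2 / 2))\<bar>" by (rule abs_triangle_ineq)
  also have "\<dots> = \<bar>m - 1\<bar> * T + m * (\<bar>e\<bar> * exp (x\<^sup>2 / 2))" using T m0 by (simp add: abs_mult)
  also have "\<dots> \<le> 18 * (B * x ^ 3) * T + 19 * (30 * D * (1 + x) * T)"
  proof (rule add_mono[OF mult_right_mono mult_mono])
    show m1: "\<bar>m - 1\<bar> \<le> 18 * (B * x ^ 3)" unfolding m_def by (rule mgf_normal_approx[OF x0 x(2,3)])
    show "m \<le> 19" using m1 x(3) by linarith
    have "2 * D * exp (- x\<^sup>2 / 2) \<le> 2 * D * (15 * (1 + x) * T)"
      unfolding T_def using D0 by (intro mult_left_mono std_normal_tail_ge x0) auto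
    also have "\<dots> = 30 * D * (1 + x) * T" by simp
    finally show "\<bar>e\<bar> * exp (x\<^sup>2 / 2) \<le> 30 * D * (1 + x) * T" by (rule order_trans[OF e])
  qed (use T B_pos x in auto)
  also have "\<dots> = B * T * (18 * x ^ 3 + 5130000 * ((1 + x) * (1 + x\<^sup>2 + ln (1 / B))))"
    by (simp add: D_def algebra_simps)
  also have "\<dots> \<le> B * T * (5200000 * ((1 + x) * (1 + x\<^sup>2 + ln (1 / B))))"
  proof (intro mult_left_mono)
    have "x ^ 3 = x * x\<^sup>2" by (simp add: power3_eq_cube power2_eq_square)
    also have "\<dots> \<le> (1 + x) * (1 + x\<^sup>2 + ln (1 / B))" using x0 l by (intro mult_mono) auto
    finally have "x ^ 3 \<le> (1 + x) * (1 + x\<^sup>2 + ln (1 / B))" .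
    moreover have "0 \<le> x ^ 3" using x0 by simp
    ultimately show "18 * x ^ 3 + 5130000 * ((1 + x) * (1 + x\<^sup>2 + ln (1 / B)))
      \<le> 5200000 * ((1 + x) * (1 + x\<^sup>2 + ln (1 / B)))" by linarith
  qed (use B_pos T in auto)
  finally show ?thesis unfolding p_def T_def by (simp only: mult_ac)
qed

text \<open>For \<open>x \<le> 0\<close> the normal tail is bounded below by \<open>1/15\<close>, and the Berry--Esseen bound is already a relative
  one.\<close>
theorem cramer_moderate_deviation:
  assumes x: "0 < x \<Longrightarrow> 20 * B * x\<^sup>2 \<le> 1" "0 < x \<Longrightarrow> B * x ^ 3 \<le> 1"
  shows "\<bar>prob {\<omega> \<in> space M. S \<omega> > x} - (1 - std_normal_cdf x)\<bar>
    \<le> 5200000 * B * (1 + \<bar>x\<bar>) * (1 + x\<^sup>2 + ln (1 / B)) * (1 - std_normal_cdf x)"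
proof (cases "0 < x")
  case True
  then show ?thesis using cramer_positive[OF True x(1)[OF True] x(2)[OF True]] by simp
next
  case False
  have l: "1 / 2 \<le> ln (1 / B)" by (rule ln_inverse_B[of 0]) auto
  have "1 / 15 \<le> 1 - std_normal_cdf 0" using std_normal_tail_ge[of 0] by simp
  also have "\<dots> \<le> 1 - std_normal_cdf x" using False std_normal.cdf_nondecreasing[of x 0] by simp
  finally have T: "1 / 15 \<le> 1 - std_normal_cdf x" .
  have "prob {\<omega> \<in> space M. S \<omega> > x} = 1 - prob {\<omega> \<in> space M. S \<omega> \<le> x}"
    using prob_neg[of "\<lambda>\<omega>. S \<omega> \<le> x"] by (simp add: not_le)
  then have "\<bar>prob {\<omega> \<in> space M. S \<omega> > x} - (1 - std_normal_cdf x)\<bar> \<le> 9000 * B * (1 + ln (1 / B))"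
    using berry_esseen[of x] by simp
  also have "\<dots> = (9000 * B * (1 * (1 + ln (1 / B)))) * 1" by simp
  also have "\<dots> \<le> (9000 * B * ((1 + \<bar>x\<bar>) * (1 + x\<^sup>2 + ln (1 / B)))) * (15 * (1 - std_normal_cdf x))"
  proof (rule mult_mono)
    have "1 * (1 + ln (1 / B)) \<le> (1 + \<bar>x\<bar>) * (1 + x\<^sup>2 + ln (1 / B))"
      using l by (intro mult_mono) auto
    then show "9000 * B * (1 * (1 + ln (1 / B))) \<le> 9000 * B * ((1 + \<bar>x\<bar>) * (1 + x\<^sup>2 + ln (1 / B)))"
      using B_pos by (intro mult_left_mono) auto
    have "0 \<le> (1 + \<bar>x\<bar>) * (1 + x\<^sup>2 + ln (1 / B))" using l B_half B_pos by (intro mult_nonneg_nonneg add_nonneg_nonneg) auto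
    then show "0 \<le> 9000 * B * ((1 + \<bar>x\<bar>) * (1 + x\<^sup>2 + ln (1 / B)))" using B_pos by simp
  qed (use T in auto)
  also have "\<dots> = 135000 * (B * (1 + \<bar>x\<bar>) * (1 + x\<^sup>2 + ln (1 / B)) * (1 - std_normal_cdf x))" by simp
  also have "\<dots> \<le> 5200000 * (B * (1 + \<bar>x\<bar>) * (1 + x\<^sup>2 + ln (1 / B)) * (1 - std_normal_cdf x))"
    using B_pos B_half l T by (intro mult_right_mono mult_nonneg_nonneg add_nonneg_nonneg) auto
  finally show ?thesis by (simp only: mult_ac)
qed

end

section \<open>Exponential tails of degenerate two-sample statistics\<close>

text \<open>For a centred variable the linear term integrates to 0, so this bounds the exponential moment by that of the
  square.\<close>
lemma exp_le_plus_exp_square: "exp x \<le> x + exp (x\<^sup>2)" for x :: real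
proof (cases "\<bar>x\<bar> \<le> 1")
  case True
  have "exp x \<le> 1 + x + x\<^sup>2"
  proof (cases "0 \<le> x")
    case True
    then show ?thesis using exp_bound[of x] \<open>\<bar>x\<bar> \<le> 1\<close> by simp
  next
    case False
    define y where "y = - x"
    have y: "0 \<le> y" using False by (simp add: y_def)
    have "0 \<le> 1 - y + y\<^sup>2" using zero_le_power2[of "y - 1 / 2"] by (simp add: power2_diff power2_eq_square field_simps)
    then have "(1 + y) * (1 - y + y\<^sup>2) \<le> exp y * (1 - y + y\<^sup>2)"
      by (intro mult_right_mono exp_ge_add_one_self)
    moreover have "(1 + y) * (1 - y + y\<^sup>2) = 1 + y ^ 3" by (simp add: algebra_simps power2_eq_square power3_eq_cube)
    moreover have "0 \<le> y ^ 3" using y by simp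
    ultimately have "1 \<le> exp y * (1 - y + y\<^sup>2)" by linarith
    then have "exp (- y) \<le> 1 - y + y\<^sup>2" by (simp add: exp_minus field_simps)
    then show ?thesis by (simp add: y_def)
  qed
  moreover have "1 + x\<^sup>2 \<le> exp (x\<^sup>2)" by (rule exp_ge_add_one_self)
  ultimately show ?thesis by linarith
next
  case False
  then have x2: "\<bar>x\<bar> * 1 \<le> \<bar>x\<bar> * \<bar>x\<bar>" by (intro mult_left_mono) auto
  then have x2: "\<bar>x\<bar> \<le> x\<^sup>2" by (simp add: power2_eq_square)
  show ?thesis
  proof (cases "0 \<le> x")
    case True
    then have "exp x \<le> exp (x\<^sup>2)" using x2 by simp
    then show ?thesis using True by linarith
  next
    case False
    then have "exp x \<le> 1" by simp
    moreover have "1 + x\<^sup>2 \<le> exp (x\<^sup>2)" by (rule exp_ge_add_one_self)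
    ultimately show ?thesis using x2 False by linarith
  qed
qed

lemma nn_integral_exp_normal:
  "(\<integral>\<^sup>+g. ennreal (exp (c * g)) \<partial>std_normal_distribution) = ennreal (exp (c\<^sup>2 / 2))"
proof -
  have eq: "std_normal_density g * exp (c * g) = exp (c\<^sup>2 / 2) * normal_density c 1 g" for g
    by (simp add: normal_density_def power2_diff field_simps flip: exp_add)
  have "(\<integral>\<^sup>+g. ennreal (exp (c * g)) \<partial>std_normal_distribution)
      = (\<integral>\<^sup>+g. ennreal (exp (c\<^sup>2 / 2)) * ennreal (normal_density c 1 g) \<partial>lborel)"
    by (subst nn_integral_density) (auto simp: eq simp flip: ennreal_mult intro!: nn_integral_cong)
  also have "\<dots> = ennreal (exp (c\<^sup>2 / 2)) * (\<integral>\<^sup>+g. ennreal (normal_density c 1 g) \<partial>lborel)"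
    by (rule nn_integral_cmult) measurable
  also have "(\<integral>\<^sup>+g. ennreal (normal_density c 1 g) \<partial>lborel) = 1"
    by (simp add: nn_integral_eq_integral)
  finally show ?thesis by simp
qed

lemma nn_integral_exp_square_normal:
  "(\<integral>\<^sup>+g. ennreal (exp (g\<^sup>2 / 4)) \<partial>std_normal_distribution) = ennreal (sqrt 2)"
proof -
  have eq: "std_normal_density g * exp (g\<^sup>2 / 4) = 1 / sqrt (2 * pi) * exp (- (1 / 4 * g\<^sup>2))" for g
    by (simp add: std_normal_density_def flip: exp_add)
  have hb: "has_bochner_integral lborel (\<lambda>g. 1 / sqrt (2 * pi) * exp (- (1 / 4 * g\<^sup>2))) (1 / sqrt (2 * pi) * sqrt (pi / (1 / 4)))"
    by (intro has_bochner_integral_mult_right gaussian_integral) auto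
  have "(\<integral>\<^sup>+g. ennreal (exp (g\<^sup>2 / 4)) \<partial>std_normal_distribution)
      = (\<integral>\<^sup>+g. ennreal (1 / sqrt (2 * pi) * exp (- (1 / 4 * g\<^sup>2))) \<partial>lborel)"
    by (subst nn_integral_density) (auto simp: eq simp flip: ennreal_mult intro!: nn_integral_cong)
  also have "\<dots> = ennreal (1 / sqrt (2 * pi) * sqrt (pi / (1 / 4)))"
    using hb by (subst nn_integral_eq_integral) (auto simp: has_bochner_integral_iff)
  also have "1 / sqrt (2 * pi) * sqrt (pi / (1 / 4)) = sqrt 2"
  proof -
    have "sqrt (pi / (1 / 4)) = sqrt (2 * pi) * sqrt 2" by (simp flip: real_sqrt_mult)
    then show ?thesis by simp
  qed
  finally show ?thesis .
qed

lemma (in prob_space) hoeffding_mgf: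
  assumes [measurable]: "f \<in> borel_measurable M" and f: "\<And>x. x \<in> space M \<Longrightarrow> \<bar>f x\<bar> \<le> H" and f0: "expectation f = 0"
  shows "(\<integral>\<^sup>+x. ennreal (exp (b * f x)) \<partial>M) \<le> ennreal (exp (b\<^sup>2 * H\<^sup>2 / 2))"
proof -
  have main: "(\<integral>\<^sup>+x. ennreal (exp (c * g x)) \<partial>M) \<le> ennreal (exp (c\<^sup>2 * H\<^sup>2 / 2))"
    if [measurable]: "g \<in> borel_measurable M" and "\<And>x. x \<in> space M \<Longrightarrow> \<bar>g x\<bar> \<le> H" and "expectation g = 0" and "c > 0" for c g
  proof -
    interpret interval_bounded_random_variable M g "- H" H
      using that(2) by unfold_locales (auto simp: abs_le_iff minus_le_iff)
    have "(H - - H)\<^sup>2 = 4 * H\<^sup>2" by (simp add: power2_eq_square)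
    then show ?thesis using Hoeffdings_lemma_nn_integral_0[OF that(4,3)] by (simp add: mult.commute)
  qed
  consider "b > 0" | "b = 0" | "b < 0" by linarith
  then show ?thesis
  proof cases
    case 1 then show ?thesis using main[of f b] f f0 by simp
  next
    case 2 then show ?thesis by (simp add: emeasure_space_1)
  next
    case 3 then show ?thesis using main[of "\<lambda>x. - f x" "- b"] f f0 by simp
  qed
qed

text \<open>The power moves inside the expectation by Jensen's inequality, after the linear term has been removed.\<close>
lemma (in prob_space) exp_centred_power_le:
  assumes [measurable]: "f \<in> borel_measurable M" and f: "\<And>x. x \<in> space M \<Longrightarrow> \<bar>f x\<bar> \<le> K" and f0: "expectation f = 0"
  shows "(\<integral>\<^sup>+x. ennreal (exp (f x)) \<partial>M) ^ n \<le> (\<integral>\<^sup>+x. ennreal (exp (real n * (f x)\<^sup>2)) \<partial>M)"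
proof -
  have K: "(f x)\<^sup>2 \<le> K\<^sup>2" if "x \<in> space M" for x
    using f[OF that] by (metis abs_ge_zero power2_abs power_mono)
  have int: "integrable M (\<lambda>x. exp (c * (f x)\<^sup>2))" if "0 \<le> c" for c
    using K that by (intro integrable_const_bound[where B = "exp (c * K\<^sup>2)"]) (auto intro!: mult_left_mono)
  have intf: "integrable M f" using f by (intro integrable_const_bound[where B = K]) auto
  have inte: "integrable M (\<lambda>x. exp (f x))"
    using f by (intro integrable_const_bound[where B = "exp K"]) (auto simp: abs_le_iff)
  have "expectation (\<lambda>x. exp (f x)) \<le> expectation (\<lambda>x. f x + exp ((f x)\<^sup>2))"
    using int[of 1] intf inte by (intro integral_mono exp_le_plus_exp_square) auto
  also have "\<dots> = expectation (\<lambda>x. exp ((f x)\<^sup>2))" using int[of 1] intf f0 by simp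
  finally have "expectation (\<lambda>x. exp (f x)) ^ n \<le> expectation (\<lambda>x. exp ((f x)\<^sup>2)) ^ n"
    by (intro power_mono integral_nonneg_AE) auto
  also have "\<dots> \<le> expectation (\<lambda>x. exp ((f x)\<^sup>2) ^ n)"
  proof (rule jensens_inequality[where I = "{0<..}"])
    show "convex_on {0<..} (\<lambda>x::real. x ^ n)"
      by (cases "even n") (auto intro: convex_on_subset[OF convex_power_even] convex_on_subset[OF convex_power_odd])
  qed (use int[of 1] int[of "real n"] in \<open>auto simp flip: exp_of_nat_mult\<close>)
  also have "\<dots> = expectation (\<lambda>x. exp (real n * (f x)\<^sup>2))" by (simp flip: exp_of_nat_mult)
  finally show ?thesis using inte int[of "real n"]
    by (simp add: nn_integral_eq_integral ennreal_power integral_nonneg_AE)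
qed

text \<open>Integrate out the first sample with the second one fixed: its \<open>n\<close> coordinates contribute the \<open>n\<close>-th power of one
  exponential moment of \<open>l S z u\<close>, where \<open>S z u\<close> is the row sum over the second sample. By degeneracy this
  row sum is centred in \<open>u\<close>, and \<open>exp_centred_power_le\<close> replaces the power by a single moment of
  \<open>exp (n l\<^sup>2 (S z u)\<^sup>2)\<close>. Now integrate over the second sample first: degeneracy in the other variable makes
  \<open>S z u\<close> a sum of \<open>m\<close> independent centred terms, and writing the exponential of the square as a Gaussian
  mixture of exponentials reduces everything to Hoeffding's lemma.\<close>
lemma (in prob_space) degenerate_chaos_mgf:
  fixes xi eps :: "nat \<Rightarrow> 'a \<Rightarrow> real" and h :: "real \<Rightarrow> real \<Rightarrow> real"
  assumes indep: "indep_vars (\<lambda>_. borel) (case_sum xi eps) UNIV"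
    and law_xi: "\<And>i. distr M borel (xi i) = P" and law_eps: "\<And>j. distr M borel (eps j) = Q"
    and nm: "0 < n" "0 < m"
    and meas: "case_prod h \<in> borel_measurable (borel \<Otimes>\<^sub>M borel)"
    and bound: "\<And>x y. \<bar>h x y\<bar> \<le> H"
    and deg_x: "\<And>y. (\<integral>x. h x y \<partial>P) = 0" and deg_y: "\<And>x. (\<integral>y. h x y \<partial>Q) = 0"
    and l: "4 * (real n * real m) * (l\<^sup>2 * H\<^sup>2) \<le> 1"
  shows "(\<integral>\<^sup>+\<omega>. ennreal (exp (l * (\<Sum>i<n. \<Sum>j<m. h (xi i \<omega>) (eps j \<omega>)))) \<partial>M) \<le> ennreal (sqrt 2)"
proof -
  define A where "A = (Inl ` {..<n} :: (nat + nat) set)"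
  define B where "B = (Inr ` {..<m} :: (nat + nat) set)"
  define N where "N = case_sum (\<lambda>_::nat. P) (\<lambda>_::nat. Q)"
  have rv: "random_variable borel (case_sum xi eps k)" for k
    using indep by (auto simp: indep_vars_def)
  have rv_xi[measurable]: "xi i \<in> borel_measurable M" for i using rv[of "Inl i"] by simp
  have rv_eps[measurable]: "eps j \<in> borel_measurable M" for j using rv[of "Inr j"] by simp
  have P: "prob_space P" using prob_space_distr[OF rv_xi[of 0]] by (simp add: law_xi)
  have Q: "prob_space Q" using prob_space_distr[OF rv_eps[of 0]] by (simp add: law_eps)
  have sP[simp, measurable_cong]: "sets P = sets borel" using law_xi[of 0] by auto
  have sQ[simp, measurable_cong]: "sets Q = sets borel" using law_eps[of 0] by auto
  have spP[simp]: "space P = UNIV" using law_xi[of 0] by auto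
  have spQ[simp]: "space Q = UNIV" using law_eps[of 0] by auto
  interpret P: prob_space P by fact
  interpret Q: prob_space Q by fact
  have N: "prob_space (N k)" for k using P Q by (auto simp: N_def split: sum.split)
  interpret PN: product_prob_space N by (rule product_prob_spaceI) (rule N)
  interpret PB: prob_space "Pi\<^sub>M B N" by (rule prob_space_PiM) (rule N)
  have fin: "finite A" "finite B" and disj: "B \<inter> A = {}" by (auto simp: A_def B_def)
  have sN[simp, measurable_cong]: "sets (N k) = sets borel" for k by (auto simp: N_def split: sum.split)
  note [measurable] = meas
  have hm1[measurable]: "(\<lambda>x. h x y) \<in> borel_measurable borel" for y by measurable
  have hm2[measurable]: "(\<lambda>y. h x y) \<in> borel_measurable borel" for x by measurable
  define S where "S z u = (\<Sum>j<m. h u (z (Inr j)))" for z :: "nat + nat \<Rightarrow> real" and u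
  define f where "f z = ennreal (exp (l * (\<Sum>i<n. S z (z (Inl i)))))" for z :: "nat + nat \<Rightarrow> real"
  have comp: "(\<lambda>z. z k) \<in> borel_measurable (Pi\<^sub>M K N)" if "k \<in> K" for k K
  proof -
    have "measurable (Pi\<^sub>M K N) (N k) = borel_measurable (Pi\<^sub>M K N)"
      by (rule measurable_cong_sets) auto
    then show ?thesis using measurable_component_singleton[OF that, of N] by blast
  qed
  have hcomp: "(\<lambda>w. h (a w) (b w)) \<in> borel_measurable K"
    if "a \<in> borel_measurable K" "b \<in> borel_measurable K" for a b and K :: "'w measure"
    using measurable_compose[OF measurable_Pair[OF that] meas] by simp
  have "(\<lambda>z. \<Sum>i<n. \<Sum>j<m. h (z (Inl i)) (z (Inr j))) \<in> borel_measurable (Pi\<^sub>M (B \<union> A) N)"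
    by (intro borel_measurable_sum hcomp comp) (auto simp: A_def B_def)
  then have f_meas[measurable]: "f \<in> borel_measurable (Pi\<^sub>M (B \<union> A) N)"
    unfolding f_def S_def by measurable
  have S_meas2[measurable]: "(\<lambda>z. S z u) \<in> borel_measurable (Pi\<^sub>M B N)" for u
    unfolding S_def by (intro borel_measurable_sum hcomp comp) (auto simp: B_def)
  have S_meas[measurable]: "(\<lambda>p. S (fst p) (snd p)) \<in> borel_measurable (Pi\<^sub>M B N \<Otimes>\<^sub>M P)"
    unfolding S_def
  proof (intro borel_measurable_sum hcomp)
    show "snd \<in> borel_measurable (Pi\<^sub>M B N \<Otimes>\<^sub>M P)" by measurable
    show "(\<lambda>p. fst p (Inr j)) \<in> borel_measurable (Pi\<^sub>M B N \<Otimes>\<^sub>M P)" if "j \<in> {..<m}" for j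
      using that by (intro measurable_compose[OF measurable_fst comp]) (auto simp: B_def)
  qed
  have S_meas1[measurable]: "(\<lambda>u. S z u) \<in> borel_measurable P" for z
    unfolding S_def by (intro borel_measurable_sum hcomp) (auto intro: measurable_ident_sets)
  have S_bound: "\<bar>S z u\<bar> \<le> real m * H" for z u
    unfolding S_def using bound sum_bounded_above[of "{..<m}" "\<lambda>j. \<bar>h u (z (Inr j))\<bar>" H]
    by (auto intro!: order_trans[OF sum_abs])
  have ind: "indep_vars (\<lambda>_. borel) (case_sum xi eps) (B \<union> A)"
    by (rule indep_vars_subset[OF indep]) auto
  have ne: "B \<union> A \<noteq> {}" using nm by (auto simp: A_def)
  have "distr M (Pi\<^sub>M (B \<union> A) (\<lambda>_. borel)) (\<lambda>\<omega>. \<lambda>k\<in>B \<union> A. case_sum xi eps k \<omega>)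
      = Pi\<^sub>M (B \<union> A) (\<lambda>k. distr M borel (case_sum xi eps k))"
    by (rule iffD1[OF indep_vars_iff_distr_eq_PiM[OF ne rv] ind])
  also have "\<dots> = Pi\<^sub>M (B \<union> A) N"
    by (intro PiM_cong) (auto simp: N_def law_xi law_eps split: sum.split)
  finally have joint: "distr M (Pi\<^sub>M (B \<union> A) (\<lambda>_. borel)) (\<lambda>\<omega>. \<lambda>k\<in>B \<union> A. case_sum xi eps k \<omega>) = Pi\<^sub>M (B \<union> A) N" .
  have "(\<integral>\<^sup>+\<omega>. ennreal (exp (l * (\<Sum>i<n. \<Sum>j<m. h (xi i \<omega>) (eps j \<omega>)))) \<partial>M)
      = (\<integral>\<^sup>+\<omega>. f (\<lambda>k\<in>B \<union> A. case_sum xi eps k \<omega>) \<partial>M)"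
    by (intro nn_integral_cong) (simp add: f_def S_def A_def B_def)
  also have "\<dots> = (\<integral>\<^sup>+z. f z \<partial>Pi\<^sub>M (B \<union> A) N)"
    unfolding joint[symmetric]
  proof (rule nn_integral_distr[symmetric])
    show "(\<lambda>\<omega>. \<lambda>k\<in>B \<union> A. case_sum xi eps k \<omega>) \<in> M \<rightarrow>\<^sub>M Pi\<^sub>M (B \<union> A) (\<lambda>_. borel)"
      by (intro measurable_restrict rv)
    have "sets (Pi\<^sub>M (B \<union> A) (\<lambda>_. borel)) = sets (Pi\<^sub>M (B \<union> A) N)"
      by (intro sets_PiM_cong) auto
    then show "f \<in> borel_measurable (distr M (Pi\<^sub>M (B \<union> A) (\<lambda>_. borel)) (\<lambda>\<omega>. \<lambda>k\<in>B \<union> A. case_sum xi eps k \<omega>))"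
      using f_meas by (simp cong: measurable_cong_sets)
  qed
  also have "\<dots> = (\<integral>\<^sup>+z. (\<integral>\<^sup>+y. f (merge B A (z, y)) \<partial>Pi\<^sub>M A N) \<partial>Pi\<^sub>M B N)"
    by (rule PN.product_nn_integral_fold[OF disj fin(2,1)]) measurable
  also have "\<dots> \<le> (\<integral>\<^sup>+z. (\<integral>\<^sup>+u. ennreal (exp (real n * (l * S z u)\<^sup>2)) \<partial>P) \<partial>Pi\<^sub>M B N)"
  proof (rule nn_integral_mono)
    fix z
    have Sm: "S (merge B A (z, y)) u = S z u" for y u by (simp add: S_def merge_def B_def)
    have fm: "f (merge B A (z, y)) = (\<Prod>k\<in>A. ennreal (exp (l * S z (y k))))" for y
    proof -
      have "(\<Prod>k\<in>A. ennreal (exp (l * S z (y k)))) = (\<Prod>i<n. ennreal (exp (l * S z (y (Inl i)))))"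
        unfolding A_def by (subst prod.reindex) (auto simp: inj_on_def)
      also have "\<dots> = ennreal (exp (\<Sum>i<n. l * S z (y (Inl i))))"
        by (simp add: prod_ennreal exp_sum)
      also have "\<dots> = f (merge B A (z, y))"
      proof -
        have "merge B A (z, y) (Inl i) = y (Inl i)" if "i \<in> {..<n}" for i
          using that by (auto simp: merge_def A_def B_def)
        then have "(\<Sum>i<n. S z (merge B A (z, y) (Inl i))) = (\<Sum>i<n. S z (y (Inl i)))"
          by (intro sum.cong) auto
        then show ?thesis unfolding f_def Sm by (simp add: sum_distrib_left)
      qed
      finally show ?thesis ..
    qed
    have "(\<integral>\<^sup>+y. f (merge B A (z, y)) \<partial>Pi\<^sub>M A N) = (\<Prod>k\<in>A. (\<integral>\<^sup>+u. ennreal (exp (l * S z u)) \<partial>N k))"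
      unfolding fm by (rule PN.product_nn_integral_prod[OF fin(1)]) (auto simp: N_def A_def)
    also have "\<dots> = (\<integral>\<^sup>+u. ennreal (exp (l * S z u)) \<partial>P) ^ n"
      unfolding A_def by (subst prod.reindex) (auto simp: inj_on_def N_def)
    also have "\<dots> \<le> (\<integral>\<^sup>+u. ennreal (exp (real n * (l * S z u)\<^sup>2)) \<partial>P)"
    proof (rule P.exp_centred_power_le)
      show "\<bar>l * S z u\<bar> \<le> \<bar>l\<bar> * (real m * H)" for u
        unfolding abs_mult using S_bound by (intro mult_left_mono) auto
      have "integrable P (\<lambda>u. h u y)" for y
        using bound by (intro P.integrable_const_bound[where B=H]) auto
      then show "P.expectation (\<lambda>u. l * S z u) = 0"
        unfolding S_def by (simp add: deg_x)
    qed measurable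
    finally show "(\<integral>\<^sup>+y. f (merge B A (z, y)) \<partial>Pi\<^sub>M A N) \<le> \<dots>" .
  qed
  also have "\<dots> = (\<integral>\<^sup>+u. (\<integral>\<^sup>+z. ennreal (exp (real n * (l * S z u)\<^sup>2)) \<partial>Pi\<^sub>M B N) \<partial>P)"
  proof -
    interpret pair_sigma_finite "Pi\<^sub>M B N" P ..
    show ?thesis by (rule Fubini'[symmetric]) (simp add: case_prod_beta')
  qed
  also have "\<dots> \<le> (\<integral>\<^sup>+u. ennreal (sqrt 2) \<partial>P)"
  proof (rule nn_integral_mono)
    fix u
    \<comment> \<open>With this \<open>c\<close> the Gaussian moment \<open>exp ((c S)\<^sup>2 / 2)\<close> is \<open>exp (n (l S)\<^sup>2)\<close>.\<close>
    define c where "c = sqrt (2 * real n) * l"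
    have c2: "c\<^sup>2 / 2 = real n * l\<^sup>2" by (simp add: c_def power_mult_distrib)
    have "(\<integral>\<^sup>+z. ennreal (exp (real n * (l * S z u)\<^sup>2)) \<partial>Pi\<^sub>M B N)
        = (\<integral>\<^sup>+z. (\<integral>\<^sup>+g. ennreal (exp ((c * S z u) * g)) \<partial>std_normal_distribution) \<partial>Pi\<^sub>M B N)"
      unfolding nn_integral_exp_normal power_mult_distrib times_divide_eq_left[symmetric] c2 by (simp add: mult_ac)
    also have "\<dots> = (\<integral>\<^sup>+g. (\<integral>\<^sup>+z. ennreal (exp ((c * S z u) * g)) \<partial>Pi\<^sub>M B N) \<partial>std_normal_distribution)"
    proof -
      interpret pair_sigma_finite "Pi\<^sub>M B N" std_normal_distribution ..
      show ?thesis by (rule Fubini'[symmetric]) (simp add: case_prod_beta')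
    qed
    also have "\<dots> \<le> (\<integral>\<^sup>+g. ennreal (exp (g\<^sup>2 / 4)) \<partial>std_normal_distribution)"
    proof (rule nn_integral_mono)
      fix g
      have "(\<integral>\<^sup>+z. ennreal (exp ((c * S z u) * g)) \<partial>Pi\<^sub>M B N) = (\<integral>\<^sup>+z. (\<Prod>k\<in>B. ennreal (exp ((c * g) * h u (z k)))) \<partial>Pi\<^sub>M B N)"
      proof (rule nn_integral_cong)
        fix z
        have "(\<Prod>k\<in>B. ennreal (exp ((c * g) * h u (z k)))) = (\<Prod>j<m. ennreal (exp ((c * g) * h u (z (Inr j)))))"
          unfolding B_def by (subst prod.reindex) (auto simp: inj_on_def)
        also have "\<dots> = ennreal (exp (\<Sum>j<m. (c * g) * h u (z (Inr j))))"
          by (simp add: prod_ennreal exp_sum)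
        also have "(\<Sum>j<m. (c * g) * h u (z (Inr j))) = (c * S z u) * g"
          by (simp add: S_def sum_distrib_left sum_distrib_right mult_ac)
        finally show "ennreal (exp ((c * S z u) * g)) = (\<Prod>k\<in>B. ennreal (exp ((c * g) * h u (z k))))" ..
      qed
      also have "\<dots> = (\<Prod>k\<in>B. (\<integral>\<^sup>+y. ennreal (exp ((c * g) * h u y)) \<partial>N k))"
        by (rule PN.product_nn_integral_prod[OF fin(2)]) (auto simp: N_def B_def)
      also have "\<dots> = (\<integral>\<^sup>+y. ennreal (exp ((c * g) * h u y)) \<partial>Q) ^ m"
        unfolding B_def by (subst prod.reindex) (auto simp: inj_on_def N_def)
      also have "\<dots> \<le> ennreal (exp ((c * g)\<^sup>2 * H\<^sup>2 / 2)) ^ m"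
        by (intro power_mono Q.hoeffding_mgf) (auto simp: bound deg_y)
      also have "\<dots> = ennreal (exp (real m * ((c * g)\<^sup>2 * H\<^sup>2 / 2)))"
        by (simp add: ennreal_power flip: exp_of_nat_mult)
      also have "\<dots> \<le> ennreal (exp (g\<^sup>2 / 4))"
      proof -
        have "real m * ((c * g)\<^sup>2 * H\<^sup>2 / 2) = (4 * (real n * real m) * (l\<^sup>2 * H\<^sup>2)) * (g\<^sup>2 / 4)"
          using c2 by (simp add: power_mult_distrib field_simps)
        also have "\<dots> \<le> 1 * (g\<^sup>2 / 4)" using l by (intro mult_right_mono) auto
        finally show ?thesis by (intro ennreal_leI) simp
      qed
      finally show "(\<integral>\<^sup>+z. ennreal (exp ((c * S z u) * g)) \<partial>Pi\<^sub>M B N) \<le> ennreal (exp (g\<^sup>2 / 4))" .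
    qed
    also have "\<dots> = ennreal (sqrt 2)" by (rule nn_integral_exp_square_normal)
    finally show "(\<integral>\<^sup>+z. ennreal (exp (real n * (l * S z u)\<^sup>2)) \<partial>Pi\<^sub>M B N) \<le> ennreal (sqrt 2)" .
  qed
  also have "\<dots> = ennreal (sqrt 2)" by (simp add: P.emeasure_space_1[simplified])
  finally show ?thesis .
qed

section \<open>The Hoeffding decomposition of the pair indicators\<close>

text \<open>Exponential Markov inequality for both signs, with the largest \<open>l\<close> that \<open>degenerate_chaos_mgf\<close> admits.\<close>
lemma (in prob_space) degenerate_chaos_tail:
  fixes xi eps :: "nat \<Rightarrow> 'a \<Rightarrow> real" and h :: "real \<Rightarrow> real \<Rightarrow> real"
  assumes indep: "indep_vars (\<lambda>_. borel) (case_sum xi eps) UNIV"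
    and law_xi: "\<And>i. distr M borel (xi i) = P" and law_eps: "\<And>j. distr M borel (eps j) = Q"
    and nm: "0 < n" "0 < m"
    and meas: "case_prod h \<in> borel_measurable (borel \<Otimes>\<^sub>M borel)"
    and bound: "\<And>x y. \<bar>h x y\<bar> \<le> H" and H: "0 < H"
    and deg_x: "\<And>y. (\<integral>x. h x y \<partial>P) = 0" and deg_y: "\<And>x. (\<integral>y. h x y \<partial>Q) = 0"
  shows "prob {\<omega> \<in> space M. b \<le> \<bar>\<Sum>i<n. \<Sum>j<m. h (xi i \<omega>) (eps j \<omega>)\<bar>}
    \<le> 3 * exp (- b / (2 * H * sqrt (real n * real m)))"
proof -
  define l where "l = 1 / (2 * H * sqrt (real n * real m))"
  define T where "T \<omega> = (\<Sum>i<n. \<Sum>j<m. h (xi i \<omega>) (eps j \<omega>))" for \<omega>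
  have l0: "0 < l" using nm H by (simp add: l_def)
  have rv: "random_variable borel (case_sum xi eps k)" for k
    using indep by (auto simp: indep_vars_def)
  have rv_xi: "xi i \<in> borel_measurable M" and rv_eps: "eps i \<in> borel_measurable M" for i
    using rv[of "Inl i"] rv[of "Inr i"] by simp_all
  have [measurable]: "T \<in> borel_measurable M" unfolding T_def
    using measurable_compose[OF measurable_Pair[OF rv_xi rv_eps] meas]
    by (intro borel_measurable_sum) simp
  have l2: "4 * (real n * real m) * (l\<^sup>2 * H\<^sup>2) \<le> 1"
    using nm H by (simp add: l_def power_divide power_mult_distrib)
  have one: "prob {\<omega> \<in> space M. b \<le> c * T \<omega>} \<le> sqrt 2 * exp (- (l * b))" if c: "c\<^sup>2 = 1" for c
  proof -
    have "emeasure M {\<omega> \<in> space M. b \<le> c * T \<omega>} = (\<integral>\<^sup>+\<omega>. indicator {\<omega> \<in> space M. b \<le> c * T \<omega>} \<omega> \<partial>M)"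
      by simp
    also have "\<dots> \<le> (\<integral>\<^sup>+\<omega>. ennreal (exp (- (l * b))) * ennreal (exp ((l * c) * T \<omega>)) \<partial>M)"
    proof (rule nn_integral_mono)
      fix \<omega>
      have "1 \<le> exp (- (l * b)) * exp ((l * c) * T \<omega>)" if "b \<le> c * T \<omega>"
        using mult_left_mono[OF that, of l] l0 by (simp add: mult.assoc flip: exp_add)
      then show "indicator {\<omega> \<in> space M. b \<le> c * T \<omega>} \<omega> \<le> ennreal (exp (- (l * b))) * ennreal (exp ((l * c) * T \<omega>))"
        by (auto split: split_indicator simp flip: ennreal_mult)
    qed
    also have "\<dots> = ennreal (exp (- (l * b))) * (\<integral>\<^sup>+\<omega>. ennreal (exp ((l * c) * T \<omega>)) \<partial>M)"
      by (rule nn_integral_cmult) measurable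
    also have "\<dots> \<le> ennreal (exp (- (l * b))) * ennreal (sqrt 2)"
    proof (rule mult_left_mono)
      show "(\<integral>\<^sup>+\<omega>. ennreal (exp ((l * c) * T \<omega>)) \<partial>M) \<le> ennreal (sqrt 2)"
        unfolding T_def
        using l2 c by (intro degenerate_chaos_mgf[OF indep law_xi law_eps nm meas bound deg_x deg_y])
          (simp add: power_mult_distrib)
    qed simp
    finally show ?thesis by (simp add: emeasure_eq_measure mult.commute flip: ennreal_mult)
  qed
  have "prob {\<omega> \<in> space M. b \<le> \<bar>T \<omega>\<bar>} \<le> prob ({\<omega> \<in> space M. b \<le> 1 * T \<omega>} \<union> {\<omega> \<in> space M. b \<le> (-1) * T \<omega>})"
    by (intro finite_measure_mono) auto
  also have "\<dots> \<le> prob {\<omega> \<in> space M. b \<le> 1 * T \<omega>} + prob {\<omega> \<in> space M. b \<le> (-1) * T \<omega>}"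
    by (rule measure_Un_le) auto
  also have "\<dots> \<le> sqrt 2 * exp (- (l * b)) + sqrt 2 * exp (- (l * b))"
    by (intro add_mono one) auto
  also have "\<dots> = (2 * sqrt 2) * exp (- (l * b))" by simp
  also have "\<dots> \<le> 3 * exp (- (l * b))"
  proof (rule mult_right_mono)
    have "sqrt 2 \<le> 3 / 2" by (intro real_le_lsqrt) (auto simp: power2_eq_square)
    then show "2 * sqrt 2 \<le> 3" by simp
  qed simp
  finally show ?thesis by (simp add: T_def l_def)
qed

lemma (in real_distribution) quantile_exists:
  assumes "0 < p" "p < 1"
  obtains a where "p \<le> cdf M a" "\<And>t. t < a \<Longrightarrow> cdf M t < p"
    "a = Inf {t. p \<le> cdf M t}"
proof -
  define A where "A = {t. p \<le> cdf M t}"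
  have "\<forall>\<^sub>F t in at_top. p < cdf M t" using order_tendstoD(1)[OF cdf_lim_at_top_prob assms(2)] .
  then obtain t1 where "p < cdf M t1" by (auto simp: eventually_at_top_linorder)
  then have ne: "A \<noteq> {}" unfolding A_def using less_imp_le by blast
  have "\<forall>\<^sub>F t in at_bot. cdf M t < p" using order_tendstoD(2)[OF cdf_lim_at_bot assms(1)] .
  then obtain t0 where t0: "\<And>t. t \<le> t0 \<Longrightarrow> cdf M t < p" by (auto simp: eventually_at_bot_linorder)
  have bdd: "bdd_below A"
  proof (rule bdd_belowI[of _ t0])
    fix t assume "t \<in> A" then show "t0 \<le> t" using t0[of t] by (cases "t \<le> t0") (auto simp: A_def)
  qed
  define a where "a = Inf A"
  have below: "cdf M t < p" if "t < a" for t
  proof (rule ccontr)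
    assume "\<not> cdf M t < p"
    then have "a \<le> t" unfolding a_def by (intro cInf_lower bdd) (simp add: A_def)
    then show False using that by simp
  qed
  have above: "p \<le> cdf M t" if t: "a < t" for t
  proof -
    obtain s where "s \<in> A" "s < t" using cInf_lessD[OF ne] t by (auto simp: a_def)
    then show ?thesis using cdf_nondecreasing[of s t] by (auto simp: A_def)
  qed
  have lim: "(cdf M \<longlongrightarrow> cdf M a) (at_right a)"
    using cdf_is_right_cont[of a] by (simp add: continuous_within)
  have "p \<le> cdf M a"
    by (rule tendsto_lowerbound[OF lim]) (auto simp: eventually_at_filter intro!: always_eventually above)
  then show thesis using that below by (auto simp: a_def A_def)
qed

text \<open>A differentiable distribution function of the difference has no jumps; the absence of ties is what this
  amounts to for the sample.\<close>
locale two_sample = prob_space +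
  fixes xi eps :: "nat \<Rightarrow> 'a \<Rightarrow> real"
  assumes indep: "indep_vars (\<lambda>_. borel) (case_sum xi eps) UNIV"
    and ident_xi: "\<And>i. distr M borel (xi i) = distr M borel (xi 0)"
    and ident_eps: "\<And>j. distr M borel (eps j) = distr M borel (eps 0)"
    and no_ties: "\<And>u. prob {\<omega> \<in> space M. xi 0 \<omega> - eps 0 \<omega> = u} = 0"
begin

text \<open>\<open>g u x\<close> and \<open>f u y\<close> are the conditional probabilities of \<open>xi - eps \<le> u\<close> given \<open>xi = x\<close> and given \<open>eps = y\<close>; the
  kernel \<open>h u\<close> is what remains of the indicator after both projections are removed.\<close>
definition "P = distr M borel (xi 0)"
definition "Q = distr M borel (eps 0)"
definition "V u = prob {\<omega> \<in> space M. xi 0 \<omega> - eps 0 \<omega> \<le> u}"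
definition "f u y = measure P {x. x - y \<le> u}"
definition "g u x = measure Q {y. x - y \<le> u}"
definition "h u x y = of_bool (x - y \<le> u) - g u x - f u y + V u"
definition "var_f u = (\<integral>y. (f u y - V u)\<^sup>2 \<partial>Q)"
definition "var_g u = (\<integral>x. (g u x - V u)\<^sup>2 \<partial>P)"

lemma rv[measurable]: "xi i \<in> borel_measurable M" "eps i \<in> borel_measurable M"
proof -
  have rv: "random_variable borel (case_sum xi eps k)" for k
    using indep by (auto simp: indep_vars_def)
  show "xi i \<in> borel_measurable M" "eps i \<in> borel_measurable M" using rv[of "Inl i"] rv[of "Inr i"] by simp_all
qed

lemma sets_PQ[simp, measurable_cong]: "sets P = sets borel" "sets Q = sets borel"
  and space_PQ[simp]: "space P = UNIV" "space Q = UNIV"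
  by (simp_all add: P_def Q_def)

sublocale P: real_distribution P unfolding P_def by (rule real_distribution_distr) simp
sublocale Q: real_distribution Q unfolding Q_def by (rule real_distribution_distr) simp
sublocale PQ: pair_prob_space P Q ..

lemma law_xi: "distr M borel (xi i) = P" and law_eps: "distr M borel (eps j) = Q"
  using ident_xi ident_eps by (simp_all add: P_def Q_def)

lemma joint_law: "distr M (borel \<Otimes>\<^sub>M borel) (\<lambda>\<omega>. (xi i \<omega>, eps j \<omega>)) = P \<Otimes>\<^sub>M Q"
proof (rule pair_measure_eqI[symmetric])
  fix A B assume "A \<in> sets P" "B \<in> sets Q"
  then have [measurable]: "A \<in> sets borel" "B \<in> sets borel" by simp_all
  let ?A = "case_sum (\<lambda>_. A) (\<lambda>_. B) :: nat + nat \<Rightarrow> real set"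
  have "prob (\<Inter>k\<in>{Inl i, Inr j}. case_sum xi eps k -` ?A k \<inter> space M)
      = (\<Prod>k\<in>{Inl i, Inr j}. prob (case_sum xi eps k -` ?A k \<inter> space M))"
    by (rule indep_varsD[OF indep]) auto
  then have "prob ((xi i -` A \<inter> space M) \<inter> (eps j -` B \<inter> space M))
      = prob (xi i -` A \<inter> space M) * prob (eps j -` B \<inter> space M)" by simp
  also have "prob (xi i -` A \<inter> space M) = measure P A" by (simp add: measure_distr flip: law_xi[of i])
  also have "prob (eps j -` B \<inter> space M) = measure Q B" by (simp add: measure_distr flip: law_eps[of j])
  also have "(xi i -` A \<inter> space M) \<inter> (eps j -` B \<inter> space M) = (\<lambda>\<omega>. (xi i \<omega>, eps j \<omega>)) -` (A \<times> B) \<inter> space M"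
    by auto
  finally show "emeasure P A * emeasure Q B
      = emeasure (distr M (borel \<Otimes>\<^sub>M borel) (\<lambda>\<omega>. (xi i \<omega>, eps j \<omega>))) (A \<times> B)"
    by (simp add: emeasure_distr P.emeasure_eq_measure Q.emeasure_eq_measure emeasure_eq_measure ennreal_mult)
next
  show "sets (P \<Otimes>\<^sub>M Q) = sets (distr M (borel \<Otimes>\<^sub>M borel) (\<lambda>\<omega>. (xi i \<omega>, eps j \<omega>)))"
    by (simp cong: sets_pair_measure_cong)
qed unfold_locales

lemma prob_pair:
  assumes [measurable]: "Measurable.pred (borel \<Otimes>\<^sub>M borel) A"
  shows "prob {\<omega> \<in> space M. A (xi i \<omega>, eps j \<omega>)} = measure (P \<Otimes>\<^sub>M Q) {p. A p}"
proof -
  have "{p \<in> space (borel \<Otimes>\<^sub>M borel). A p} \<in> sets (borel \<Otimes>\<^sub>M borel)" by measurable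
  then have [measurable]: "{p. A p} \<in> sets (borel \<Otimes>\<^sub>M borel)" by (simp add: space_pair_measure)
  have "measure (P \<Otimes>\<^sub>M Q) {p. A p} = measure (distr M (borel \<Otimes>\<^sub>M borel) (\<lambda>\<omega>. (xi i \<omega>, eps j \<omega>))) {p. A p}"
    by (simp add: joint_law)
  also have "\<dots> = prob {\<omega> \<in> space M. A (xi i \<omega>, eps j \<omega>)}"
    by (subst measure_distr) (auto intro!: arg_cong2[where f=measure])
  finally show ?thesis ..
qed

lemma no_tie_pair: "prob {\<omega> \<in> space M. xi i \<omega> - eps j \<omega> = u} = 0"
  using prob_pair[of "\<lambda>p. fst p - snd p = u" i j] prob_pair[of "\<lambda>p. fst p - snd p = u" 0 0] no_ties[of u] by simp

lemma V_mono: "u \<le> u' \<Longrightarrow> V u \<le> V u'" and V_bounds: "0 \<le> V u" "V u \<le> 1"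
  unfolding V_def by (auto intro!: finite_measure_mono)

lemma f_bounds: "0 \<le> f u y" "f u y \<le> 1" and g_bounds: "0 \<le> g u x" "g u x \<le> 1"
  by (simp_all add: f_def g_def)

lemma fg_sets[measurable, simp]: "{x::real. x - y \<le> u} \<in> sets borel" "{y::real. x - y \<le> u} \<in> sets borel"
  by measurable

lemma f_mono: "u \<le> u' \<Longrightarrow> f u y \<le> f u' y" and g_mono: "u \<le> u' \<Longrightarrow> g u x \<le> g u' x"
  unfolding f_def g_def by (auto intro!: P.finite_measure_mono Q.finite_measure_mono)

lemma f_measurable[measurable]: "f u \<in> borel_measurable borel"
  unfolding f_def by (rule borel_measurable_mono) (auto simp: mono_def intro!: P.finite_measure_mono)

lemma g_measurable[measurable]: "g u \<in> borel_measurable borel"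
proof -
  have "(\<lambda>x. - g u x) \<in> borel_measurable borel"
    unfolding g_def by (rule borel_measurable_mono) (auto simp: mono_def intro!: Q.finite_measure_mono)
  then show ?thesis by simp
qed

lemma integrable_f[simp]: "integrable Q (f u)" and integrable_g[simp]: "integrable P (g u)"
  using f_bounds g_bounds
  by (auto intro!: Q.integrable_const_bound[where B=1] P.integrable_const_bound[where B=1])

lemma mean_g: "(\<integral>x. g u x \<partial>P) = V u" and mean_f: "(\<integral>y. f u y \<partial>Q) = V u"
proof -
  let ?A = "{p. fst p - snd p \<le> u}"
  have "{p \<in> space (borel \<Otimes>\<^sub>M borel). fst p - snd p \<le> u} \<in> sets (borel \<Otimes>\<^sub>M borel)" by measurable
  then have "?A \<in> sets (borel \<Otimes>\<^sub>M borel)" by (simp add: space_pair_measure)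
  then have A: "?A \<in> sets (P \<Otimes>\<^sub>M Q)" by (simp cong: sets_pair_measure_cong)
  have V: "V u = measure (P \<Otimes>\<^sub>M Q) ?A"
    unfolding V_def using prob_pair[of "\<lambda>p. fst p - snd p \<le> u" 0 0] by simp
  have "ennreal (V u) = (\<integral>\<^sup>+x. emeasure Q (Pair x -` ?A) \<partial>P)"
    unfolding V PQ.emeasure_eq_measure[symmetric] by (rule Q.emeasure_pair_measure_alt[OF A])
  also have "\<dots> = (\<integral>\<^sup>+x. ennreal (g u x) \<partial>P)"
    by (intro nn_integral_cong) (simp add: g_def Q.emeasure_eq_measure vimage_def)
  also have "\<dots> = ennreal (\<integral>x. g u x \<partial>P)"
    using g_bounds by (intro nn_integral_eq_integral) auto
  finally show "(\<integral>x. g u x \<partial>P) = V u"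
    using V_bounds g_bounds by (simp add: integral_nonneg_AE)
  have "ennreal (V u) = (\<integral>\<^sup>+y. emeasure P ((\<lambda>x. (x, y)) -` ?A) \<partial>Q)"
    unfolding V PQ.emeasure_eq_measure[symmetric] by (rule PQ.emeasure_pair_measure_alt2[OF A])
  also have "\<dots> = (\<integral>\<^sup>+y. ennreal (f u y) \<partial>Q)"
    by (intro nn_integral_cong) (simp add: f_def P.emeasure_eq_measure vimage_def)
  also have "\<dots> = ennreal (\<integral>y. f u y \<partial>Q)"
    using f_bounds by (intro nn_integral_eq_integral) auto
  finally show "(\<integral>y. f u y \<partial>Q) = V u"
    using V_bounds f_bounds by (simp add: integral_nonneg_AE)
qed

lemma h_measurable: "case_prod (h u) \<in> borel_measurable (borel \<Otimes>\<^sub>M borel)"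
  unfolding h_def by measurable

lemma h_bound: "\<bar>h u x y\<bar> \<le> 2"
  using f_bounds[of u y] g_bounds[of u x] V_bounds[of u] by (auto simp: h_def abs_le_iff)

lemma h_degenerate: "(\<integral>x. h u x y \<partial>P) = 0" "(\<integral>y. h u x y \<partial>Q) = 0"
proof -
  have 1: "(\<integral>x. of_bool (x - y \<le> u) \<partial>P) = f u y" "integrable P (\<lambda>x. of_bool (x - y \<le> u) :: real)"
  proof -
    have eq: "(\<lambda>x. of_bool (x - y \<le> u) :: real) = indicator {x. x - y \<le> u}" by (auto simp: indicator_def)
    show "(\<integral>x. of_bool (x - y \<le> u) \<partial>P) = f u y" "integrable P (\<lambda>x. of_bool (x - y \<le> u) :: real)"
      unfolding eq by (simp_all add: f_def P.emeasure_eq_measure)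
  qed
  show "(\<integral>x. h u x y \<partial>P) = 0" unfolding h_def using 1 P.prob_space by (simp add: mean_g)
  have 2: "(\<integral>y. of_bool (x - y \<le> u) \<partial>Q) = g u x" "integrable Q (\<lambda>y. of_bool (x - y \<le> u) :: real)"
  proof -
    have eq: "(\<lambda>y. of_bool (x - y \<le> u) :: real) = indicator {y. x - y \<le> u}" by (auto simp: indicator_def)
    show "(\<integral>y. of_bool (x - y \<le> u) \<partial>Q) = g u x" "integrable Q (\<lambda>y. of_bool (x - y \<le> u) :: real)"
      unfolding eq by (simp_all add: g_def Q.emeasure_eq_measure)
  qed
  show "(\<integral>y. h u x y \<partial>Q) = 0" unfolding h_def using 2 Q.prob_space by (simp add: mean_f)
qed

text \<open>A monotone change of a function with values in \<open>[0, 1]\<close> has an \<open>L\<^sup>1\<close>-size equal to the change of its mean,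
  which therefore controls the change of the variance.\<close>
lemma variance_perturbation:
  fixes a b :: "real \<Rightarrow> real"
  assumes "real_distribution R" and [measurable]: "a \<in> borel_measurable borel" "b \<in> borel_measurable borel"
    and ab: "\<And>x. 0 \<le> a x" "\<And>x. a x \<le> b x" "\<And>x. b x \<le> 1"
    and means: "(\<integral>x. a x \<partial>R) = \<alpha>" "(\<integral>x. b x \<partial>R) = \<beta>"
  shows "\<bar>(\<integral>x. (a x - \<alpha>)\<^sup>2 \<partial>R) - (\<integral>x. (b x - \<beta>)\<^sup>2 \<partial>R)\<bar> \<le> 4 * (\<beta> - \<alpha>)"
proof -
  interpret R: real_distribution R by fact
  have ab': "0 \<le> b x" "a x \<le> 1" for x
    by (rule order_trans[OF ab(1,2)], rule order_trans[OF ab(2,3)])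
  have int: "integrable R a" "integrable R b"
    using ab ab' by (auto intro!: R.integrable_const_bound[where B=1])
  have \<alpha>: "0 \<le> \<alpha>" unfolding means[symmetric] using ab by (intro integral_nonneg_AE) auto
  have \<alpha>\<beta>: "\<alpha> \<le> \<beta>" unfolding means[symmetric] using int ab by (intro integral_mono)
  have "\<beta> \<le> (\<integral>x. 1 \<partial>R)" unfolding means[symmetric] using int ab by (intro integral_mono) auto
  then have \<beta>: "\<beta> \<le> 1" using R.prob_space by simp
  have sq: "\<bar>p - q\<bar> \<le> 1" if "0 \<le> p" "p \<le> 1" "0 \<le> q" "q \<le> 1" for p q :: real using that by auto
  have bd: "\<bar>a x - \<alpha>\<bar> \<le> 1" "\<bar>b x - \<beta>\<bar> \<le> 1" for x
    using ab ab' \<alpha> \<beta> \<alpha>\<beta> by (auto intro!: sq)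
  have ints: "integrable R (\<lambda>x. (a x - \<alpha>)\<^sup>2)" "integrable R (\<lambda>x. (b x - \<beta>)\<^sup>2)"
    using bd by (auto intro!: R.integrable_const_bound[where B=1] simp: abs_square_le_1)
  have "norm ((\<integral>x. (a x - \<alpha>)\<^sup>2 \<partial>R) - (\<integral>x. (b x - \<beta>)\<^sup>2 \<partial>R)) \<le> (\<integral>x. 2 * ((b x - a x) + (\<beta> - \<alpha>)) \<partial>R)"
  proof (rule R.abs_expectation_diff_le[OF ints])
    show "integrable R (\<lambda>x. 2 * ((b x - a x) + (\<beta> - \<alpha>)))" using int by simp
    fix x
    have "(a x - \<alpha>)\<^sup>2 - (b x - \<beta>)\<^sup>2 = ((a x - \<alpha>) + (b x - \<beta>)) * ((a x - b x) + (\<beta> - \<alpha>))"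
      by (simp add: power2_eq_square algebra_simps)
    also have "\<bar>\<dots>\<bar> \<le> 2 * ((b x - a x) + (\<beta> - \<alpha>))"
      unfolding abs_mult
    proof (rule mult_mono)
      show "\<bar>(a x - \<alpha>) + (b x - \<beta>)\<bar> \<le> 2" using bd[of x] by linarith
      show "\<bar>(a x - b x) + (\<beta> - \<alpha>)\<bar> \<le> (b x - a x) + (\<beta> - \<alpha>)" using ab(2)[of x] \<alpha>\<beta> by linarith
    qed auto
    finally show "norm ((a x - \<alpha>)\<^sup>2 - (b x - \<beta>)\<^sup>2) \<le> 2 * ((b x - a x) + (\<beta> - \<alpha>))" by simp
  qed
  also have "\<dots> = 4 * (\<beta> - \<alpha>)" using int means R.prob_space by simp
  finally show ?thesis by simp
qed

lemma var_perturbation: "\<bar>var_f u - var_f 0\<bar> \<le> 4 * \<bar>V u - V 0\<bar>" "\<bar>var_g u - var_g 0\<bar> \<le> 4 * \<bar>V u - V 0\<bar>"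
proof -
  have F: "\<bar>var_f u - var_f u'\<bar> \<le> 4 * (V u' - V u)" and G: "\<bar>var_g u - var_g u'\<bar> \<le> 4 * (V u' - V u)" if "u \<le> u'" for u u'
    unfolding var_f_def var_g_def using that
    by (intro variance_perturbation P.real_distribution_axioms Q.real_distribution_axioms f_measurable g_measurable
        f_bounds g_bounds f_mono g_mono mean_f mean_g; assumption?)+
  show "\<bar>var_f u - var_f 0\<bar> \<le> 4 * \<bar>V u - V 0\<bar>" "\<bar>var_g u - var_g 0\<bar> \<le> 4 * \<bar>V u - V 0\<bar>"
    using F[of u 0] F[of 0 u] G[of u 0] G[of 0 u] V_mono[of u 0] V_mono[of 0 u]
    by (cases "u \<le> 0"; simp add: abs_minus_commute)+
qed

lemma var_nonneg: "0 \<le> var_f u" "0 \<le> var_g u"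
  by (simp_all add: var_f_def var_g_def)

text \<open>A common atom of both noise laws would be a tie.\<close>
lemma atom_null: "AE x in P. measure Q {x} = 0"
proof -
  let ?A = "{p. fst p - snd p = (0::real)}"
  have "{p \<in> space (borel \<Otimes>\<^sub>M borel). fst p - snd p = (0::real)} \<in> sets (borel \<Otimes>\<^sub>M borel)" by measurable
  then have A0: "?A \<in> sets (borel \<Otimes>\<^sub>M borel)" by (simp add: space_pair_measure)
  then have A: "?A \<in> sets (P \<Otimes>\<^sub>M Q)" by (simp cong: sets_pair_measure_cong)
  have m: "(\<lambda>x. emeasure Q (Pair x -` ?A)) \<in> borel_measurable P"
    by (rule Q.measurable_emeasure_Pair[OF A])
  have "(\<integral>\<^sup>+x. emeasure Q (Pair x -` ?A) \<partial>P) = emeasure (P \<Otimes>\<^sub>M Q) ?A"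
    by (rule Q.emeasure_pair_measure_alt[OF A, symmetric])
  also have "\<dots> = 0"
    using no_ties[of 0] prob_pair[of "\<lambda>p. fst p - snd p = 0" 0 0] by (simp add: PQ.emeasure_eq_measure)
  finally have "AE x in P. emeasure Q (Pair x -` ?A) = 0"
    using m by (simp add: nn_integral_0_iff_AE)
  moreover have "Pair x -` ?A = {x}" for x by auto
  ultimately show ?thesis by (simp add: Q.emeasure_eq_measure)
qed

lemma g_0_eq: "AE x in P. g 0 x = 1 - cdf Q x"
  using atom_null
proof eventually_elim
  case (elim x)
  have "{y. x - y \<le> 0} = {x} \<union> (UNIV - {..x})" by auto
  then have "g 0 x = measure Q ({x} \<union> (UNIV - {..x}))" by (simp only: g_def)
  also have "\<dots> = measure Q {x} + measure Q (UNIV - {..x})"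
    by (rule Q.finite_measure_Union) auto
  also have "measure Q (UNIV - {..x}) = 1 - cdf Q x"
    using Q.prob_compl[of "{..x}"] by (simp add: cdf_def)
  finally show ?case using elim by simp
qed

lemma f_0_eq: "f 0 y = cdf P y"
proof -
  have "{x. x - y \<le> 0} = {..y}" by auto
  then show ?thesis by (simp add: f_def cdf_def)
qed

lemma var_f_0: "variance (\<lambda>\<omega>. cdf P (eps 0 \<omega>)) = var_f 0"
proof -
  have [measurable]: "cdf P \<in> borel_measurable borel" using f_measurable[of 0] by (simp add: f_0_eq[abs_def])
  have E: "expectation (\<lambda>\<omega>. cdf P (eps 0 \<omega>)) = V 0"
    unfolding mean_f[symmetric] f_0_eq Q_def by (subst integral_distr) auto
  show ?thesis unfolding E var_f_def f_0_eq Q_def by (subst integral_distr) auto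
qed

lemma var_g_0: "variance (\<lambda>\<omega>. cdf Q (xi 0 \<omega>)) = var_g 0"
proof -
  have [measurable]: "cdf Q \<in> borel_measurable borel"
    using Q.cdf_nondecreasing by (intro borel_measurable_mono) (auto simp: mono_def)
  have int: "integrable P (cdf Q)"
    using Q.cdf_nonneg Q.cdf_bounded_prob by (intro P.integrable_const_bound[where B=1]) auto
  have E0: "expectation (\<lambda>\<omega>. cdf Q (xi 0 \<omega>)) = (\<integral>x. cdf Q x \<partial>P)"
    unfolding P_def by (subst integral_distr) auto
  have "V 0 = (\<integral>x. 1 - cdf Q x \<partial>P)"
    unfolding mean_g[symmetric] using g_0_eq by (intro integral_cong_AE) auto
  also have "\<dots> = 1 - expectation (\<lambda>\<omega>. cdf Q (xi 0 \<omega>))"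
    using int P.prob_space by (simp add: E0)
  finally have E: "expectation (\<lambda>\<omega>. cdf Q (xi 0 \<omega>)) = 1 - V 0" by simp
  have "var_g 0 = (\<integral>x. (cdf Q x - (1 - V 0))\<^sup>2 \<partial>P)"
    unfolding var_g_def
  proof (rule integral_cong_AE)
    show "AE x in P. (g 0 x - V 0)\<^sup>2 = (cdf Q x - (1 - V 0))\<^sup>2"
      using g_0_eq
    proof eventually_elim
      case (elim x)
      then have "g 0 x - V 0 = - (cdf Q x - (1 - V 0))" by simp
      then show ?case by (simp only: power2_minus)
    qed
  qed measurable
  then show ?thesis unfolding E P_def by (subst (asm) integral_distr) auto
qed

text \<open>If both variances vanished, then \<open>cdf P\<close> would be \<open>1/2\<close> almost everywhere under \<open>Q\<close> and \<open>cdf Q\<close> would be \<open>1/2\<close> almost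
  everywhere under \<open>P\<close>. So each law lives to the right of the lower median of the other one. The medians
  then agree and carry mass at least \<open>1/2\<close> under both laws, which is a tie of positive probability.\<close>
lemma var_pos:
  assumes V0: "V 0 = 1 / 2"
  shows "0 < var_f 0 + var_g 0"
proof (rule ccontr)
  assume "\<not> ?thesis"
  then have z: "var_f 0 = 0" "var_g 0 = 0" using var_nonneg[of 0] by auto
  have intf: "integrable Q (\<lambda>y. (f 0 y - V 0)\<^sup>2)" "integrable P (\<lambda>x. (g 0 x - V 0)\<^sup>2)"
  proof -
    have "\<bar>f 0 y - V 0\<bar> \<le> 1" "\<bar>g 0 x - V 0\<bar> \<le> 1" for x y
      using f_bounds[of 0 y] g_bounds[of 0 x] V0 by (auto simp: abs_le_iff)
    then show "integrable Q (\<lambda>y. (f 0 y - V 0)\<^sup>2)" "integrable P (\<lambda>x. (g 0 x - V 0)\<^sup>2)"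
      by (auto intro!: Q.integrable_const_bound[where B=1] P.integrable_const_bound[where B=1] simp: abs_square_le_1)
  qed
  have F: "AE y in Q. cdf P y = 1 / 2"
    using z(1) intf(1) by (simp add: var_f_def integral_nonneg_eq_0_iff_AE f_0_eq V0)
  have "AE x in P. g 0 x = 1 / 2"
    using z(2) intf(2) by (simp add: var_g_def integral_nonneg_eq_0_iff_AE V0)
  then have G: "AE x in P. cdf Q x = 1 / 2" using g_0_eq by eventually_elim simp
  obtain a where a: "1 / 2 \<le> cdf P a" "\<And>t. t < a \<Longrightarrow> cdf P t < 1 / 2"
    by (rule P.quantile_exists[of "1 / 2"]) auto
  obtain b where b: "1 / 2 \<le> cdf Q b" "\<And>t. t < b \<Longrightarrow> cdf Q t < 1 / 2"
    by (rule Q.quantile_exists[of "1 / 2"]) auto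
  have Qa: "AE y in Q. a \<le> y" using F
  proof eventually_elim
    case (elim y) then show ?case using a(2)[of y] by (cases "y < a") auto
  qed
  have Pb: "AE x in P. b \<le> x" using G
  proof eventually_elim
    case (elim x) then show ?case using b(2)[of x] by (cases "x < b") auto
  qed
  have Q0: "measure Q {..<a} = 0" using Qa by (subst Q.prob_eq_0) (auto simp: not_less)
  have P0: "measure P {..<b} = 0" using Pb by (subst P.prob_eq_0) (auto simp: not_less)
  have "a \<le> b"
  proof (rule ccontr)
    assume "\<not> a \<le> b"
    then have "cdf Q b \<le> measure Q {..<a}" unfolding cdf_def by (intro Q.finite_measure_mono) auto
    then show False using Q0 b(1) by simp
  qed
  moreover have "b \<le> a"
  proof (rule ccontr)
    assume "\<not> b \<le> a"
    then have "cdf P a \<le> measure P {..<b}" unfolding cdf_def by (intro P.finite_measure_mono) auto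
    then show False using P0 a(1) by simp
  qed
  ultimately have ab: "b = a" by simp
  have u: "{..a} = {..<a} \<union> {a}" by auto
  have "measure Q {a} \<ge> 1 / 2"
    using b(1) Q0 measure_Un_le[of "{..<a}" Q "{a}"] unfolding ab cdf_def u by simp
  moreover have "measure P {a} \<ge> 1 / 2"
    using a(1) P0 measure_Un_le[of "{..<a}" P "{a}"] unfolding ab cdf_def u by simp
  moreover have "AE x in P. x \<noteq> a"
    using atom_null by eventually_elim (use \<open>measure Q {a} \<ge> 1 / 2\<close> in auto)
  then have "measure P {a} = 0" by (subst P.prob_eq_0) auto
  ultimately show False by simp
qed

end

section \<open>Normal approximation of the proportion of pairs below a level\<close>

context two_sample
begin

text \<open>\<open>sd\<close> is the standard deviation of \<open>\<surd>N\<close> times the linear part at level \<open>u\<close>, \<open>emp\<close> the proportion of pairs with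
  difference at most \<open>u\<close>, and \<open>thr\<close> the value that the standardised statistic has to exceed for this
  proportion to fall below one half.\<close>
definition "sd n m u = sqrt (real m / (real n + real m) * var_g u + real n / (real n + real m) * var_f u)"

definition "emp n m u \<omega> = (\<Sum>i<n. \<Sum>j<m. of_bool (xi i \<omega> - eps j \<omega> \<le> u)) / (real n * real m)"

definition "thr n m u = sqrt (eff_size n m) * (V u - 1 / 2) / sd n m u"

lemma emp_measurable[measurable]: "emp n m u \<in> borel_measurable M"
  unfolding emp_def by measurable

context
  fixes n m :: nat and u B :: real
  assumes nm: "0 < n" "0 < m" and sd: "0 < sd n m u"
    and B: "1 / (sd n m u * sqrt (eff_size n m)) \<le> B" "B \<le> 1 / 2"
begin

text \<open>The summands of the linear part, with the sign reversed because a small proportion means a large estimator.\<close>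
definition "score k x = (case k of
    Inl _ \<Rightarrow> sqrt (eff_size n m) / (real n * sd n m u) * (V u - g u x)
  | Inr _ \<Rightarrow> sqrt (eff_size n m) / (real m * sd n m u) * (V u - f u x))"
  for k :: "nat + nat"

definition "indices = (Inl ` {..<n} \<union> Inr ` {..<m} :: (nat + nat) set)"

definition "scores k \<omega> = score k (case_sum xi eps k \<omega>)"

lemma score_measurable[measurable]: "score k \<in> borel_measurable borel"
  by (cases k) (auto simp: score_def[abs_def])

lemma N_pos: "0 < eff_size n m" and N_le: "eff_size n m \<le> real n" "eff_size n m \<le> real m"
  using nm by (auto simp: eff_size_def field_simps)

lemma coeff_le: "sqrt (eff_size n m) / (real n * sd n m u) \<le> B" "sqrt (eff_size n m) / (real m * sd n m u) \<le> B"
proof -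
  have gen: "sqrt (eff_size n m) / (k * sd n m u) \<le> B" if "eff_size n m \<le> k" for k
  proof -
    have "sqrt (eff_size n m) / (k * sd n m u) \<le> sqrt (eff_size n m) / (eff_size n m * sd n m u)"
      using that N_pos sd by (intro divide_left_mono mult_right_mono mult_pos_pos) auto
    also have "\<dots> = 1 / (sd n m u * sqrt (eff_size n m))"
      using N_pos sd real_sqrt_mult_self[of "eff_size n m"] by (simp add: field_simps)
    finally show ?thesis using B(1) by simp
  qed
  show "sqrt (eff_size n m) / (real n * sd n m u) \<le> B" "sqrt (eff_size n m) / (real m * sd n m u) \<le> B"
    using gen N_le by auto
qed

text \<open>The coefficients are at most \<open>1 / (sd \<surd>N)\<close> since \<open>N\<close> is at most the smaller of the two sample sizes.\<close>
lemma centred_bounded_sum_scores: "centred_bounded_sum M indices scores B"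
proof unfold_locales
  show "finite indices" by (simp add: indices_def)
  have "indep_vars (\<lambda>_. borel) (case_sum xi eps) indices"
    by (rule indep_vars_subset[OF indep]) auto
  then show "indep_vars (\<lambda>_. borel) scores indices"
    unfolding scores_def[abs_def] by (rule indep_vars_compose2) (rule score_measurable)
  have "0 < 1 / (sd n m u * sqrt (eff_size n m))" using sd N_pos by simp
  then show "0 < B" using B(1) by (rule less_le_trans)
  show "B \<le> 1 / 2" by (rule B(2))
next
  fix k \<omega> assume "k \<in> indices"
  have 1: "\<bar>V u - g u x\<bar> \<le> 1" "\<bar>V u - f u x\<bar> \<le> 1" for x
    using V_bounds[of u] f_bounds[of u x] g_bounds[of u x] by (auto simp: abs_le_iff)
  have gen: "\<bar>c * d\<bar> \<le> B" if "0 \<le> c" "c \<le> B" "\<bar>d\<bar> \<le> 1" for c d :: real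
    using mult_mono[of c B "\<bar>d\<bar>" 1] that by (simp add: abs_mult)
  show "\<bar>scores k \<omega>\<bar> \<le> B"
  proof (cases k)
    case (Inl i)
    show ?thesis unfolding scores_def score_def Inl sum.case
      by (rule gen[OF _ coeff_le(1) 1(1)]) (use sd N_pos in simp)
  next
    case (Inr j)
    show ?thesis unfolding scores_def score_def Inr sum.case
      by (rule gen[OF _ coeff_le(2) 1(2)]) (use sd N_pos in simp)
  qed
next
  fix k assume "k \<in> indices"
  show "expectation (scores k) = 0"
  proof (cases k)
    case (Inl i)
    have "expectation (scores k) = (\<integral>x. score k x \<partial>distr M borel (xi i))"
      by (subst integral_distr) (auto simp: scores_def[abs_def] Inl)
    then show ?thesis by (simp add: law_xi score_def Inl mean_g P.prob_space[simplified])
  next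
    case (Inr j)
    have "expectation (scores k) = (\<integral>x. score k x \<partial>distr M borel (eps j))"
      by (subst integral_distr) (auto simp: scores_def[abs_def] Inr)
    then show ?thesis by (simp add: law_eps score_def Inr mean_f Q.prob_space[simplified])
  qed
next
  let ?c = "\<lambda>k. sqrt (eff_size n m) / (k * sd n m u)"
  have 1: "expectation (\<lambda>\<omega>. (scores (Inl i) \<omega>)\<^sup>2) = (?c (real n))\<^sup>2 * var_g u" for i
  proof -
    have "expectation (\<lambda>\<omega>. (scores (Inl i) \<omega>)\<^sup>2) = (\<integral>x. (score (Inl i) x)\<^sup>2 \<partial>distr M borel (xi i))"
      by (subst integral_distr) (auto simp: scores_def[abs_def])
    also have "\<dots> = (\<integral>x. (?c (real n))\<^sup>2 * (g u x - V u)\<^sup>2 \<partial>P)"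
      unfolding law_xi score_def by (simp only: sum.case power_mult_distrib power2_commute[of "V u"])
    finally show ?thesis by (simp add: var_g_def)
  qed
  have 2: "expectation (\<lambda>\<omega>. (scores (Inr i) \<omega>)\<^sup>2) = (?c (real m))\<^sup>2 * var_f u" for i
  proof -
    have "expectation (\<lambda>\<omega>. (scores (Inr i) \<omega>)\<^sup>2) = (\<integral>x. (score (Inr i) x)\<^sup>2 \<partial>distr M borel (eps i))"
      by (subst integral_distr) (auto simp: scores_def[abs_def])
    also have "\<dots> = (\<integral>x. (?c (real m))\<^sup>2 * (f u x - V u)\<^sup>2 \<partial>Q)"
      unfolding law_eps score_def by (simp only: sum.case power_mult_distrib power2_commute[of "V u"])
    finally show ?thesis by (simp add: var_f_def)
  qed
  have "(\<Sum>k\<in>indices. expectation (\<lambda>\<omega>. (scores k \<omega>)\<^sup>2)) = real n * ((?c (real n))\<^sup>2 * var_g u) + real m * ((?c (real m))\<^sup>2 * var_f u)"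
    unfolding indices_def by (subst sum.union_disjoint) (auto simp: sum.reindex inj_on_def 1 2)
  also have "\<dots> = (real m / (real n + real m) * var_g u + real n / (real n + real m) * var_f u) / (sd n m u)\<^sup>2"
  proof -
    have "real n * ((?c (real n))\<^sup>2 * a) + real m * ((?c (real m))\<^sup>2 * b)
        = (eff_size n m / real n * a + eff_size n m / real m * b) / (sd n m u)\<^sup>2" for a b
      using nm sd N_pos by (simp add: power_divide power_mult_distrib field_simps power2_eq_square[of "real n"] power2_eq_square[of "real m"])
    moreover have "eff_size n m / real n = real m / (real n + real m)" "eff_size n m / real m = real n / (real n + real m)"
      using nm by (auto simp: eff_size_def)
    ultimately show ?thesis by simp
  qed
  also have "real m / (real n + real m) * var_g u + real n / (real n + real m) * var_f u = (sd n m u)\<^sup>2"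
    unfolding sd_def using var_nonneg[of u] by simp
  finally show "(\<Sum>k\<in>indices. expectation (\<lambda>\<omega>. (scores k \<omega>)\<^sup>2)) = 1" using sd by simp
qed

interpretation L: centred_bounded_sum M indices scores B by (rule centred_bounded_sum_scores)

definition "degenerate_part \<omega> = (\<Sum>i<n. \<Sum>j<m. h u (xi i \<omega>) (eps j \<omega>))"

lemma degenerate_part_measurable[measurable]: "degenerate_part \<in> borel_measurable M"
  unfolding degenerate_part_def h_def by measurable

lemma hoeffding_decomposition:
  "emp n m u \<omega> = V u - sd n m u / sqrt (eff_size n m) * L.S \<omega> + degenerate_part \<omega> / (real n * real m)"
proof -
  define a where "a = (\<Sum>i<n. g u (xi i \<omega>))"
  define b where "b = (\<Sum>j<m. f u (eps j \<omega>))"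
  have of: "of_bool (x - y \<le> u) = h u x y + g u x + f u y - V u" for x y :: real by (simp add: h_def)
  have "(\<Sum>i<n. \<Sum>j<m. of_bool (xi i \<omega> - eps j \<omega> \<le> u)) = degenerate_part \<omega> + real m * a + real n * b - real n * real m * V u"
    unfolding of degenerate_part_def a_def b_def
    by (simp add: sum.distrib sum_subtractf sum_distrib_left)
  then have emp: "emp n m u \<omega> = degenerate_part \<omega> / (real n * real m) + a / real n + b / real m - V u"
    using nm by (simp add: emp_def add_divide_distrib diff_divide_distrib)
  have sums: "(\<Sum>i<k. c * (v - G i)) = c * (real k * v - (\<Sum>i<k. G i))" for c v and G :: "nat \<Rightarrow> real" and k
    by (simp add: sum_subtractf flip: sum_distrib_left)
  have "L.S \<omega> = (\<Sum>i<n. sqrt (eff_size n m) / (real n * sd n m u) * (V u - g u (xi i \<omega>)))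
      + (\<Sum>j<m. sqrt (eff_size n m) / (real m * sd n m u) * (V u - f u (eps j \<omega>)))"
    unfolding L.S_def unfolding indices_def
    by (subst sum.union_disjoint) (auto simp: sum.reindex inj_on_def scores_def score_def)
  also have "\<dots> = sqrt (eff_size n m) / (real n * sd n m u) * (real n * V u - a)
      + sqrt (eff_size n m) / (real m * sd n m u) * (real m * V u - b)"
    unfolding sums a_def b_def ..
  finally have S: "L.S \<omega> = sqrt (eff_size n m) / (real n * sd n m u) * (real n * V u - a)
      + sqrt (eff_size n m) / (real m * sd n m u) * (real m * V u - b)" .
  have "k / r * (r / (p * k) * (p * v - a) + r / (q * k) * (q * v - b)) = (v - a / p) + (v - b / q)"
    if "k > 0" "r > 0" "p > 0" "q > 0" for k r p q v :: real
    using that by (simp add: field_simps)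
  from this[OF sd, of "sqrt (eff_size n m)" "real n" "real m" "V u"]
  have "sd n m u / sqrt (eff_size n m) * L.S \<omega> = (V u - a / real n) + (V u - b / real m)"
    using nm N_pos unfolding S by simp
  then show ?thesis unfolding emp by simp
qed

lemma emp_less_half_iff:
  "emp n m u \<omega> < 1 / 2 \<longleftrightarrow>
    thr n m u < L.S \<omega> - sqrt (eff_size n m) / (sd n m u * (real n * real m)) * degenerate_part \<omega>"
proof -
  let ?k = "sd n m u / sqrt (eff_size n m)"
  have k: "0 < ?k" using sd N_pos by simp
  have "thr n m u = (V u - 1 / 2) / ?k" by (simp add: thr_def)
  moreover have "sqrt (eff_size n m) / (sd n m u * (real n * real m)) * degenerate_part \<omega> = degenerate_part \<omega> / (real n * real m) / ?k"
    by (simp add: mult_ac)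
  ultimately have "thr n m u < L.S \<omega> - sqrt (eff_size n m) / (sd n m u * (real n * real m)) * degenerate_part \<omega>
      \<longleftrightarrow> (V u - 1 / 2) / ?k + degenerate_part \<omega> / (real n * real m) / ?k < L.S \<omega>" by auto
  also have "\<dots> \<longleftrightarrow> (V u - 1 / 2) + degenerate_part \<omega> / (real n * real m) < ?k * L.S \<omega>"
  proof -
    have "(p / k + q / k < s) = (p + q < k * s)" if "0 < k" for p q k s :: real
      using that by (simp add: pos_divide_less_eq mult.commute flip: add_divide_distrib)
    from this[OF k] show ?thesis .
  qed
  also have "\<dots> \<longleftrightarrow> emp n m u \<omega> < 1 / 2" unfolding hoeffding_decomposition by (rule iffI; linarith)
  finally show ?thesis ..
qed

text \<open>The kernel is bounded by 2, and \<open>N\<^sup>2 \<le> n m\<close> converts the scale \<open>\<surd>(n m)\<close> of the degenerate sum.\<close>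
lemma remainder_tail:
  assumes w: "0 \<le> w"
  shows "prob {\<omega> \<in> space M. w \<le> \<bar>sqrt (eff_size n m) / (sd n m u * (real n * real m)) * degenerate_part \<omega>\<bar>}
    \<le> 3 * exp (- (w * sd n m u * sqrt (eff_size n m) / 4))"
proof -
  let ?c = "sqrt (eff_size n m) / (sd n m u * (real n * real m))"
  have c: "0 < ?c" using nm sd N_pos by simp
  have "w \<le> \<bar>c * d\<bar> \<longleftrightarrow> w / c \<le> \<bar>d\<bar>" if "0 < c" for c d
    using that by (simp add: abs_mult pos_divide_le_eq mult.commute)
  from this[OF c] have "{\<omega> \<in> space M. w \<le> \<bar>?c * degenerate_part \<omega>\<bar>} = {\<omega> \<in> space M. w / ?c \<le> \<bar>degenerate_part \<omega>\<bar>}"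
    by blast
  then have "prob {\<omega> \<in> space M. w \<le> \<bar>?c * degenerate_part \<omega>\<bar>} = prob {\<omega> \<in> space M. w / ?c \<le> \<bar>degenerate_part \<omega>\<bar>}"
    by (rule arg_cong)
  also have "\<dots> \<le> 3 * exp (- (w / ?c) / (2 * 2 * sqrt (real n * real m)))"
    unfolding degenerate_part_def
    by (rule degenerate_chaos_tail[OF indep law_xi law_eps nm h_measurable h_bound _ h_degenerate]) simp
  also have "\<dots> \<le> 3 * exp (- (w * sd n m u * sqrt (eff_size n m) / 4))"
  proof -
    define q where "q = sqrt (real n * real m)"
    have q: "0 < q" "q * q = real n * real m" using nm by (auto simp: q_def)
    define r where "r = sqrt (eff_size n m)"
    have r: "0 < r" "r * r = eff_size n m" using N_pos by (auto simp: r_def)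
    have "r * r \<le> q"
    proof -
      have "(eff_size n m)\<^sup>2 \<le> real n * real m"
        unfolding power2_eq_square using N_le N_pos by (intro mult_mono) auto
      then show ?thesis unfolding r(2) q_def by (rule real_le_rsqrt)
    qed
    then have "r \<le> q / r" using r by (simp add: pos_le_divide_eq)
    then have "w * sd n m u * r / 4 \<le> w * sd n m u * (q / r) / 4"
      using w sd by (intro divide_right_mono mult_left_mono) auto
    also have "\<dots> = (w / ?c) / (2 * 2 * q)"
      unfolding r_def[symmetric] q(2)[symmetric] using q r sd by (simp add: field_simps)
    finally show ?thesis by (simp add: q_def r_def)
  qed
  finally show ?thesis .
qed

lemma emp_sandwich:
  assumes w: "0 \<le> w"
  shows "prob {\<omega> \<in> space M. emp n m u \<omega> < 1 / 2}
      \<le> prob {\<omega> \<in> space M. L.S \<omega> > thr n m u - w} + 3 * exp (- (w * sd n m u * sqrt (eff_size n m) / 4))"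
    and "prob {\<omega> \<in> space M. L.S \<omega> > thr n m u + w}
      \<le> prob {\<omega> \<in> space M. emp n m u \<omega> < 1 / 2} + 3 * exp (- (w * sd n m u * sqrt (eff_size n m) / 4))"
proof -
  define R where "R \<omega> = sqrt (eff_size n m) / (sd n m u * (real n * real m)) * degenerate_part \<omega>" for \<omega>
  have [measurable]: "R \<in> borel_measurable M" unfolding R_def by measurable
  note iff = emp_less_half_iff[folded R_def] and tail = remainder_tail[OF w, folded R_def]
  have "prob {\<omega> \<in> space M. emp n m u \<omega> < 1 / 2}
      \<le> prob ({\<omega> \<in> space M. L.S \<omega> > thr n m u - w} \<union> {\<omega> \<in> space M. w \<le> \<bar>R \<omega>\<bar>})"
    unfolding iff by (intro finite_measure_mono) auto
  also have "\<dots> \<le> prob {\<omega> \<in> space M. L.S \<omega> > thr n m u - w} + prob {\<omega> \<in> space M. w \<le> \<bar>R \<omega>\<bar>}"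
    by (rule measure_Un_le) auto
  finally show "prob {\<omega> \<in> space M. emp n m u \<omega> < 1 / 2}
      \<le> prob {\<omega> \<in> space M. L.S \<omega> > thr n m u - w} + 3 * exp (- (w * sd n m u * sqrt (eff_size n m) / 4))"
    using tail by linarith
  have "prob {\<omega> \<in> space M. L.S \<omega> > thr n m u + w}
      \<le> prob ({\<omega> \<in> space M. emp n m u \<omega> < 1 / 2} \<union> {\<omega> \<in> space M. w \<le> \<bar>R \<omega>\<bar>})"
    unfolding iff by (intro finite_measure_mono) auto
  also have "\<dots> \<le> prob {\<omega> \<in> space M. emp n m u \<omega> < 1 / 2} + prob {\<omega> \<in> space M. w \<le> \<bar>R \<omega>\<bar>}"
    by (rule measure_Un_le) auto
  finally show "prob {\<omega> \<in> space M. L.S \<omega> > thr n m u + w}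
      \<le> prob {\<omega> \<in> space M. emp n m u \<omega> < 1 / 2} + 3 * exp (- (w * sd n m u * sqrt (eff_size n m) / 4))"
    using tail by linarith
qed

lemma emp_berry_esseen:
  assumes w: "0 \<le> w"
  shows "\<bar>prob {\<omega> \<in> space M. emp n m u \<omega> < 1 / 2} - (1 - std_normal_cdf (thr n m u))\<bar>
    \<le> 9000 * B * (1 + ln (1 / B)) + w + 3 * exp (- (w * sd n m u * sqrt (eff_size n m) / 4))"
proof -
  have be: "\<bar>prob {\<omega> \<in> space M. L.S \<omega> > x} - (1 - std_normal_cdf x)\<bar> \<le> 9000 * B * (1 + ln (1 / B))" for x
  proof -
    have "prob {\<omega> \<in> space M. L.S \<omega> > x} = 1 - prob {\<omega> \<in> space M. L.S \<omega> \<le> x}"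
      using prob_neg[of "\<lambda>\<omega>. L.S \<omega> \<le> x"] by (simp add: not_le)
    then show ?thesis using L.berry_esseen[of x] by simp
  qed
  show ?thesis
    using emp_sandwich[OF w] be[of "thr n m u - w"] be[of "thr n m u + w"]
      std_normal_cdf_Lipschitz[of "thr n m u - w" "thr n m u"] std_normal_cdf_Lipschitz[of "thr n m u + w" "thr n m u"] w
    unfolding abs_le_iff by simp
qed

text \<open>The two thresholds shifted by \<open>w\<close> lie within \<open>\<Delta>\<close> of \<open>z\<close>, and \<open>(1 + z) \<Delta> \<le> 1\<close> keeps the normal tails there
  comparable to the tail at \<open>z\<close>.\<close>
lemma emp_cramer:
  assumes w: "0 \<le> w" and z: "0 \<le> z" and x: "\<bar>thr n m u - z\<bar> + w \<le> \<Delta>" and D: "(1 + z) * \<Delta> \<le> 1"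
    and small: "20 * B * (1 + z) ^ 3 \<le> 1"
  shows "\<bar>prob {\<omega> \<in> space M. emp n m u \<omega> < 1 / 2} - (1 - std_normal_cdf z)\<bar>
    \<le> (15 * ((1 + z) * \<Delta>) + 83200000 * B * (2 + z) * (1 + (1 + z)\<^sup>2 + ln (1 / B))) * (1 - std_normal_cdf z)
      + 3 * exp (- (w * sd n m u * sqrt (eff_size n m) / 4))"
proof -
  define T where "T = 1 - std_normal_cdf z"
  define \<kappa> where "\<kappa> = 5200000 * B * (2 + z) * (1 + (1 + z)\<^sup>2 + ln (1 / B))"
  have T: "0 < T" unfolding T_def by (rule std_normal_tail_pos)
  have \<Delta>0: "0 \<le> \<Delta>" using w x by linarith
  have \<Delta>1: "\<Delta> \<le> 1"
    using D mult_right_mono[of 1 "1 + z" \<Delta>] z \<Delta>0 by simp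
  have B0: "0 < B" by (rule L.B_pos)
  have lB: "1 / 2 \<le> ln (1 / B)" by (rule L.ln_inverse_B[of 0]) auto
  have gen: "\<bar>prob {\<omega> \<in> space M. L.S \<omega> > y} - T\<bar> \<le> (15 * ((1 + z) * \<Delta>) + 16 * \<kappa>) * T" if y: "\<bar>y - z\<bar> \<le> \<Delta>" for y
  proof -
    have D1: "(1 + z) * \<bar>y - z\<bar> \<le> (1 + z) * \<Delta>" using y z by (intro mult_left_mono) auto
    have N1: "\<bar>std_normal_cdf y - std_normal_cdf z\<bar> \<le> 15 * ((1 + z) * \<bar>y - z\<bar>) * (1 - std_normal_cdf z)"
      by (rule std_normal_cdf_relative_change[OF z order_trans[OF D1 D]])
    also have "\<dots> \<le> 15 * ((1 + z) * \<Delta>) * (1 - std_normal_cdf z)"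
      using D1 T by (intro mult_right_mono) (auto simp: T_def)
    finally have N2: "\<bar>(1 - std_normal_cdf y) - T\<bar> \<le> 15 * ((1 + z) * \<Delta>) * T" by (simp add: T_def abs_minus_commute)
    also have "\<dots> \<le> 15 * 1 * T" using D T by (intro mult_right_mono mult_left_mono) auto
    finally have N3: "1 - std_normal_cdf y \<le> 16 * T" by linarith
    have ya: "\<bar>y\<bar> \<le> 1 + z" using y z \<Delta>1 by linarith
    have y2: "y\<^sup>2 \<le> (1 + z)\<^sup>2" using ya z by (metis abs_ge_zero power2_abs power_mono)
    have y3: "y ^ 3 \<le> (1 + z) ^ 3" if "0 < y" using ya that by (intro power_mono) auto
    have sq_le: "(1 + z)\<^sup>2 \<le> (1 + z) ^ 3" using z by (intro power_increasing) auto
    have "\<bar>prob {\<omega> \<in> space M. L.S \<omega> > y} - (1 - std_normal_cdf y)\<bar>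
        \<le> 5200000 * B * (1 + \<bar>y\<bar>) * (1 + y\<^sup>2 + ln (1 / B)) * (1 - std_normal_cdf y)"
    proof (rule L.cramer_moderate_deviation)
      show "20 * B * y\<^sup>2 \<le> 1" using order_trans[OF mult_left_mono[OF order_trans[OF y2 sq_le], of "20 * B"] small] B0 by simp
      assume "0 < y"
      have "B * y ^ 3 \<le> B * (1 + z) ^ 3" using y3[OF \<open>0 < y\<close>] B0 by (intro mult_left_mono) auto
      also have "\<dots> \<le> 20 * (B * (1 + z) ^ 3)" using B0 z by simp
      finally show "B * y ^ 3 \<le> 1" using small by simp
    qed
    also have "\<dots> \<le> \<kappa> * (16 * T)"
      unfolding \<kappa>_def
    proof (rule mult_mono[OF mult_mono[OF mult_left_mono]])
      show "1 + \<bar>y\<bar> \<le> 2 + z" using ya by simp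
      show "1 + y\<^sup>2 + ln (1 / B) \<le> 1 + (1 + z)\<^sup>2 + ln (1 / B)" using y2 by simp
      show "1 - std_normal_cdf y \<le> 16 * T" by (rule N3)
      show "0 \<le> 1 - std_normal_cdf y" using std_normal_tail_pos[of y] by simp
      have "0 \<le> 1 + y\<^sup>2 + ln (1 / B)" "0 \<le> 1 + (1 + z)\<^sup>2 + ln (1 / B)" using lB zero_le_power2[of y] zero_le_power2[of "1 + z"] by linarith+
      then show "0 \<le> 1 + y\<^sup>2 + ln (1 / B)" "0 \<le> 5200000 * B * (2 + z) * (1 + (1 + z)\<^sup>2 + ln (1 / B))"
        using B0 z by (auto intro!: mult_nonneg_nonneg)
    qed (use B0 z in auto)
    finally show ?thesis using N2 by (simp add: algebra_simps abs_le_iff)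
  qed
  have y1: "\<bar>(thr n m u - w) - z\<bar> \<le> \<Delta>" "\<bar>(thr n m u + w) - z\<bar> \<le> \<Delta>" using x w by linarith+
  have "\<bar>prob {\<omega> \<in> space M. emp n m u \<omega> < 1 / 2} - T\<bar> \<le> (15 * ((1 + z) * \<Delta>) + 16 * \<kappa>) * T
      + 3 * exp (- (w * sd n m u * sqrt (eff_size n m) / 4))"
    using emp_sandwich[OF w] gen[OF y1(1)] gen[OF y1(2)] by linarith
  moreover have "16 * \<kappa> = 83200000 * B * (2 + z) * (1 + (1 + z)\<^sup>2 + ln (1 / B))" by (simp add: \<kappa>_def)
  ultimately show ?thesis by (simp only: T_def)
qed

end
end

section \<open>Explicit error bounds for the estimator\<close>

context
  fixes n m :: nat and x y :: "nat \<Rightarrow> real"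
  assumes nm: "0 < n" "0 < m"
begin

definition "diff_ecdf t = (\<Sum>i<n. \<Sum>j<m. of_bool (x i - y j \<le> t)) / (real n * real m)"

lemma diff_ecdf_mono: "s \<le> t \<Longrightarrow> diff_ecdf s \<le> diff_ecdf t"
  unfolding diff_ecdf_def by (intro divide_right_mono sum_mono) auto

text \<open>The proportion of differences at most \<open>t\<close> jumps only at the differences themselves, so the infimum in the
  definition is a minimum attained at one of them.\<close>
lemma hodges_lehmann_attained:
  "1 / 2 \<le> diff_ecdf (hodges_lehmann n m x y)" "\<And>t. 1 / 2 \<le> diff_ecdf t \<Longrightarrow> hodges_lehmann n m x y \<le> t"
  "\<exists>i<n. \<exists>j<m. hodges_lehmann n m x y = x i - y j"
proof -
  define D where "D = (\<lambda>(i, j). x i - y j) ` ({..<n} \<times> {..<m})"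
  define A where "A = {t. 1 / 2 \<le> diff_ecdf t}"
  have D: "finite D" "D \<noteq> {}" using nm by (auto simp: D_def)
  have inD: "x i - y j \<in> D" if "i < n" "j < m" for i j using that by (auto simp: D_def)
  have below: "\<exists>d\<in>D. d \<le> t \<and> d \<in> A" if t: "t \<in> A" for t
  proof -
    define E where "E = {d \<in> D. d \<le> t}"
    have "E \<noteq> {}"
    proof
      assume E: "E = {}"
      have "of_bool (x i - y j \<le> t) = (0 :: real)" if "i < n" "j < m" for i j
        using E inD[OF that] by (auto simp: E_def)
      then have "diff_ecdf t = 0" by (simp add: diff_ecdf_def)
      then show False using t by (simp add: A_def)
    qed
    moreover have fE: "finite E" using D by (simp add: E_def)
    ultimately have M: "Max E \<in> E" by simp
    have "of_bool (x i - y j \<le> t) = (of_bool (x i - y j \<le> Max E) :: real)" if "i < n" "j < m" for i j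
    proof -
      have "x i - y j \<le> t \<Longrightarrow> x i - y j \<le> Max E"
        using inD[OF that] fE by (auto simp: E_def intro!: Max_ge)
      moreover have "Max E \<le> t" using M by (simp add: E_def)
      ultimately show ?thesis by auto
    qed
    then have "diff_ecdf t = diff_ecdf (Max E)" by (simp add: diff_ecdf_def)
    then show ?thesis using M t by (auto simp: E_def A_def)
  qed
  have "diff_ecdf (Max D) = 1"
  proof -
    have "of_bool (x i - y j \<le> Max D) = (1 :: real)" if "i < n" "j < m" for i j
      using inD[OF that] D by simp
    then show ?thesis using nm by (simp add: diff_ecdf_def)
  qed
  then have "Max D \<in> A \<inter> D" using D by (simp add: A_def)
  then have ne: "A \<inter> D \<noteq> {}" by blast
  define a where "a = Min (A \<inter> D)"
  have a: "a \<in> A" "a \<in> D" using Min_in[OF _ ne] D by (auto simp: a_def)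
  have least: "a \<le> t" if t: "t \<in> A" for t
  proof -
    obtain d where "d \<in> D" "d \<le> t" "d \<in> A" using below[OF t] by auto
    then show ?thesis using D by (auto simp: a_def intro: order_trans[OF Min_le])
  qed
  have "hodges_lehmann n m x y = Inf A" by (simp add: hodges_lehmann_def A_def diff_ecdf_def)
  also have "\<dots> = a" by (rule cInf_eq_minimum[OF a(1) least])
  finally have hl: "hodges_lehmann n m x y = a" .
  show "1 / 2 \<le> diff_ecdf (hodges_lehmann n m x y)" using a by (simp add: hl A_def)
  show "\<And>t. 1 / 2 \<le> diff_ecdf t \<Longrightarrow> hodges_lehmann n m x y \<le> t" using least by (simp add: hl A_def)
  show "\<exists>i<n. \<exists>j<m. hodges_lehmann n m x y = x i - y j" using a(2) by (auto simp: hl D_def)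
qed

lemma hodges_lehmann_le_iff:
  "hodges_lehmann n m x y \<le> t \<longleftrightarrow>
    1 / 2 \<le> (\<Sum>i<n. \<Sum>j<m. of_bool (x i - y j \<le> t)) / (real n * real m)"
  using hodges_lehmann_attained(1,2) diff_ecdf_mono unfolding diff_ecdf_def[symmetric] by (meson order_trans)

end

text \<open>The Taylor estimate makes the threshold linear in the level to first order; the Lipschitz estimate controls the
  change of the variance of the linear part.\<close>
locale two_sample_regular = two_sample +
  fixes v K c \<eta> :: real
  assumes V_median: "V 0 = 1 / 2" and v_pos: "0 < v" and K_pos: "0 < K" and c_pos: "0 < c"
    and V_Taylor: "\<And>u. \<bar>u\<bar> \<le> c \<Longrightarrow> \<bar>V u - 1 / 2 - v * u\<bar> \<le> K * u\<^sup>2"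
    and V_Lipschitz: "\<And>u. \<bar>u\<bar> \<le> c \<Longrightarrow> \<bar>V u - V 0\<bar> \<le> K * \<bar>u\<bar>"
    and \<eta>: "0 < \<eta>" "\<eta> < 1"
begin

definition "balanced n m \<longleftrightarrow> 0 < n \<and> 0 < m \<and> \<eta> \<le> real n / real m \<and> real n / real m \<le> 1 / \<eta>"

text \<open>The level, measured from the true shift, that lies \<open>z\<close> asymptotic standard deviations of the estimator above it.\<close>
definition "cutoff n m z = sd n m 0 / v * z / sqrt (eff_size n m)"

definition "exceed n m z = prob {\<omega> \<in> space M. emp n m (cutoff n m z) \<omega> < 1 / 2}"

lemma balanced_weights:
  assumes "balanced n m"
  shows "\<eta> / 2 \<le> real n / (real n + real m)" "\<eta> / 2 \<le> real m / (real n + real m)"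
    "real n / (real n + real m) + real m / (real n + real m) = 1"
proof -
  have nm: "0 < n" "0 < m" "\<eta> * real m \<le> real n" "\<eta> * real n \<le> real m"
    using assms \<eta> by (auto simp: balanced_def field_simps)
  have gen: "\<eta> / 2 \<le> a / (a + b)" if "0 < a" "0 < b" "\<eta> * b \<le> a" for a b :: real
  proof -
    have "\<eta> * a \<le> 1 * a" using \<eta> that by (intro mult_right_mono) auto
    then have "\<eta> * (a + b) \<le> 2 * a" using that(3) unfolding distrib_left by linarith
    then show ?thesis using that by (simp add: field_simps)
  qed
  show "\<eta> / 2 \<le> real n / (real n + real m)" using gen[of "real n" "real m"] nm by simp
  show "\<eta> / 2 \<le> real m / (real n + real m)" using gen[of "real m" "real n"] nm by (simp add: add.commute)
  show "real n / (real n + real m) + real m / (real n + real m) = 1"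
    using nm by (simp flip: add_divide_distrib)
qed

lemma var_le_1: "var_f u \<le> 1" "var_g u \<le> 1"
proof -
  have b: "(f u y - V u)\<^sup>2 \<le> 1" "(g u x - V u)\<^sup>2 \<le> 1" for x y
    using f_bounds[of u y] g_bounds[of u x] V_bounds[of u] by (auto simp: abs_square_le_1 abs_le_iff)
  have "var_f u \<le> (\<integral>y. 1 \<partial>Q)" unfolding var_f_def
    using b by (intro integral_mono Q.integrable_const_bound[where B=1]) auto
  then show "var_f u \<le> 1" using Q.prob_space by simp
  have "var_g u \<le> (\<integral>y. 1 \<partial>P)" unfolding var_g_def
    using b by (intro integral_mono P.integrable_const_bound[where B=1]) auto
  then show "var_g u \<le> 1" using P.prob_space by simp
qed

text \<open>A lower bound for \<open>sd n m 0\<close> over all balanced sample sizes.\<close>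
definition "s1 = sqrt (\<eta> / 2 * (var_f 0 + var_g 0))"

lemma s1_pos: "0 < s1" using var_pos[OF V_median] \<eta> by (simp add: s1_def)

lemma sd_sq: "(sd n m u)\<^sup>2 = real m / (real n + real m) * var_g u + real n / (real n + real m) * var_f u"
  unfolding sd_def using var_nonneg[of u] by simp

lemma sd_0_bounds:
  assumes "balanced n m"
  shows "s1 \<le> sd n m 0" "sd n m 0 \<le> 1"
proof -
  have "\<eta> / 2 * var_g 0 + \<eta> / 2 * var_f 0 \<le> real m / (real n + real m) * var_g 0 + real n / (real n + real m) * var_f 0"
    using balanced_weights[OF assms] var_nonneg[of 0] by (intro add_mono mult_right_mono) auto
  then show "s1 \<le> sd n m 0" unfolding s1_def sd_def by (intro real_sqrt_le_mono) (simp add: algebra_simps)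
  have "real m / (real n + real m) * var_g 0 + real n / (real n + real m) * var_f 0
      \<le> real m / (real n + real m) * 1 + real n / (real n + real m) * 1"
    using var_le_1[of 0] by (intro add_mono mult_left_mono) auto
  also have "\<dots> = 1" using balanced_weights(3)[OF assms] by simp
  finally show "sd n m 0 \<le> 1" unfolding sd_def by (simp add: real_sqrt_le_1_iff)
qed

lemma sd_perturbation:
  assumes "balanced n m" "\<bar>u\<bar> \<le> c"
  shows "\<bar>(sd n m u)\<^sup>2 - (sd n m 0)\<^sup>2\<bar> \<le> 4 * K * \<bar>u\<bar>"
proof -
  let ?a = "real m / (real n + real m)" and ?b = "real n / (real n + real m)"
  have "(sd n m u)\<^sup>2 - (sd n m 0)\<^sup>2 = ?a * (var_g u - var_g 0) + ?b * (var_f u - var_f 0)"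
    unfolding sd_sq by (simp add: algebra_simps)
  also have "\<bar>\<dots>\<bar> \<le> ?a * \<bar>var_g u - var_g 0\<bar> + ?b * \<bar>var_f u - var_f 0\<bar>"
    by (rule order_trans[OF abs_triangle_ineq]) (simp add: abs_mult)
  also have "\<dots> \<le> ?a * (4 * (K * \<bar>u\<bar>)) + ?b * (4 * (K * \<bar>u\<bar>))"
    using var_perturbation[of u] V_Lipschitz[OF assms(2)] by (intro add_mono mult_left_mono) auto
  also have "\<dots> = (?b + ?a) * (4 * (K * \<bar>u\<bar>))" by (simp only: distrib_right add.commute)
  also have "\<dots> = 4 * K * \<bar>u\<bar>" unfolding balanced_weights(3)[OF assms(1)] by simp
  finally show ?thesis .
qed

text \<open>For \<open>\<bar>z\<bar> \<le> zmax \<surd>N\<close> the level stays in the neighbourhood where the expansions hold and \<open>sd\<close> stays above \<open>s0\<close>;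
  \<open>Cthr\<close> is the constant in the expansion of the threshold.\<close>
definition "s0 = s1 / 2"
definition "zmax = min (c * v) (3 * s1\<^sup>2 * v / (16 * K))"
definition "Cthr = 2 / s1 * (K / v\<^sup>2 + 4 * K / (v * s1))"

lemma consts_pos: "0 < s0" "s0 \<le> 1" "0 < zmax" "0 < Cthr"
proof -
  have "balanced 1 1" using \<eta> by (simp add: balanced_def)
  then show "s0 \<le> 1" using sd_0_bounds[of 1 1] by (simp add: s0_def)
qed (use s1_pos c_pos v_pos K_pos in \<open>auto simp: s0_def zmax_def Cthr_def intro!: mult_pos_pos add_pos_pos divide_pos_pos\<close>)

lemma eff_size_pos: "balanced n m \<Longrightarrow> 0 < eff_size n m"
  by (auto simp: balanced_def eff_size_def)

text \<open>The factor \<open>sd n m 0 / v\<close> in \<open>cutoff\<close> is chosen so that the linear term of \<open>V\<close> contributes exactly \<open>z * sd n m 0\<close>; what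
  remains is the quadratic Taylor term and the change of \<open>sd\<close> between the levels 0 and \<open>cutoff n m z\<close>.\<close>
lemma threshold_bounds:
  assumes bal: "balanced n m" and z: "\<bar>z\<bar> \<le> zmax * sqrt (eff_size n m)"
  shows "s0 \<le> sd n m (cutoff n m z)" "\<bar>thr n m (cutoff n m z) - z\<bar> \<le> Cthr * z\<^sup>2 / sqrt (eff_size n m)"
proof -
  define r where "r = sqrt (eff_size n m)"
  define u where "u = cutoff n m z"
  have r: "0 < r" using eff_size_pos[OF bal] by (simp add: r_def)
  note sd0 = sd_0_bounds[OF bal]
  have sd0p: "0 < sd n m 0" using sd0 s1_pos by linarith
  have u: "\<bar>u\<bar> \<le> \<bar>z\<bar> / (v * r)"
  proof -
    have "\<bar>u\<bar> = sd n m 0 * (\<bar>z\<bar> / (v * r))"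
      using sd0p v_pos r by (simp add: u_def cutoff_def abs_mult r_def[symmetric])
    also have "\<dots> \<le> 1 * (\<bar>z\<bar> / (v * r))" using sd0 v_pos r by (intro mult_right_mono) auto
    finally show ?thesis by simp
  qed
  have zr: "\<bar>z\<bar> / (v * r) \<le> zmax / v"
    using z v_pos r unfolding r_def[symmetric] by (simp add: field_simps)
  have uc: "\<bar>u\<bar> \<le> c"
  proof -
    have "zmax / v \<le> c" using v_pos by (simp add: zmax_def field_simps min_le_iff_disj)
    then show ?thesis using u zr by linarith
  qed
  have uK: "4 * K * \<bar>u\<bar> \<le> 3 / 4 * s1\<^sup>2"
  proof -
    have "zmax / v \<le> 3 * s1\<^sup>2 / (16 * K)"
    proof -
      have "zmax / v \<le> (3 * s1\<^sup>2 * v / (16 * K)) / v" using v_pos unfolding zmax_def by (intro divide_right_mono) auto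
      then show ?thesis using v_pos by simp
    qed
    then have "\<bar>u\<bar> \<le> 3 * s1\<^sup>2 / (16 * K)" using u zr by linarith
    then show ?thesis using K_pos by (simp add: field_simps)
  qed
  note pert = sd_perturbation[OF bal uc]
  have "s1\<^sup>2 \<le> (sd n m 0)\<^sup>2" using sd0 s1_pos by (intro power_mono) auto
  then have "s0\<^sup>2 \<le> (sd n m u)\<^sup>2" using pert uK by (simp add: s0_def power_divide)
  then show s0: "s0 \<le> sd n m (cutoff n m z)"
    unfolding u_def[symmetric] by (rule power2_le_imp_le) (simp add: sd_def var_nonneg)
  have sdu: "0 < sd n m u" using s0 consts_pos unfolding u_def by linarith
  have su: "sd n m 0 * z = r * (v * u)"
    using v_pos r by (simp add: u_def cutoff_def r_def[symmetric])
  define e where "e = V u - 1 / 2 - v * u"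
  have e: "\<bar>e\<bar> \<le> K * u\<^sup>2" using V_Taylor[OF uc] by (simp add: e_def)
  have u2: "u\<^sup>2 \<le> z\<^sup>2 / (v\<^sup>2 * r\<^sup>2)"
  proof -
    have "\<bar>u\<bar>\<^sup>2 \<le> (\<bar>z\<bar> / (v * r))\<^sup>2" using u by (intro power_mono) auto
    then show ?thesis by (simp add: power_divide power_mult_distrib)
  qed
  have "r * (V u - 1 / 2) - z * sd n m u = r * e + z * (sd n m 0 - sd n m u)"
    using su by (simp add: e_def algebra_simps)
  also have "\<bar>\<dots>\<bar> \<le> \<bar>r * e\<bar> + \<bar>z * (sd n m 0 - sd n m u)\<bar>" by (rule abs_triangle_ineq)
  also have "\<bar>r * e\<bar> \<le> z\<^sup>2 / r * (K / v\<^sup>2)"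
  proof -
    have "\<bar>r * e\<bar> \<le> r * (K * (z\<^sup>2 / (v\<^sup>2 * r\<^sup>2)))"
      unfolding abs_mult using r e order_trans[OF e mult_left_mono[OF u2]] K_pos by (intro mult_mono) auto
    also have "\<dots> = z\<^sup>2 / r * (K / v\<^sup>2)" using r by (simp add: power2_eq_square mult_ac)
    finally show ?thesis .
  qed
  also have "\<bar>z * (sd n m 0 - sd n m u)\<bar> \<le> z\<^sup>2 / r * (4 * K / (v * s1))"
  proof -
    have "(sd n m 0 - sd n m u) * (sd n m 0 + sd n m u) = (sd n m 0)\<^sup>2 - (sd n m u)\<^sup>2"
      by (simp add: power2_eq_square algebra_simps)
    then have "\<bar>sd n m 0 - sd n m u\<bar> * (sd n m 0 + sd n m u) = \<bar>(sd n m 0)\<^sup>2 - (sd n m u)\<^sup>2\<bar>"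
      using sd0p sdu by (metis abs_mult abs_of_pos add_pos_pos)
    also have "\<dots> \<le> 4 * K * \<bar>u\<bar>" using pert by (simp add: abs_minus_commute)
    also have "\<dots> \<le> 4 * K * (\<bar>z\<bar> / (v * r))" using u K_pos by (intro mult_left_mono) auto
    finally have "\<bar>sd n m 0 - sd n m u\<bar> * (sd n m 0 + sd n m u) \<le> 4 * K * (\<bar>z\<bar> / (v * r))" .
    moreover have "\<bar>sd n m 0 - sd n m u\<bar> * s1 \<le> \<bar>sd n m 0 - sd n m u\<bar> * (sd n m 0 + sd n m u)"
      using sd0 sdu by (intro mult_left_mono) auto
    ultimately have "\<bar>sd n m 0 - sd n m u\<bar> * s1 \<le> 4 * K * (\<bar>z\<bar> / (v * r))" by linarith
    then have d: "\<bar>sd n m 0 - sd n m u\<bar> \<le> 4 * K * (\<bar>z\<bar> / (v * r)) / s1"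
      by (rule iffD2[OF pos_le_divide_eq[OF s1_pos]])
    have "\<bar>z * (sd n m 0 - sd n m u)\<bar> \<le> \<bar>z\<bar> * (4 * K * (\<bar>z\<bar> / (v * r)) / s1)"
      unfolding abs_mult using d by (intro mult_left_mono) auto
    also have "\<dots> = (\<bar>z\<bar> * \<bar>z\<bar>) / r * (4 * K / (v * s1))"
      by (simp add: mult_ac del: abs_mult_self_eq)
    also have "\<bar>z\<bar> * \<bar>z\<bar> = z\<^sup>2" by (simp add: power2_eq_square)
    finally show ?thesis .
  qed
  finally have num: "\<bar>r * (V u - 1 / 2) - z * sd n m u\<bar> \<le> z\<^sup>2 / r * (K / v\<^sup>2 + 4 * K / (v * s1))"
    by (simp add: distrib_left)
  have "thr n m u - z = (r * (V u - 1 / 2) - z * sd n m u) / sd n m u"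
    using sdu by (simp add: thr_def r_def[symmetric] diff_divide_distrib)
  then have "\<bar>thr n m u - z\<bar> = \<bar>r * (V u - 1 / 2) - z * sd n m u\<bar> / sd n m u"
    using sdu by simp
  also have "\<dots> \<le> (z\<^sup>2 / r * (K / v\<^sup>2 + 4 * K / (v * s1))) / s0"
    using num s0 consts_pos by (intro frac_le) (auto simp: u_def)
  also have "\<dots> = Cthr * z\<^sup>2 / r"
  proof -
    have "(z\<^sup>2 / r * q) / (s1 / 2) = 2 / s1 * q * z\<^sup>2 / r" for q by (simp add: mult_ac)
    then show ?thesis unfolding Cthr_def s0_def .
  qed
  finally show "\<bar>thr n m (cutoff n m z) - z\<bar> \<le> Cthr * z\<^sup>2 / sqrt (eff_size n m)"
    by (simp add: u_def r_def)
qed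

lemma exceed_approx:
  assumes bal: "balanced n m" and z: "\<bar>z\<bar> \<le> zmax * sqrt (eff_size n m)"
    and N: "2 \<le> s0 * sqrt (eff_size n m)" and w: "0 \<le> w"
  shows exceed_berry_esseen: "\<bar>exceed n m z - (1 - std_normal_cdf z)\<bar>
      \<le> 9000 / (s0 * sqrt (eff_size n m)) * (1 + ln (s0 * sqrt (eff_size n m))) + w
        + 3 * exp (- (w * s0 * sqrt (eff_size n m) / 4)) + Cthr * z\<^sup>2 / sqrt (eff_size n m)"
    and exceed_cramer: "0 \<le> z \<Longrightarrow> Cthr * z\<^sup>2 / sqrt (eff_size n m) + w \<le> \<Delta> \<Longrightarrow> (1 + z) * \<Delta> \<le> 1 \<Longrightarrow>
      20 * (1 + z) ^ 3 \<le> s0 * sqrt (eff_size n m) \<Longrightarrow>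
      \<bar>exceed n m z - (1 - std_normal_cdf z)\<bar>
      \<le> (15 * ((1 + z) * \<Delta>) + 83200000 / (s0 * sqrt (eff_size n m)) * (2 + z)
            * (1 + (1 + z)\<^sup>2 + ln (s0 * sqrt (eff_size n m)))) * (1 - std_normal_cdf z)
        + 3 * exp (- (w * s0 * sqrt (eff_size n m) / 4))"
proof -
  define r where "r = sqrt (eff_size n m)"
  define B where "B = 1 / (s0 * r)"
  have r: "0 < r" using eff_size_pos[OF bal] by (simp add: r_def)
  have nm: "0 < n" "0 < m" using bal by (auto simp: balanced_def)
  note tb = threshold_bounds[OF bal z, folded r_def]
  have sd: "0 < sd n m (cutoff n m z)" using tb(1) consts_pos by linarith
  have B1: "1 / (sd n m (cutoff n m z) * sqrt (eff_size n m)) \<le> B"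
    unfolding B_def r_def[symmetric] using tb(1) consts_pos r by (intro divide_left_mono mult_right_mono) auto
  have B2: "B \<le> 1 / 2" using N consts_pos r unfolding B_def r_def[symmetric] by (simp add: field_simps)
  have lnB: "ln (1 / B) = ln (s0 * r)" by (simp add: B_def)
  have ex: "exp (- (w * sd n m (cutoff n m z) * r / 4)) \<le> exp (- (w * s0 * r / 4))"
    using tb(1) w r by (simp add: mult_left_mono mult_right_mono)
  have "\<bar>exceed n m z - (1 - std_normal_cdf (thr n m (cutoff n m z)))\<bar>
      \<le> 9000 * B * (1 + ln (1 / B)) + w + 3 * exp (- (w * sd n m (cutoff n m z) * r / 4))"
    unfolding exceed_def r_def by (rule emp_berry_esseen[OF nm sd B1 B2 w])
  moreover have "\<bar>std_normal_cdf (thr n m (cutoff n m z)) - std_normal_cdf z\<bar> \<le> Cthr * z\<^sup>2 / r"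
    using std_normal_cdf_Lipschitz[of "thr n m (cutoff n m z)" z] tb(2) by linarith
  moreover have "9000 * B * (1 + ln (1 / B)) = 9000 / (s0 * r) * (1 + ln (s0 * r))" by (simp add: B_def)
  ultimately show "\<bar>exceed n m z - (1 - std_normal_cdf z)\<bar>
      \<le> 9000 / (s0 * sqrt (eff_size n m)) * (1 + ln (s0 * sqrt (eff_size n m))) + w
        + 3 * exp (- (w * s0 * sqrt (eff_size n m) / 4)) + Cthr * z\<^sup>2 / sqrt (eff_size n m)"
    using ex unfolding r_def[symmetric] by linarith
  assume z0: "0 \<le> z" and \<Delta>: "Cthr * z\<^sup>2 / sqrt (eff_size n m) + w \<le> \<Delta>" and \<Delta>1: "(1 + z) * \<Delta> \<le> 1"
    and small: "20 * (1 + z) ^ 3 \<le> s0 * sqrt (eff_size n m)"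
  have x: "\<bar>thr n m (cutoff n m z) - z\<bar> + w \<le> \<Delta>" using tb(2) \<Delta> unfolding r_def by linarith
  have sm: "20 * B * (1 + z) ^ 3 \<le> 1"
    using small consts_pos r unfolding B_def r_def[symmetric] by (simp add: field_simps)
  have "\<bar>exceed n m z - (1 - std_normal_cdf z)\<bar>
      \<le> (15 * ((1 + z) * \<Delta>) + 83200000 * B * (2 + z) * (1 + (1 + z)\<^sup>2 + ln (1 / B))) * (1 - std_normal_cdf z)
        + 3 * exp (- (w * sd n m (cutoff n m z) * sqrt (eff_size n m) / 4))"
    unfolding exceed_def by (rule emp_cramer[OF nm sd B1 B2 w z0 x \<Delta>1 sm])
  moreover have "83200000 * B * (2 + z) * (1 + (1 + z)\<^sup>2 + ln (1 / B))
      = 83200000 / (s0 * r) * (2 + z) * (1 + (1 + z)\<^sup>2 + ln (s0 * r))" unfolding lnB by (simp add: B_def)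
  ultimately show "\<bar>exceed n m z - (1 - std_normal_cdf z)\<bar>
      \<le> (15 * ((1 + z) * \<Delta>) + 83200000 / (s0 * sqrt (eff_size n m)) * (2 + z)
            * (1 + (1 + z)\<^sup>2 + ln (s0 * sqrt (eff_size n m)))) * (1 - std_normal_cdf z)
        + 3 * exp (- (w * s0 * sqrt (eff_size n m) / 4))"
    using ex unfolding r_def[symmetric] by (simp only:)
qed

lemma exceed_antimono:
  assumes bal: "balanced n m" and "z \<le> z'"
  shows "exceed n m z' \<le> exceed n m z"
proof -
  have cut: "cutoff n m z \<le> cutoff n m z'"
    unfolding cutoff_def using assms sd_0_bounds[OF bal] s1_pos v_pos eff_size_pos[OF bal]
    by (intro divide_right_mono mult_left_mono) auto
  have "emp n m (cutoff n m z) \<omega> \<le> emp n m (cutoff n m z') \<omega>" for \<omega>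
    unfolding emp_def using cut by (intro divide_right_mono sum_mono) auto
  then have "emp n m (cutoff n m z') \<omega> < 1 / 2 \<Longrightarrow> emp n m (cutoff n m z) \<omega> < 1 / 2" for \<omega>
    by (rule le_less_trans)
  then show ?thesis unfolding exceed_def by (intro finite_measure_mono Collect_mono conj_mono impI) auto
qed

lemma exceed_range: "0 \<le> exceed n m z" "exceed n m z \<le> 1"
  by (simp_all add: exceed_def)

text \<open>For \<open>\<bar>z\<bar> \<le> \<surd>(ln N)\<close> the shift \<open>w = 4 ln N / (s0 \<surd>N)\<close> makes the remainder negligible. For larger \<open>\<bar>z\<bar>\<close>
  monotonicity reduces to \<open>\<plusminus>\<surd>(ln N)\<close>, where the normal tail is at most \<open>1 / \<surd>N\<close>. For small \<open>N\<close> the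
  constant is taken so large that the bound is at least 1.\<close>
lemma berry_esseen_rate:
  "\<exists>C1>0. \<forall>n m z. balanced n m \<longrightarrow> 2 \<le> eff_size n m \<longrightarrow>
    \<bar>exceed n m z - (1 - std_normal_cdf z)\<bar> \<le> C1 * ln (eff_size n m) / sqrt (eff_size n m)"
proof -
  have "eventually (\<lambda>N::real. 2 \<le> s0 * sqrt N \<and> sqrt (ln N) \<le> zmax * sqrt N) at_top"
  proof (rule eventually_conj)
    have "\<forall>\<^sub>F N in at_top. 2 \<le> a * sqrt N" if "0 < a" for a :: real using that by real_asymp
    then show "\<forall>\<^sub>F N in at_top. 2 \<le> s0 * sqrt N" using consts_pos by blast
    have "\<forall>\<^sub>F N in at_top. sqrt (ln N) \<le> a * sqrt N" if "0 < a" for a :: real using that by real_asymp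
    then show "\<forall>\<^sub>F N in at_top. sqrt (ln N) \<le> zmax * sqrt N" using consts_pos by blast
  qed
  then obtain N0 where N0: "\<And>N. N0 \<le> N \<Longrightarrow> 2 \<le> s0 * sqrt N \<and> sqrt (ln N) \<le> zmax * sqrt N"
    by (auto simp: eventually_at_top_linorder)
  define A where "A = 27000 / s0 + 4 / s0 + 6 + Cthr"
  define C1 where "C1 = A + 2 + 2 * sqrt (max N0 0)"
  have A: "0 < A" using consts_pos by (auto simp: A_def intro!: add_pos_pos)
  have C1: "0 < C1" using A by (simp add: C1_def add_pos_nonneg)
  have "\<bar>exceed n m z - (1 - std_normal_cdf z)\<bar> \<le> C1 * ln (eff_size n m) / sqrt (eff_size n m)"
    if bal: "balanced n m" and N2: "2 \<le> eff_size n m" for n m z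
  proof -
    define N where "N = eff_size n m"
    have N: "2 \<le> N" using N2 by (simp add: N_def)
    have r: "0 < sqrt N" using N by simp
    have "exp (1 / 2 :: real) \<le> 2" using exp_bound_half[of "1/2::real"] by simp
    then have "exp (1 / 2 :: real) \<le> N" using N by linarith
    then have ln: "1 / 2 \<le> ln N" using N ln_ge_iff[of N "1 / 2"] by simp
    have l0: "0 \<le> ln N" using ln by linarith
    have e: "0 \<le> ln N / sqrt N" by (rule divide_nonneg_pos[OF l0 r])
    show ?thesis
    proof (cases "N0 \<le> N")
      case False
      have "\<bar>exceed n m z - (1 - std_normal_cdf z)\<bar> \<le> 1"
        using exceed_range[of n m z] std_normal.cdf_nonneg[of z] std_normal.cdf_bounded_prob[of z] by (auto simp: abs_le_iff)
      also have "1 \<le> 2 * sqrt (max N0 0) * ln N / sqrt N"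
      proof -
        have "sqrt N \<le> sqrt (max N0 0)" using False by simp
        also have "\<dots> = sqrt (max N0 0) * (2 * (1 / 2))" by simp
        also have "\<dots> \<le> sqrt (max N0 0) * (2 * ln N)" using ln by (intro mult_left_mono) auto
        finally show ?thesis using r by (simp add: pos_le_divide_eq)
      qed
      also have "\<dots> \<le> C1 * ln N / sqrt N"
        using A N l0 r by (intro divide_right_mono mult_right_mono) (auto simp: C1_def)
      finally show ?thesis by (simp add: N_def)
    next
      case True
      note big = N0[OF True]
      define \<epsilon> where "\<epsilon> = A * ln N / sqrt N"
      have inv: "1 / sqrt N \<le> 2 * (ln N / sqrt N)" using ln r by (simp add: field_simps)
      have core: "\<bar>exceed n m y - (1 - std_normal_cdf y)\<bar> \<le> \<epsilon>" if y: "\<bar>y\<bar> \<le> sqrt (ln N)" for y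
      proof -
        define w where "w = 4 * ln N / (s0 * sqrt N)"
        have w: "0 \<le> w" unfolding w_def using l0 r consts_pos by (intro divide_nonneg_pos mult_nonneg_nonneg mult_pos_pos) auto
        have yz: "\<bar>y\<bar> \<le> zmax * sqrt (eff_size n m)" using y big by (simp add: N_def)
        have "\<bar>exceed n m y - (1 - std_normal_cdf y)\<bar>
            \<le> 9000 / (s0 * sqrt N) * (1 + ln (s0 * sqrt N)) + w + 3 * exp (- (w * s0 * sqrt N / 4)) + Cthr * y\<^sup>2 / sqrt N"
          unfolding N_def using big w by (intro exceed_berry_esseen[OF bal yz]) (auto simp: N_def)
        also have "\<dots> \<le> 27000 / s0 * (ln N / sqrt N) + 4 / s0 * (ln N / sqrt N) + 6 * (ln N / sqrt N) + Cthr * (ln N / sqrt N)"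
        proof (intro add_mono)
          have "s0 * sqrt N \<le> N"
          proof -
            have "s0 * sqrt N \<le> 1 * sqrt N" using consts_pos r by (intro mult_right_mono) auto
            also have "\<dots> \<le> sqrt N * sqrt N" using N by (intro mult_right_mono) auto
            finally show ?thesis using N by simp
          qed
          then have "ln (s0 * sqrt N) \<le> ln N" using consts_pos r N by simp
          then have "1 + ln (s0 * sqrt N) \<le> 3 * ln N" using ln by linarith
          then have "9000 / (s0 * sqrt N) * (1 + ln (s0 * sqrt N)) \<le> 9000 / (s0 * sqrt N) * (3 * ln N)"
            using consts_pos r by (intro mult_left_mono) auto
          then show "9000 / (s0 * sqrt N) * (1 + ln (s0 * sqrt N)) \<le> 27000 / s0 * (ln N / sqrt N)" by simp
          show "w \<le> 4 / s0 * (ln N / sqrt N)" by (simp add: w_def)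
          have "exp (- (w * s0 * sqrt N / 4)) = 1 / N"
            using consts_pos r N by (simp add: w_def exp_minus inverse_eq_divide)
          also have "\<dots> \<le> 1 / sqrt N"
            using N r by (intro divide_left_mono) (auto intro: real_le_lsqrt simp: power2_eq_square)
          finally show "3 * exp (- (w * s0 * sqrt N / 4)) \<le> 6 * (ln N / sqrt N)" using inv by linarith
          have "y\<^sup>2 \<le> ln N" using y ln power_mono[OF y, of 2] by simp
          then show "Cthr * y\<^sup>2 / sqrt N \<le> Cthr * (ln N / sqrt N)"
            using consts_pos r by (simp add: divide_right_mono mult_left_mono)
        qed
        also have "\<dots> = \<epsilon>" by (simp add: \<epsilon>_def A_def add_divide_distrib distrib_right)
        finally show ?thesis .
      qed
      define z0 where "z0 = sqrt (ln N)"
      have z0: "0 \<le> z0" "z0\<^sup>2 = ln N" using ln by (auto simp: z0_def)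
      have tail: "exp (- z0\<^sup>2 / 2) \<le> 2 * (ln N / sqrt N)"
      proof -
        have "exp (- z0\<^sup>2 / 2) = 1 / sqrt N"
          using N by (simp add: z0 exp_minus inverse_eq_divide ln_sqrt[symmetric])
        then show ?thesis using inv by simp
      qed
      have "\<bar>exceed n m z - (1 - std_normal_cdf z)\<bar> \<le> \<epsilon> + 2 * (ln N / sqrt N)"
      proof -
        consider "\<bar>z\<bar> \<le> z0" | "z0 < z" | "z < - z0" by linarith
        then show ?thesis
        proof cases
          case 1 then show ?thesis using core[of z] e by (simp add: z0_def)
        next
          case 2
          have "exceed n m z \<le> exceed n m z0" using 2 by (intro exceed_antimono[OF bal]) auto
          moreover have "std_normal_cdf z0 \<le> std_normal_cdf z" using 2 by (intro std_normal.cdf_nondecreasing) auto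
          ultimately show ?thesis
            using core[of z0] std_normal_tail_le(1)[OF z0(1)] tail exceed_range[of n m z] std_normal_tail_pos[of z] z0(1)
            by (auto simp: z0_def abs_le_iff)
        next
          case 3
          have "exceed n m (- z0) \<le> exceed n m z" using 3 by (intro exceed_antimono[OF bal]) auto
          moreover have "std_normal_cdf z \<le> std_normal_cdf (- z0)" using 3 by (intro std_normal.cdf_nondecreasing) auto
          ultimately show ?thesis
            using core[of "- z0"] std_normal_tail_le(2)[OF z0(1)] tail exceed_range[of n m z] std_normal.cdf_nonneg[of z] z0(1)
            by (auto simp: z0_def abs_le_iff)
        qed
      qed
      also have "\<dots> \<le> C1 * ln N / sqrt N"
      proof -
        have "\<epsilon> + 2 * (ln N / sqrt N) = (A + 2) * (ln N / sqrt N)" by (simp add: \<epsilon>_def distrib_right add_divide_distrib)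
        also have "\<dots> \<le> C1 * (ln N / sqrt N)" using e by (intro mult_right_mono) (auto simp: C1_def)
        finally show ?thesis by simp
      qed
      finally show ?thesis by (simp add: N_def)
    qed
  qed
  then show ?thesis using C1 by blast
qed

text \<open>The remainder is absorbed by the shift \<open>w = 4 d / s0\<close>, outside an event of probability
  \<open>3 exp (- \<surd>N d)\<close>. The hypotheses \<open>z d \<le> e\<close> and \<open>z\<^sup>3 \<le> e \<surd>N\<close> make \<open>(1 + z) \<Delta> \<le> 1\<close>, unless \<open>d\<close> itself
  is bounded below. In that case \<open>z \<le> 1\<close>, the ratio is bounded, and the term \<open>(1 + z) d\<close> of the claimed
  bound is of constant size.\<close>
lemma moderate_deviation_rate:
  "\<exists>C2>0. \<exists>e>0. \<exists>N0>0. \<forall>n m z d. balanced n m \<longrightarrow> N0 \<le> eff_size n m \<longrightarrow> 0 < d \<longrightarrow> 0 < z \<longrightarrow>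
    z * d \<le> e \<longrightarrow> z ^ 3 \<le> e * sqrt (eff_size n m) \<longrightarrow>
    \<bar>exceed n m z / (1 - std_normal_cdf z) - 1\<bar>
    \<le> C2 * ((1 + z ^ 3) / sqrt (eff_size n m) + (1 + z) * d
        + 2 * max z 1 * sqrt (2 * pi) * exp (z\<^sup>2 / 2 - sqrt (eff_size n m) * d))"
proof -
  define k where "k = 4 / s0"
  define M where "M = 83200000 / s0"
  define C2 where "C2 = 30 * Cthr + 135 * k + 16 * M + 45"
  define e where "e = min (min (zmax / 2) (s0 / 160)) (1 / (16 * (Cthr + k)))"
  define N1 where "N1 = max (2 / zmax) (max (160 / s0) (4 * Cthr))"
  define N0 where "N0 = max 2 (N1\<^sup>2)"
  have k: "0 < k" and M: "0 < M" using consts_pos by (auto simp: k_def M_def)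
  have C2: "0 < C2" using k M consts_pos by (auto simp: C2_def intro!: add_pos_pos)
  have e: "0 < e" using k consts_pos by (auto simp: e_def intro!: add_pos_pos)
  have main: "\<bar>exceed n m z / (1 - std_normal_cdf z) - 1\<bar>
      \<le> C2 * ((1 + z ^ 3) / sqrt (eff_size n m) + (1 + z) * d
        + 2 * max z 1 * sqrt (2 * pi) * exp (z\<^sup>2 / 2 - sqrt (eff_size n m) * d))"
    if bal: "balanced n m" and NN: "N0 \<le> eff_size n m" and d: "0 < d" and z: "0 < z"
      and zd: "z * d \<le> e" and z3: "z ^ 3 \<le> e * sqrt (eff_size n m)" for n m z d
  proof -
    define N where "N = eff_size n m"
    define r where "r = sqrt N"
    define T where "T = 1 - std_normal_cdf z"
    define p where "p = exceed n m z"
    define X where "X = (1 + z ^ 3) / r"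
    define Y where "Y = (1 + z) * d"
    define W where "W = 2 * max z 1 * sqrt (2 * pi) * exp (z\<^sup>2 / 2 - r * d)"
    have N: "2 \<le> N" "N1\<^sup>2 \<le> N" using NN by (auto simp: N0_def N_def)
    have r: "0 < r" "r * r = N" using N by (auto simp: r_def)
    have N1r: "N1 \<le> r" unfolding r_def using N by (intro real_le_rsqrt)
    have T: "0 < T" unfolding T_def by (rule std_normal_tail_pos)
    have z3r: "z ^ 3 \<le> e * r" using z3 by (simp add: r_def N_def)
    have X0: "0 \<le> X" using z r by (simp add: X_def)
    have Y0: "0 \<le> Y" using z d by (simp add: Y_def)
    have W0: "0 \<le> W" by (simp add: W_def)
    have zz: "z + z\<^sup>2 \<le> 1 + z ^ 3"
    proof -
      have "0 \<le> (1 - z)\<^sup>2 * (1 + z)" using z by simp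
      then show ?thesis by (simp add: power2_eq_square power3_eq_cube algebra_simps)
    qed
    have z2: "0 \<le> z\<^sup>2" by simp
    have z30: "0 \<le> z ^ 3" using z by simp
    have cube: "(1 + z) ^ 3 \<le> 4 * (1 + z ^ 3)"
    proof -
      have "(1 + z) ^ 3 = 1 + 3 * (z + z\<^sup>2) + z ^ 3" by (simp add: power2_eq_square power3_eq_cube algebra_simps)
      also have "\<dots> \<le> 1 + 3 * (1 + z ^ 3) + z ^ 3" using mult_left_mono[OF zz, of 3] by simp
      finally show ?thesis by simp
    qed
    have e1: "e \<le> zmax / 2" "e \<le> s0 / 160" and e2: "e \<le> 1 / (16 * (Cthr + k))" by (auto simp: e_def)
    have e3: "e * (16 * (Cthr + k)) \<le> 1"
    proof -
      have "0 < 16 * (Cthr + k)" using k consts_pos by simp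
      from iffD1[OF pos_le_divide_eq[OF this] e2] show ?thesis .
    qed
    have e4: "e * Cthr * 16 + e * k * 16 \<le> 1" using e3 by (simp add: algebra_simps)
    have "0 \<le> e * Cthr" "0 \<le> e * k" using e k consts_pos by auto
    then have eC: "e * Cthr \<le> 1 / 16" "e * k \<le> 1 / 16" using e4 by linarith+
    have r1: "1 \<le> zmax / 2 * r" "80 \<le> s0 / 2 * r" "4 * Cthr \<le> r"
    proof -
      have "2 / zmax \<le> r" "160 / s0 \<le> r" "4 * Cthr \<le> r" using N1r by (auto simp: N1_def)
      then show "1 \<le> zmax / 2 * r" "80 \<le> s0 / 2 * r" "4 * Cthr \<le> r"
        using consts_pos by (auto simp: pos_divide_le_eq mult.commute)
    qed
    have er: "e * r \<le> zmax / 2 * r" "e * r \<le> s0 / 160 * r" using e1 r by (auto intro!: mult_right_mono)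
    have zz_max: "\<bar>z\<bar> \<le> zmax * sqrt (eff_size n m)"
    proof -
      have "z \<le> 1 + e * r" using zz z2 z3r by linarith
      also have "\<dots> \<le> zmax / 2 * r + zmax / 2 * r" using r1 er by (intro add_mono)
      also have "\<dots> = zmax * r" by simp
      finally show ?thesis using z unfolding r_def N_def by simp
    qed
    have small: "20 * (1 + z) ^ 3 \<le> s0 * sqrt (eff_size n m)"
    proof -
      have gen: "20 * q \<le> 80 + 80 * b" if "q \<le> 4 + 4 * y" "y \<le> b" for q y b :: real
        using that by linarith
      have "(1 + z) ^ 3 \<le> 4 + 4 * z ^ 3" using cube by simp
      from gen[OF this z3r] have "20 * (1 + z) ^ 3 \<le> 80 + 80 * (e * r)" .
      also have "\<dots> \<le> s0 / 2 * r + 80 * (s0 / 160 * r)" using r1 er by (intro add_mono mult_left_mono) auto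
      also have "\<dots> = s0 * r" by simp
      finally show ?thesis unfolding r_def N_def .
    qed
    have two: "2 \<le> s0 * sqrt (eff_size n m)"
    proof -
      have "2 \<le> 2 * (s0 / 2 * r)" using r1(2) by linarith
      also have "\<dots> = s0 * r" by simp
      finally show ?thesis unfolding r_def N_def .
    qed
    define w where "w = k * d"
    define \<Delta> where "\<Delta> = Cthr * z\<^sup>2 / r + w"
    have w: "0 \<le> w" using k d by (simp add: w_def)
    have \<Delta>_eq: "(1 + z) * \<Delta> = Cthr * (z\<^sup>2 + z ^ 3) / r + k * Y"
      by (simp add: \<Delta>_def w_def Y_def algebra_simps power2_eq_square power3_eq_cube add_divide_distrib)
    show ?thesis
    proof (cases "k * d \<le> 1 / 2")
      case False
      have "z \<le> 1"
      proof -
        have "z * (k * d) \<le> e * k" using mult_left_mono[OF zd, of k] k by (simp add: mult_ac)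
        then have "z * (k * d) \<le> 1 / 16" using eC by linarith
        moreover have "z * (1 / 2) \<le> z * (k * d)" using False z by (intro mult_left_mono) auto
        ultimately show ?thesis by linarith
      qed
      have "1 / 2 \<le> exp (- 1 / 2 :: real)" using exp_ge_add_one_self[of "- 1 / 2 :: real"] by simp
      then have "1 / 60 \<le> 1 - std_normal_cdf 1" using std_normal_tail_ge[of 1] by simp
      also have "\<dots> \<le> T" unfolding T_def using std_normal.cdf_nondecreasing[OF \<open>z \<le> 1\<close>] by simp
      finally have T60: "1 / 60 \<le> T" .
      have "p \<le> 60 * T" using T60 exceed_range[of n m z] by (simp add: p_def)
      then have "p / T \<le> 60" using T by (simp add: pos_divide_le_eq)
      moreover have "0 \<le> p / T" using T exceed_range[of n m z] by (simp add: p_def)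
      ultimately have "\<bar>p / T - 1\<bar> \<le> 60" by (simp add: abs_le_iff)
      also have "60 \<le> 120 * (k * d)" using False by linarith
      also have "\<dots> \<le> 120 * (k * Y)"
      proof -
        have "d \<le> Y" using d z by (simp add: Y_def distrib_right)
        then have "k * d \<le> k * Y" using k by (intro mult_left_mono) auto
        then show ?thesis by linarith
      qed
      also have "\<dots> = (120 * k) * Y" by simp
      also have "\<dots> \<le> C2 * Y" using Y0 k M consts_pos by (intro mult_right_mono) (auto simp: C2_def)
      also have "\<dots> \<le> C2 * (X + Y + W)" using X0 W0 C2 by (intro mult_left_mono) auto
      finally show ?thesis by (simp add: p_def T_def X_def Y_def W_def r_def N_def)
    next
      case True
      have D1: "(1 + z) * \<Delta> \<le> 1"
      proof -
        have "Cthr * (z\<^sup>2 + z ^ 3) \<le> Cthr * (1 + 2 * (e * r))"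
          using zz z z3r consts_pos by (intro mult_left_mono) linarith+
        then have "Cthr * (z\<^sup>2 + z ^ 3) \<le> Cthr + 2 * (e * Cthr) * r" by (simp add: algebra_simps)
        also have "\<dots> \<le> r / 4 + 2 * (1 / 16) * r" using r1(3) eC r by (intro add_mono mult_right_mono) auto
        finally have 1: "Cthr * (z\<^sup>2 + z ^ 3) / r \<le> 3 / 8" using r by (simp add: pos_divide_le_eq)
        have "k * Y = k * d + (z * d) * k" by (simp add: Y_def algebra_simps)
        also have "\<dots> \<le> 1 / 2 + e * k" using True zd k by (intro add_mono mult_right_mono) auto
        finally have "k * Y \<le> 1 / 2 + 1 / 16" using eC by linarith
        then show ?thesis unfolding \<Delta>_eq using 1 by linarith
      qed
      define E where "E = exp (- (r * d))"
      have E: "exp (- (w * s0 * sqrt (eff_size n m) / 4)) = E"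
        using consts_pos by (simp add: E_def w_def k_def r_def N_def mult_ac)
      have main: "\<bar>p - T\<bar> \<le> (15 * ((1 + z) * \<Delta>) + M / r * (2 + z) * (1 + (1 + z)\<^sup>2 + ln (s0 * r))) * T + 3 * E"
      proof -
        have "Cthr * z\<^sup>2 / sqrt (eff_size n m) + w \<le> \<Delta>" by (simp add: \<Delta>_def r_def N_def)
        from exceed_cramer[OF bal zz_max two w less_imp_le[OF z] this D1 small]
        show ?thesis unfolding E by (simp add: p_def T_def M_def r_def N_def)
      qed
      have maxz: "1 + z \<le> 2 * max z 1" by simp
      have sq2pi: "1 \<le> sqrt (2 * pi)" using pi_gt3 by (intro real_le_rsqrt) auto
      define G where "G = max z 1 * exp (z\<^sup>2 / 2 - r * d)"
      have G0: "0 \<le> G" by (simp add: G_def)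
      have GW: "2 * G \<le> W"
      proof -
        have "2 * G * 1 \<le> 2 * G * sqrt (2 * pi)" using sq2pi G0 by (intro mult_left_mono) auto
        then show ?thesis by (simp add: W_def G_def mult_ac)
      qed
      have EF: "E \<le> exp (z\<^sup>2 / 2 - r * d)" by (simp add: E_def)
      have EG: "(1 + z) * E \<le> 2 * G"
      proof -
        have "(1 + z) * E \<le> (2 * max z 1) * exp (z\<^sup>2 / 2 - r * d)"
          using z by (intro mult_mono maxz EF) (auto simp: E_def)
        then show ?thesis by (simp add: G_def mult.assoc)
      qed
      have ET: "E \<le> 30 * G * T"
      proof -
        have "exp (- z\<^sup>2 / 2) * exp (z\<^sup>2 / 2 - r * d) \<le> (15 * (1 + z) * T) * exp (z\<^sup>2 / 2 - r * d)"
          unfolding T_def by (rule mult_right_mono[OF std_normal_tail_ge[OF less_imp_le[OF z]]]) simp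
        also have "exp (- z\<^sup>2 / 2) * exp (z\<^sup>2 / 2 - r * d) = E" by (simp add: E_def flip: exp_add)
        also have "(15 * (1 + z) * T) * exp (z\<^sup>2 / 2 - r * d) \<le> (15 * (2 * max z 1) * T) * exp (z\<^sup>2 / 2 - r * d)"
          using T maxz by (intro mult_right_mono mult_left_mono) auto
        finally show ?thesis by (simp add: G_def mult_ac)
      qed
      \<comment> \<open>Either \<open>d\<close> is at least \<open>ln N / (4 \<surd>N)\<close> or \<open>E\<close> is at least \<open>N\<close> to the power \<open>-1/4\<close>.\<close>
      have lnN: "ln N / r \<le> 4 * d + 4 * E"
      proof (cases "ln N / 4 \<le> r * d")
        case True
        then have "ln N \<le> (4 * d) * r" by (simp add: mult_ac)
        then have "ln N / r \<le> 4 * d" using r by (simp add: pos_divide_le_eq)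
        moreover have "0 \<le> E" by (simp add: E_def)
        ultimately show ?thesis by linarith
      next
        case False
        have "ln r = ln N / 2" using N by (simp add: r_def ln_sqrt)
        then have "exp (ln N / 2) = exp (ln r)" by (simp only:)
        then have er: "exp (ln N / 2) = r" using r by simp
        have "exp (ln N / 4) = exp (ln N / 2 + - (ln N / 4))" by (rule arg_cong[of _ _ exp]) simp
        also have "\<dots> = r * exp (- (ln N / 4))" by (simp only: exp_add er)
        finally have e4: "exp (ln N / 4) = r * exp (- (ln N / 4))" .
        have "exp (- (ln N / 4)) \<le> E" using False by (simp add: E_def)
        then have "r * exp (- (ln N / 4)) \<le> r * E" using r by (intro mult_left_mono) auto
        moreover have "ln N / 4 \<le> exp (ln N / 4)" using exp_ge_add_one_self[of "ln N / 4"] by linarith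
        ultimately have "ln N / 4 \<le> r * E" unfolding e4 by linarith
        then have "ln N \<le> (4 * E) * r" by (simp add: mult_ac)
        then have "ln N / r \<le> 4 * E" using r by (simp add: pos_divide_le_eq)
        then show ?thesis using d by linarith
      qed
      have ln_le: "ln (s0 * r) \<le> ln N"
      proof -
        have "s0 * r \<le> 1 * r" using consts_pos r by (intro mult_right_mono) auto
        also have "\<dots> \<le> r * r"
        proof (rule mult_right_mono)
          show "1 \<le> r" unfolding r_def using N by simp
        qed (use r in simp)
        finally have "s0 * r \<le> N" unfolding r(2) .
        then show ?thesis using consts_pos r N by simp
      qed
      have "1 \<le> s0 * r" using two unfolding r_def N_def by linarith
      then have lnpos: "0 \<le> ln (s0 * r)" by (rule ln_ge_zero)
      have b1: "15 * ((1 + z) * \<Delta>) \<le> 30 * Cthr * X + 15 * k * Y"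
      proof -
        have "z\<^sup>2 + z ^ 3 \<le> 2 + 2 * z ^ 3" using zz z z30 by linarith
        then have "Cthr * (z\<^sup>2 + z ^ 3) \<le> Cthr * (2 * (1 + z ^ 3))"
          using consts_pos by (intro mult_left_mono) auto
        then have "Cthr * (z\<^sup>2 + z ^ 3) / r \<le> Cthr * (2 * (1 + z ^ 3)) / r"
          by (rule divide_right_mono) (use r in simp)
        also have "\<dots> = 2 * (Cthr * X)" by (simp add: X_def)
        finally have A: "Cthr * (z\<^sup>2 + z ^ 3) / r \<le> 2 * (Cthr * X)" .
        have "15 * ((1 + z) * \<Delta>) = 15 * (Cthr * (z\<^sup>2 + z ^ 3) / r) + 15 * (k * Y)"
          unfolding \<Delta>_eq by (rule distrib_left)
        also have "\<dots> \<le> 15 * (2 * (Cthr * X)) + 15 * (k * Y)"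
          by (rule add_right_mono[OF mult_left_mono[OF A]]) simp
        finally show ?thesis by simp
      qed
      have b2: "M / r * (2 + z) * (1 + (1 + z)\<^sup>2 + ln (s0 * r)) \<le> M * (16 * X + 8 * Y + 8 * W)"
      proof -
        have "(2 + z) * (1 + (1 + z)\<^sup>2 + ln (s0 * r)) \<le> (2 * (1 + z)) * (2 * (1 + z)\<^sup>2 + ln N)"
        proof (rule mult_mono)
          have "1 \<le> (1 + z)\<^sup>2" using z by (simp add: one_le_power)
          then show "1 + (1 + z)\<^sup>2 + ln (s0 * r) \<le> 2 * (1 + z)\<^sup>2 + ln N" using ln_le by linarith
          show "0 \<le> 1 + (1 + z)\<^sup>2 + ln (s0 * r)" using lnpos by (intro add_nonneg_nonneg) auto
        qed (use z in auto)
        also have "\<dots> = 4 * (1 + z) ^ 3 + 2 * ((1 + z) * ln N)" by (simp add: power3_eq_cube power2_eq_square algebra_simps)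
        also have "\<dots> \<le> 16 * (1 + z ^ 3) + 2 * ((1 + z) * ln N)"
          by (rule add_right_mono) (use mult_left_mono[OF cube, of 4] in simp)
        finally have "(2 + z) * (1 + (1 + z)\<^sup>2 + ln (s0 * r)) / r \<le> (16 * (1 + z ^ 3) + 2 * ((1 + z) * ln N)) / r"
          using r by (intro divide_right_mono) auto
        also have "\<dots> = 16 * X + 2 * ((1 + z) * (ln N / r))" by (simp add: X_def add_divide_distrib)
        also have "\<dots> \<le> 16 * X + 8 * Y + 8 * W"
        proof -
          have "(1 + z) * (ln N / r) \<le> (1 + z) * (4 * d + 4 * E)" using lnN z by (intro mult_left_mono) auto
          also have "\<dots> = 4 * Y + 4 * ((1 + z) * E)" by (simp add: Y_def algebra_simps)
          finally have "2 * ((1 + z) * (ln N / r)) \<le> 8 * Y + 8 * ((1 + z) * E)" by linarith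
          moreover have "(1 + z) * E \<le> W" using EG GW by linarith
          ultimately show ?thesis by linarith
        qed
        finally have "(2 + z) * (1 + (1 + z)\<^sup>2 + ln (s0 * r)) / r \<le> 16 * X + 8 * Y + 8 * W" .
        then have "M * ((2 + z) * (1 + (1 + z)\<^sup>2 + ln (s0 * r)) / r) \<le> M * (16 * X + 8 * Y + 8 * W)"
          using M by (intro mult_left_mono) auto
        then show ?thesis by simp
      qed
      have "3 * E \<le> 45 * W * T"
      proof -
        have "3 * E \<le> 3 * (30 * G * T)" using ET by simp
        also have "\<dots> = 45 * (2 * G) * T" by simp
        also have "\<dots> \<le> 45 * W * T" using GW T by (intro mult_right_mono mult_left_mono) auto
        finally show ?thesis .
      qed
      then have W45: "3 * E \<le> 45 * W * T" .
      have b12: "(15 * ((1 + z) * \<Delta>) + M / r * (2 + z) * (1 + (1 + z)\<^sup>2 + ln (s0 * r))) * T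
          \<le> (30 * Cthr * X + 15 * k * Y + M * (16 * X + 8 * Y + 8 * W)) * T"
        using add_mono[OF b1 b2] T by (intro mult_right_mono) auto
      have "\<bar>p - T\<bar> \<le> (30 * Cthr * X + 15 * k * Y + M * (16 * X + 8 * Y + 8 * W)) * T + 45 * W * T"
        by (rule order_trans[OF main add_mono[OF b12 W45]])
      also have "\<dots> = ((30 * Cthr + 16 * M) * X + (15 * k + 8 * M) * Y + (8 * M + 45) * W) * T"
        by (simp add: algebra_simps)
      also have "\<dots> \<le> (C2 * X + C2 * Y + C2 * W) * T"
        using X0 Y0 W0 T k M consts_pos
        by (intro mult_right_mono add_mono) (auto simp: C2_def)
      finally have "\<bar>p - T\<bar> / T \<le> C2 * X + C2 * Y + C2 * W" using T by (simp add: pos_divide_le_eq)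
      moreover have "p / T - 1 = (p - T) / T" using T by (simp add: diff_divide_distrib)
      ultimately have "\<bar>p / T - 1\<bar> \<le> C2 * (X + Y + W)" using T by (simp add: distrib_left)
      then show ?thesis by (simp add: p_def T_def X_def Y_def W_def r_def N_def)
    qed
  qed
  have N0: "0 < N0" by (simp add: N0_def less_max_iff_disj)
  show ?thesis
    by (rule exI[of _ C2], rule conjI[OF C2], rule exI[of _ e], rule conjI[OF e], rule exI[of _ N0], rule conjI[OF N0])
       (use main in blast)
qed

end

section \<open>Rates\<close>

context two_sample_regular
begin

text \<open>The two bounds on \<open>a\<close> combine to \<open>z\<^sup>3 = o(1 / \<delta>) o(\<surd>N \<delta>) = o(\<surd>N)\<close>, so the range of \<open>z\<close> is covered by
  \<open>moderate_deviation_rate\<close> whatever the size of \<open>\<delta>\<close>.\<close>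
lemma moderate_deviation_uniform:
  "\<exists>C2>0. \<forall>\<delta>. (\<forall>N>0. \<delta> N > 0) \<longrightarrow>
    (\<forall>a \<in> o(\<lambda>N. min (1 / \<delta> N) (N powr (1/4) * sqrt (\<delta> N))).
      \<forall>\<^sub>F N in at_top. \<forall>n m z. balanced n m \<longrightarrow> eff_size n m = N \<longrightarrow> 0 < z \<longrightarrow> z \<le> a N \<longrightarrow>
        \<bar>exceed n m z / (1 - std_normal_cdf z) - 1\<bar>
          \<le> C2 * ((1 + z ^ 3) / sqrt N + (1 + z) * \<delta> N
              + 2 * max z 1 * sqrt (2 * pi) * exp (z\<^sup>2 / 2 - sqrt N * \<delta> N)))"
proof -
  obtain C2 e N0 where C2: "0 < C2" and e: "0 < e" and N0: "0 < N0"
    and rate: "\<And>n m z d. balanced n m \<Longrightarrow> N0 \<le> eff_size n m \<Longrightarrow> 0 < d \<Longrightarrow> 0 < z \<Longrightarrow>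
      z * d \<le> e \<Longrightarrow> z ^ 3 \<le> e * sqrt (eff_size n m) \<Longrightarrow>
      \<bar>exceed n m z / (1 - std_normal_cdf z) - 1\<bar>
      \<le> C2 * ((1 + z ^ 3) / sqrt (eff_size n m) + (1 + z) * d
        + 2 * max z 1 * sqrt (2 * pi) * exp (z\<^sup>2 / 2 - sqrt (eff_size n m) * d))"
    using moderate_deviation_rate by blast
  define e' where "e' = min e 1"
  have e': "0 < e'" "e' \<le> e" "e' \<le> 1" using e by (auto simp: e'_def)
  have "\<forall>\<^sub>F N in at_top. \<forall>n m z. balanced n m \<longrightarrow> eff_size n m = N \<longrightarrow> 0 < z \<longrightarrow> z \<le> a N \<longrightarrow>
        \<bar>exceed n m z / (1 - std_normal_cdf z) - 1\<bar>
          \<le> C2 * ((1 + z ^ 3) / sqrt N + (1 + z) * \<delta> N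
              + 2 * max z 1 * sqrt (2 * pi) * exp (z\<^sup>2 / 2 - sqrt N * \<delta> N))"
    if \<delta>: "\<forall>N>0. \<delta> N > 0" and a: "a \<in> o(\<lambda>N. min (1 / \<delta> N) (N powr (1/4) * sqrt (\<delta> N)))" for \<delta> a :: "real \<Rightarrow> real"
    using landau_o.smallD[OF a e'(1)] eventually_ge_at_top[of N0]
  proof eventually_elim
    case (elim N)
    then have Np: "0 < N" using N0 by simp
    have d: "0 < \<delta> N" using \<delta> Np by simp
    define q where "q = N powr (1/4) * sqrt (\<delta> N)"
    have q: "0 \<le> q" "q\<^sup>2 = sqrt N * \<delta> N"
    proof -
      have "(N powr (1/4))\<^sup>2 = N powr (1/4 + 1/4)" unfolding power2_eq_square powr_add ..
      then show "q\<^sup>2 = sqrt N * \<delta> N" using d Np by (simp add: q_def power_mult_distrib powr_half_sqrt)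
    qed (use d in \<open>simp add: q_def\<close>)
    have aN: "\<bar>a N\<bar> \<le> e' * min (1 / \<delta> N) q"
      using elim(1) d q by (simp add: q_def)
    show ?case
    proof (intro allI impI)
      fix n m z assume bal: "balanced n m" and N: "eff_size n m = N" and z: "0 < z" "z \<le> a N"
      have "e' * min (1 / \<delta> N) q \<le> e' * (1 / \<delta> N)" "e' * min (1 / \<delta> N) q \<le> e' * q"
        by (rule mult_left_mono[OF min.cobounded1], use e' in simp)
          (rule mult_left_mono[OF min.cobounded2], use e' in simp)
      then have z1: "z \<le> e' * (1 / \<delta> N)" and z2: "z \<le> e' * q" using z aN by linarith+
      have zd': "z * \<delta> N \<le> e'" using z1 d by (simp add: pos_le_divide_eq)
      then have zd: "z * \<delta> N \<le> e" using e' by linarith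
      have "z ^ 3 = z * z\<^sup>2" by (simp add: power3_eq_cube power2_eq_square)
      also have "\<dots> \<le> z * (e' * q)\<^sup>2" using z z2 by (intro mult_left_mono power_mono) auto
      also have "\<dots> = (z * \<delta> N) * (e'\<^sup>2 * sqrt N)" by (simp add: power_mult_distrib q)
      also have "\<dots> \<le> e' * (1 * sqrt N)"
        using zd' e' Np z d power_le_one[of e' 2] by (intro mult_mono mult_right_mono) auto
      also have "\<dots> \<le> e * sqrt N" using e' Np by (simp add: mult_right_mono)
      finally have z3: "z ^ 3 \<le> e * sqrt (eff_size n m)" by (simp add: N)
      show "\<bar>exceed n m z / (1 - std_normal_cdf z) - 1\<bar>
          \<le> C2 * ((1 + z ^ 3) / sqrt N + (1 + z) * \<delta> N
              + 2 * max z 1 * sqrt (2 * pi) * exp (z\<^sup>2 / 2 - sqrt N * \<delta> N))"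
        using rate[OF bal _ d z(1) zd z3] elim(2) by (simp add: N)
    qed
  qed
  then show ?thesis using C2 by blast
qed

text \<open>The bound is applied with \<open>d\<close> equal to \<open>N\<close> to the power \<open>-1/6\<close>, for which the exponent \<open>z\<^sup>2 / 2 - \<surd>N d\<close> tends to
  \<open>-\<infinity>\<close> faster than any logarithm.\<close>
lemma moderate_deviation_ratio_tendsto:
  fixes a :: "real \<Rightarrow> real"
  assumes a: "a \<in> o(\<lambda>N. N powr (1/6))" and \<epsilon>: "0 < \<epsilon>"
  shows "\<forall>\<^sub>F N in at_top. \<forall>n m z. balanced n m \<longrightarrow> eff_size n m = N \<longrightarrow> 0 < z \<longrightarrow> z \<le> a N \<longrightarrow>
    \<bar>exceed n m z / (1 - std_normal_cdf z) - 1\<bar> < \<epsilon>"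
proof -
  obtain C2 e N0 where C2: "0 < C2" and e: "0 < e" and N0: "0 < N0"
    and rate: "\<And>n m z d. balanced n m \<Longrightarrow> N0 \<le> eff_size n m \<Longrightarrow> 0 < d \<Longrightarrow> 0 < z \<Longrightarrow>
      z * d \<le> e \<Longrightarrow> z ^ 3 \<le> e * sqrt (eff_size n m) \<Longrightarrow>
      \<bar>exceed n m z / (1 - std_normal_cdf z) - 1\<bar>
      \<le> C2 * ((1 + z ^ 3) / sqrt (eff_size n m) + (1 + z) * d
        + 2 * max z 1 * sqrt (2 * pi) * exp (z\<^sup>2 / 2 - sqrt (eff_size n m) * d))"
    using moderate_deviation_rate by blast
  define \<beta> where "\<beta> = min (min e 1) (\<epsilon> / (4 * C2))"
  have \<beta>: "0 < \<beta>" "\<beta> \<le> e" "\<beta> \<le> 1" "\<beta> \<le> \<epsilon> / (4 * C2)" using e \<epsilon> C2 by (auto simp: \<beta>_def)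
  have "((\<lambda>N::real. 1 / sqrt N + N powr (-1/6) + 2 * N powr (1/6) * sqrt (2 * pi) * exp (- (N powr (1/3) / 2))) \<longlongrightarrow> 0) at_top"
    by real_asymp
  then have lim: "\<forall>\<^sub>F N::real in at_top. 1 / sqrt N + N powr (-1/6)
      + 2 * N powr (1/6) * sqrt (2 * pi) * exp (- (N powr (1/3) / 2)) < \<epsilon> / (2 * C2)"
    using \<epsilon> C2 by (intro order_tendstoD(2)) auto
  show ?thesis
    using landau_o.smallD[OF a \<beta>(1)] eventually_ge_at_top[of "max N0 1"] lim
  proof eventually_elim
    case (elim N)
    then have N1: "1 \<le> N" by simp
    define s where "s = N powr (1/6)"
    have s: "1 \<le> s" using N1 by (simp add: s_def ge_one_powr_ge_zero)
    have s3: "s ^ 3 = sqrt N"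
    proof -
      have "s ^ 3 = N powr (1/6 + 1/6 + 1/6)" unfolding s_def power3_eq_cube powr_add ..
      then show ?thesis using N1 by (simp add: powr_half_sqrt)
    qed
    have s2: "N powr (1/3) = s\<^sup>2"
    proof -
      have "s\<^sup>2 = N powr (1/6 + 1/6)" unfolding s_def power2_eq_square powr_add ..
      then show ?thesis by simp
    qed
    define d where "d = N powr (-1/6)"
    have d: "d = 1 / s" using N1 by (simp add: d_def s_def powr_minus_divide)
    have d0: "0 < d" using s by (simp add: d)
    have sd: "s * d = 1" using s by (simp add: d)
    have Nd: "sqrt N * d = s\<^sup>2" using s by (simp add: d power3_eq_cube power2_eq_square flip: s3)
    show ?case
    proof (intro allI impI)
      fix n m z assume bal: "balanced n m" and N: "eff_size n m = N" and z: "0 < z" "z \<le> a N"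
      have "\<bar>a N\<bar> \<le> \<beta> * s" using elim(1) N1 by (simp add: s_def)
      then have zs: "z \<le> \<beta> * s" using z by linarith
      have "z * d \<le> (\<beta> * s) * d" using zs d0 by (intro mult_right_mono) auto
      then have zd: "z * d \<le> \<beta>" using sd by (simp add: mult.assoc)
      have b3: "\<beta> ^ 3 \<le> \<beta>" "\<beta>\<^sup>2 \<le> 1"
        using \<beta> power_decreasing[of 1 3 \<beta>] power_le_one[of \<beta> 2] by auto
      have "z ^ 3 \<le> (\<beta> * s) ^ 3" using zs z by (intro power_mono) auto
      also have "\<dots> = \<beta> ^ 3 * sqrt N" by (simp add: power_mult_distrib s3)
      also have "\<dots> \<le> \<beta> * sqrt N" using b3 N1 by (intro mult_right_mono) auto
      finally have z3: "z ^ 3 \<le> \<beta> * sqrt N" .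
      have z3': "z ^ 3 \<le> e * sqrt (eff_size n m)"
      proof -
        have "\<beta> * sqrt N \<le> e * sqrt N" using \<beta>(2) N1 by (intro mult_right_mono) auto
        then show ?thesis unfolding N using z3 by linarith
      qed
      have "\<beta> * s \<le> 1 * s" using \<beta>(3) s by (intro mult_right_mono) auto
      then have zs1: "z \<le> s" using zs by linarith
      then have z2: "z\<^sup>2 \<le> s\<^sup>2" using z by (intro power_mono) auto
      have zmax: "max z 1 \<le> s" using zs1 s by simp
      have "\<bar>exceed n m z / (1 - std_normal_cdf z) - 1\<bar>
          \<le> C2 * ((1 + z ^ 3) / sqrt N + (1 + z) * d + 2 * max z 1 * sqrt (2 * pi) * exp (z\<^sup>2 / 2 - sqrt N * d))"
        using rate[OF bal _ d0 z(1) order_trans[OF zd \<beta>(2)] z3'] elim(2) by (simp add: N)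
      also have "\<dots> \<le> C2 * ((1 / sqrt N + \<beta>) + (d + \<beta>) + 2 * s * sqrt (2 * pi) * exp (- (s\<^sup>2 / 2)))"
      proof (rule mult_left_mono[OF add_mono[OF add_mono]])
        show "(1 + z ^ 3) / sqrt N \<le> 1 / sqrt N + \<beta>"
          using z3 N1 by (simp add: add_divide_distrib pos_divide_le_eq)
        show "(1 + z) * d \<le> d + \<beta>" using zd by (simp add: distrib_right)
        have "exp (z\<^sup>2 / 2 - sqrt N * d) \<le> exp (- (s\<^sup>2 / 2))" unfolding Nd using z2 by simp
        then show "2 * max z 1 * sqrt (2 * pi) * exp (z\<^sup>2 / 2 - sqrt N * d) \<le> 2 * s * sqrt (2 * pi) * exp (- (s\<^sup>2 / 2))"
          using zmax s by (intro mult_mono mult_right_mono mult_left_mono mult_nonneg_nonneg) auto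
      qed (use C2 in simp)
      also have "\<dots> = C2 * (1 / sqrt N + d + 2 * s * sqrt (2 * pi) * exp (- (s\<^sup>2 / 2))) + 2 * (C2 * \<beta>)"
        by (simp add: algebra_simps)
      also have "\<dots> < C2 * (\<epsilon> / (2 * C2)) + 2 * (C2 * (\<epsilon> / (4 * C2)))"
      proof (rule add_less_le_mono)
        show "C2 * (1 / sqrt N + d + 2 * s * sqrt (2 * pi) * exp (- (s\<^sup>2 / 2))) < C2 * (\<epsilon> / (2 * C2))"
          using elim(3) C2 unfolding d_def s_def[symmetric] s2 by (intro mult_strict_left_mono) auto
        show "2 * (C2 * \<beta>) \<le> 2 * (C2 * (\<epsilon> / (4 * C2)))"
          using \<beta>(4) C2 by (intro mult_left_mono) auto
      qed
      also have "\<dots> = \<epsilon>" using C2 by simp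
      finally show "\<bar>exceed n m z / (1 - std_normal_cdf z) - 1\<bar> < \<epsilon>" .
    qed
  qed
qed

end

theorem theorem2p6:
  fixes M :: "'a measure"
    and xi eps X Y :: "nat \<Rightarrow> 'a \<Rightarrow> real"
    and theta theta0 Shift c0 \<kappa>0 c1 \<kappa>1 \<eta> :: real
    and U :: "real \<Rightarrow> real"
    and T :: "nat \<Rightarrow> nat \<Rightarrow> 'a \<Rightarrow> real"
  assumes noise: "two_sample_noise M xi eps"
    and X: "X = (\<lambda>i \<omega>. theta + xi i \<omega>)"
    and Y: "Y = (\<lambda>j \<omega>. theta0 + eps j \<omega>)"
    and Shift: "Shift = theta - theta0"
    and U: "U = diff_cdf M (X 0) (Y 0)"
    and median: "Shift = Inf {t. U t \<ge> 1 / 2}"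
    and T: "T = (\<lambda>n m \<omega>. sqrt (eff_size n m) *
               (hodges_lehmann n m (\<lambda>i. X i \<omega>) (\<lambda>j. Y j \<omega>) - Shift) /
               hl_sd M (xi 0) (eps 0) (deriv U Shift) n m)"
    and pos: "c0 > 0" "\<kappa>0 > 0" "c1 > 0" "\<kappa>1 > 0"
    and U_diff: "\<And>t. U differentiable (at t)"
    and U_lower: "\<And>d. \<bar>d\<bar> \<le> c0 \<Longrightarrow> deriv U (Shift + d) \<ge> \<kappa>0"
    and U_diff2: "\<And>d. \<bar>d\<bar> \<le> c1 \<Longrightarrow> deriv U differentiable (at (Shift + d))"
    and U_upper2: "\<And>d. \<bar>d\<bar> \<le> c1 \<Longrightarrow> \<bar>deriv (deriv U) (Shift + d)\<bar> \<le> \<kappa>1"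
    and U_bdd: "bdd_above (range (\<lambda>t. \<bar>deriv U t\<bar>))"
    and eta: "0 < \<eta>" "\<eta> < 1"
  shows
    "(\<exists>C1>0. \<forall>n m. n > 0 \<longrightarrow> m > 0 \<longrightarrow> \<eta> \<le> real n / real m \<longrightarrow> real n / real m \<le> 1 / \<eta> \<longrightarrow>
        eff_size n m \<ge> 2 \<longrightarrow>
        (SUP z. \<bar>measure M {\<omega> \<in> space M. T n m \<omega> \<le> z} - std_normal_cdf z\<bar>)
          \<le> C1 * ln (eff_size n m) / sqrt (eff_size n m)) \<and>
     (\<forall>\<delta> :: real \<Rightarrow> real. (\<forall>N>0. \<delta> N > 0) \<longrightarrow>
        filterlim (\<lambda>N. sqrt N * \<delta> N) at_top at_top \<longrightarrow>
        (\<exists>C2>0. \<forall>a \<in> o(\<lambda>N. min (1 / \<delta> N) (N powr (1/4) * sqrt (\<delta> N))).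
           \<forall>\<^sub>F N in at_top. \<forall>n m. n > 0 \<longrightarrow> m > 0 \<longrightarrow>
             \<eta> \<le> real n / real m \<longrightarrow> real n / real m \<le> 1 / \<eta> \<longrightarrow> eff_size n m = N \<longrightarrow>
             (\<forall>z. 0 < z \<and> z \<le> a N \<longrightarrow>
               \<bar>measure M {\<omega> \<in> space M. T n m \<omega> \<ge> z} / (1 - std_normal_cdf z) - 1\<bar>
                 \<le> C2 * ((1 + z ^ 3) / sqrt N + (1 + z) * \<delta> N +
                     2 * max z 1 * sqrt (2 * pi) * exp (z\<^sup>2 / 2 - sqrt N * \<delta> N)))) \<and>
        (\<delta> \<in> \<Theta>(\<lambda>N. N powr (-1/6)) \<longrightarrow>
          (\<forall>a \<in> o(\<lambda>N. N powr (1/6)). \<forall>e>0.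
             \<forall>\<^sub>F N in at_top. \<forall>n m. n > 0 \<longrightarrow> m > 0 \<longrightarrow>
               \<eta> \<le> real n / real m \<longrightarrow> real n / real m \<le> 1 / \<eta> \<longrightarrow> eff_size n m = N \<longrightarrow>
               (\<forall>z. 0 < z \<and> z \<le> a N \<longrightarrow>
                 \<bar>measure M {\<omega> \<in> space M. T n m \<omega> \<ge> z} / (1 - std_normal_cdf z) - 1\<bar> < e))))"
proof -
  interpret prob_space M using noise by (simp add: two_sample_noise_def)
  have indep: "indep_vars (\<lambda>_. borel) (case_sum xi eps) UNIV"
    and ident: "\<And>i. distr M borel (xi i) = distr M borel (xi 0)" "\<And>j. distr M borel (eps j) = distr M borel (eps 0)"
    using noise by (auto simp: two_sample_noise_def)
  have rv: "random_variable borel (case_sum xi eps k)" for k using indep by (auto simp: indep_vars_def)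
  have [measurable]: "xi i \<in> borel_measurable M" "eps i \<in> borel_measurable M" for i
    using rv[of "Inl i"] rv[of "Inr i"] by simp_all
  have XY: "X i \<omega> - Y j \<omega> \<le> Shift + u \<longleftrightarrow> xi i \<omega> - eps j \<omega> \<le> u" for i j \<omega> u
    by (auto simp: X Y Shift)
  have U_prob: "U (Shift + u) = prob {\<omega> \<in> space M. xi 0 \<omega> - eps 0 \<omega> \<le> u}" for u
    unfolding U diff_cdf_def XY ..

  \<comment> \<open>All probabilities are expressed through \<open>xi\<close>, \<open>eps\<close> and levels measured from the true shift.\<close>
  define E where "E = distr M borel (\<lambda>\<omega>. xi 0 \<omega> - eps 0 \<omega>)"
  interpret E: real_distribution E unfolding E_def by (rule real_distribution_distr) simp
  have U_cdf: "U (Shift + u) = cdf E u" for u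
    by (simp add: U_prob E_def cdf_def measure_distr vimage_def Int_def conj_commute)
  have DU: "(U has_real_derivative deriv U t) (at t)" for t
    using U_diff[of t] by (simp add: DERIV_deriv_iff_real_differentiable)
  have cont_U: "isCont U t" for t using DU by (rule DERIV_isCont)
  have cont_E: "isCont (cdf E) u" for u
  proof -
    have "isCont (\<lambda>u. U (Shift + u)) u"
      by (rule continuous_at_compose[unfolded o_def]) (auto intro!: continuous_intros cont_U)
    then show ?thesis by (simp add: U_cdf[abs_def])
  qed
  have no_ties: "prob {\<omega> \<in> space M. xi 0 \<omega> - eps 0 \<omega> = u} = 0" for u
  proof -
    have "measure E {u} = 0" using cont_E[of u] E.isCont_cdf by blast
    then show ?thesis by (simp add: E_def measure_distr vimage_def Int_def conj_commute)
  qed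
  interpret two_sample M xi eps
    by unfold_locales (auto intro: indep ident no_ties)

  have V_U: "V u = U (Shift + u)" for u by (simp add: U_prob V_def)
  have V_E: "V u = cdf E u" for u by (simp add: V_U U_cdf)
  have V_median: "V 0 = 1 / 2"
  proof -
    obtain b where b: "1 / 2 \<le> cdf E b" "\<And>t. t < b \<Longrightarrow> cdf E t < 1 / 2" "b = Inf {t. 1 / 2 \<le> cdf E t}"
      by (rule E.quantile_exists[of "1 / 2"]) auto
    have "{t. U t \<ge> 1 / 2} = (+) Shift ` {t. 1 / 2 \<le> cdf E t}"
    proof (intro set_eqI iffI)
      fix t assume "t \<in> {t. U t \<ge> 1 / 2}"
      then show "t \<in> (+) Shift ` {t. 1 / 2 \<le> cdf E t}"
        using U_cdf[of "t - Shift"] by (intro image_eqI[of _ _ "t - Shift"]) auto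
    qed (auto simp: U_cdf)
    moreover have "Inf ((+) Shift ` {t. 1 / 2 \<le> cdf E t}) = Shift + b"
    proof (rule cInf_eq_minimum)
      show "Shift + b \<in> (+) Shift ` {t. 1 / 2 \<le> cdf E t}" using b(1) by auto
      fix y assume "y \<in> (+) Shift ` {t. 1 / 2 \<le> cdf E t}"
      then obtain t where "y = Shift + t" "1 / 2 \<le> cdf E t" by auto
      then show "Shift + b \<le> y" using b(2)[of t] by (cases "t < b") auto
    qed
    ultimately have b0: "b = 0" using median by simp
    have "((cdf E) \<longlongrightarrow> cdf E 0) (at_left 0)"
      using cont_E[of 0] by (simp add: isCont_def filterlim_at_split)
    moreover have "\<forall>\<^sub>F t in at_left 0. cdf E t \<le> 1 / 2"
      unfolding eventually_at_filter
    proof (intro always_eventually allI impI)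
      fix t :: real assume "t \<in> {..<0}"
      then show "cdf E t \<le> 1 / 2" using b(2)[of t] b0 by simp
    qed
    ultimately have "cdf E 0 \<le> 1 / 2" by (rule tendsto_upperbound) simp
    then show ?thesis using b(1) by (simp add: V_E b0)
  qed

  define v where "v = deriv U Shift"
  have v: "0 < v" using U_lower[of 0] pos by (simp add: v_def)
  have dU: "\<bar>deriv U (Shift + d) - v\<bar> \<le> \<kappa>1 * \<bar>d\<bar>" if d: "\<bar>d\<bar> \<le> c1" for d
  proof -
    have "norm (deriv U (Shift + d) - deriv U Shift) \<le> \<kappa>1 * norm ((Shift + d) - Shift)"
    proof (rule field_differentiable_bound)
      fix y assume "y \<in> cball Shift c1"
      then have y: "\<bar>y - Shift\<bar> \<le> c1" by (simp add: dist_real_def abs_minus_commute)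
      have "(deriv U has_real_derivative deriv (deriv U) y) (at y)"
        using U_diff2[OF y] by (simp add: DERIV_deriv_iff_real_differentiable)
      then show "(deriv U has_field_derivative deriv (deriv U) y) (at y within cball Shift c1)"
        by (rule DERIV_subset) simp
      show "norm (deriv (deriv U) y) \<le> \<kappa>1" using U_upper2[OF y] by simp
    qed (use d pos in \<open>auto simp: dist_real_def\<close>)
    then show ?thesis by (simp add: v_def)
  qed
  have Taylor: "\<bar>V u - 1 / 2 - v * u\<bar> \<le> \<kappa>1 * u\<^sup>2" if u: "\<bar>u\<bar> \<le> c1" for u
  proof -
    let ?W = "\<lambda>t. U t - v * t"
    have "norm (?W (Shift + u) - ?W Shift) \<le> (\<kappa>1 * \<bar>u\<bar>) * norm ((Shift + u) - Shift)"
    proof (rule field_differentiable_bound)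
      fix y assume "y \<in> cball Shift \<bar>u\<bar>"
      then have y: "\<bar>y - Shift\<bar> \<le> \<bar>u\<bar>" by (simp add: dist_real_def abs_minus_commute)
      show "(?W has_field_derivative deriv U y - v) (at y within cball Shift \<bar>u\<bar>)"
        by (rule DERIV_subset[of _ _ _ UNIV]) (auto intro!: derivative_eq_intros DU)
      have "\<bar>deriv U (Shift + (y - Shift)) - v\<bar> \<le> \<kappa>1 * \<bar>y - Shift\<bar>" using y u by (intro dU) auto
      also have "\<dots> \<le> \<kappa>1 * \<bar>u\<bar>" using y pos by (intro mult_left_mono) auto
      finally show "norm (deriv U y - v) \<le> \<kappa>1 * \<bar>u\<bar>" by simp
    qed (auto simp: dist_real_def)
    moreover have "U Shift = 1 / 2" using V_median V_U[of 0] by simp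
    ultimately show ?thesis by (simp add: V_U algebra_simps power2_eq_square abs_mult)
  qed
  \<comment> \<open>One constant that serves both as the Lipschitz constant and in the Taylor estimate.\<close>
  define K where "K = v + \<kappa>1 * (1 + c1)"
  have K: "0 < K" "\<kappa>1 \<le> K" "v + \<kappa>1 * c1 \<le> K" using v pos by (auto simp: K_def algebra_simps add_pos_pos)
  interpret two_sample_regular M xi eps v K c1 \<eta>
  proof unfold_locales
    fix u :: real assume u: "\<bar>u\<bar> \<le> c1"
    show "\<bar>V u - 1 / 2 - v * u\<bar> \<le> K * u\<^sup>2"
      using Taylor[OF u] mult_right_mono[OF K(2), of "u\<^sup>2"] by simp
    have "\<bar>V u - V 0\<bar> \<le> v * \<bar>u\<bar> + \<kappa>1 * u\<^sup>2"
      using Taylor[OF u] V_median v abs_triangle_ineq[of "v * u" "V u - 1 / 2 - v * u"] by (simp add: abs_mult)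
    also have "\<kappa>1 * u\<^sup>2 \<le> \<kappa>1 * (c1 * \<bar>u\<bar>)"
    proof (rule mult_left_mono)
      have "\<bar>u\<bar> * \<bar>u\<bar> \<le> c1 * \<bar>u\<bar>" using u by (intro mult_right_mono) auto
      then show "u\<^sup>2 \<le> c1 * \<bar>u\<bar>" by (simp add: power2_eq_square)
    qed (use pos in simp)
    also have "v * \<bar>u\<bar> + \<kappa>1 * (c1 * \<bar>u\<bar>) \<le> K * \<bar>u\<bar>"
      using mult_right_mono[OF K(3), of "\<bar>u\<bar>"] by (simp add: algebra_simps)
    finally show "\<bar>V u - V 0\<bar> \<le> K * \<bar>u\<bar>" by simp
  qed (use V_median v K pos eta in auto)

  have hl_sd: "hl_sd M (xi 0) (eps 0) (deriv U Shift) n m = sd n m 0 / v" for n m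
  proof -
    have "hl_sd M (xi 0) (eps 0) (deriv U Shift) n m
        = sqrt (1 / v\<^sup>2 * (real n / (real n + real m) * var_f 0 + real m / (real n + real m) * var_g 0))"
      unfolding hl_sd_def Let_def P_def[symmetric] Q_def[symmetric] var_f_0 var_g_0 v_def ..
    also have "\<dots> = sd n m 0 / v"
      using v by (simp add: sd_def real_sqrt_divide add.commute)
    finally show ?thesis .
  qed
  have T_le: "T n m \<omega> \<le> z \<longleftrightarrow> 1 / 2 \<le> emp n m (cutoff n m z) \<omega>"
    and T_eq: "T n m \<omega> = z \<Longrightarrow> \<exists>i<n. \<exists>j<m. xi i \<omega> - eps j \<omega> = cutoff n m z"
    if bal: "balanced n m" for n m z \<omega>
  proof -
    have nm: "0 < n" "0 < m" using bal by (auto simp: balanced_def)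
    define r where "r = sqrt (eff_size n m)"
    define \<sigma> where "\<sigma> = sd n m 0 / v"
    have r: "0 < r" using eff_size_pos[OF bal] by (simp add: r_def)
    have \<sigma>: "0 < \<sigma>" using sd_0_bounds[OF bal] s1_pos v by (simp add: \<sigma>_def)
    let ?hl = "hodges_lehmann n m (\<lambda>i. X i \<omega>) (\<lambda>j. Y j \<omega>)"
    have Tr: "T n m \<omega> = r * (?hl - Shift) / \<sigma>" by (simp add: T hl_sd r_def \<sigma>_def)
    have cut: "cutoff n m z = \<sigma> * z / r" by (simp add: cutoff_def \<sigma>_def r_def)
    have "T n m \<omega> \<le> z \<longleftrightarrow> ?hl \<le> Shift + cutoff n m z"
      unfolding Tr cut using r \<sigma> by (simp add: field_simps)
    also have "\<dots> \<longleftrightarrow> 1 / 2 \<le> emp n m (cutoff n m z) \<omega>"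
      unfolding hodges_lehmann_le_iff[OF nm] XY emp_def ..
    finally show "T n m \<omega> \<le> z \<longleftrightarrow> 1 / 2 \<le> emp n m (cutoff n m z) \<omega>" .
    assume "T n m \<omega> = z"
    then have "?hl = Shift + cutoff n m z" unfolding Tr cut using r \<sigma> by (simp add: field_simps)
    moreover obtain i j where "i < n" "j < m" "?hl = X i \<omega> - Y j \<omega>"
      using hodges_lehmann_attained(3)[OF nm, of "\<lambda>i. X i \<omega>" "\<lambda>j. Y j \<omega>"] by auto
    ultimately have "i < n" "j < m" "xi i \<omega> - eps j \<omega> = cutoff n m z" by (simp_all add: X Y Shift)
    then show "\<exists>i<n. \<exists>j<m. xi i \<omega> - eps j \<omega> = cutoff n m z" by blast
  qed
  have P_le: "measure M {\<omega> \<in> space M. T n m \<omega> \<le> z} = 1 - exceed n m z" if bal: "balanced n m" for n m z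
    unfolding T_le[OF bal] exceed_def
    using prob_neg[of "\<lambda>\<omega>. emp n m (cutoff n m z) \<omega> < 1 / 2"] by (simp add: not_less)
  \<comment> \<open>The estimator equals a given level only if some pair has exactly this difference, a null event.\<close>
  have P_ge: "measure M {\<omega> \<in> space M. T n m \<omega> \<ge> z} = exceed n m z" if bal: "balanced n m" for n m z
  proof -
    have [measurable]: "T n m \<in> borel_measurable M"
      unfolding borel_measurable_iff_le T_le[OF bal] by measurable
    define Z where "Z = (\<Union>i<n. \<Union>j<m. {\<omega> \<in> space M. xi i \<omega> - eps j \<omega> = cutoff n m z})"
    have [measurable]: "Z \<in> sets M" unfolding Z_def by measurable
    have Z: "prob Z = 0"
    proof -
      have "Z \<in> null_sets M" unfolding Z_def
        by (intro null_sets_UN') (auto simp: null_sets_def emeasure_eq_measure no_tie_pair)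
      then show ?thesis by (simp add: null_sets_def measure_def)
    qed
    have lt: "{\<omega> \<in> space M. emp n m (cutoff n m z) \<omega> < 1 / 2} = {\<omega> \<in> space M. z < T n m \<omega>}"
      using T_le[OF bal, of _ z] by (auto simp: not_le[symmetric])
    have "prob {\<omega> \<in> space M. T n m \<omega> \<ge> z} \<le> prob ({\<omega> \<in> space M. z < T n m \<omega>} \<union> Z)"
      using T_eq[OF bal, of _ z] by (intro finite_measure_mono) (auto simp: Z_def le_less)
    also have "\<dots> \<le> prob {\<omega> \<in> space M. z < T n m \<omega>} + prob Z" by (rule measure_Un_le) auto
    finally have "prob {\<omega> \<in> space M. T n m \<omega> \<ge> z} \<le> exceed n m z" unfolding Z exceed_def lt by simp
    moreover have "exceed n m z \<le> prob {\<omega> \<in> space M. T n m \<omega> \<ge> z}"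
      unfolding exceed_def lt by (intro finite_measure_mono) auto
    ultimately show ?thesis by simp
  qed

  have part1: "\<exists>C1>0. \<forall>n m. n > 0 \<longrightarrow> m > 0 \<longrightarrow> \<eta> \<le> real n / real m \<longrightarrow> real n / real m \<le> 1 / \<eta> \<longrightarrow>
        eff_size n m \<ge> 2 \<longrightarrow>
        (SUP z. \<bar>measure M {\<omega> \<in> space M. T n m \<omega> \<le> z} - std_normal_cdf z\<bar>)
          \<le> C1 * ln (eff_size n m) / sqrt (eff_size n m)"
  proof -
    obtain C1 where C1: "0 < C1" and rate: "\<And>n m z. balanced n m \<Longrightarrow> 2 \<le> eff_size n m \<Longrightarrow>
        \<bar>exceed n m z - (1 - std_normal_cdf z)\<bar> \<le> C1 * ln (eff_size n m) / sqrt (eff_size n m)"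
      using berry_esseen_rate by blast
    have "(SUP z. \<bar>measure M {\<omega> \<in> space M. T n m \<omega> \<le> z} - std_normal_cdf z\<bar>)
          \<le> C1 * ln (eff_size n m) / sqrt (eff_size n m)" if bal: "balanced n m" and N: "2 \<le> eff_size n m" for n m
    proof (rule cSUP_least)
      fix z show "\<bar>measure M {\<omega> \<in> space M. T n m \<omega> \<le> z} - std_normal_cdf z\<bar> \<le> C1 * ln (eff_size n m) / sqrt (eff_size n m)"
        using rate[OF bal N, of z] unfolding P_le[OF bal] by (simp add: abs_minus_commute)
    qed simp
    then show ?thesis using C1 by (auto simp: balanced_def)
  qed
  obtain C2 where C2: "0 < C2" and mod: "\<And>\<delta> a. (\<forall>N>0. \<delta> N > 0) \<Longrightarrow>
      a \<in> o(\<lambda>N. min (1 / \<delta> N) (N powr (1/4) * sqrt (\<delta> N))) \<Longrightarrow>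
      \<forall>\<^sub>F N in at_top. \<forall>n m z. balanced n m \<longrightarrow> eff_size n m = N \<longrightarrow> 0 < z \<longrightarrow> z \<le> a N \<longrightarrow>
        \<bar>exceed n m z / (1 - std_normal_cdf z) - 1\<bar>
          \<le> C2 * ((1 + z ^ 3) / sqrt N + (1 + z) * \<delta> N
              + 2 * max z 1 * sqrt (2 * pi) * exp (z\<^sup>2 / 2 - sqrt N * \<delta> N))"
    using moderate_deviation_uniform by blast
  have part2: "\<forall>\<^sub>F N in at_top. \<forall>n m. n > 0 \<longrightarrow> m > 0 \<longrightarrow>
             \<eta> \<le> real n / real m \<longrightarrow> real n / real m \<le> 1 / \<eta> \<longrightarrow> eff_size n m = N \<longrightarrow>
             (\<forall>z. 0 < z \<and> z \<le> a N \<longrightarrow>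
               \<bar>measure M {\<omega> \<in> space M. T n m \<omega> \<ge> z} / (1 - std_normal_cdf z) - 1\<bar>
                 \<le> C2 * ((1 + z ^ 3) / sqrt N + (1 + z) * \<delta> N +
                     2 * max z 1 * sqrt (2 * pi) * exp (z\<^sup>2 / 2 - sqrt N * \<delta> N)))"
    if "\<forall>N>0. \<delta> N > 0" "a \<in> o(\<lambda>N. min (1 / \<delta> N) (N powr (1/4) * sqrt (\<delta> N)))" for \<delta> a :: "real \<Rightarrow> real"
    using mod[OF that]
  proof eventually_elim
    case (elim N)
    show ?case
    proof (intro allI impI)
      fix n m z
      assume "0 < n" "0 < m" "\<eta> \<le> real n / real m" "real n / real m \<le> 1 / \<eta>"
        and N: "eff_size n m = N" and z: "0 < z \<and> z \<le> a N"
      then have bal: "balanced n m" by (simp add: balanced_def)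
      show "\<bar>measure M {\<omega> \<in> space M. T n m \<omega> \<ge> z} / (1 - std_normal_cdf z) - 1\<bar>
                 \<le> C2 * ((1 + z ^ 3) / sqrt N + (1 + z) * \<delta> N +
                     2 * max z 1 * sqrt (2 * pi) * exp (z\<^sup>2 / 2 - sqrt N * \<delta> N))"
        using elim bal N z unfolding P_ge[OF bal] by blast
    qed
  qed
  have part3: "\<forall>\<^sub>F N in at_top. \<forall>n m. n > 0 \<longrightarrow> m > 0 \<longrightarrow>
               \<eta> \<le> real n / real m \<longrightarrow> real n / real m \<le> 1 / \<eta> \<longrightarrow> eff_size n m = N \<longrightarrow>
               (\<forall>z. 0 < z \<and> z \<le> a N \<longrightarrow>
                 \<bar>measure M {\<omega> \<in> space M. T n m \<omega> \<ge> z} / (1 - std_normal_cdf z) - 1\<bar> < e)"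
    if "a \<in> o(\<lambda>N. N powr (1/6))" "0 < e" for a :: "real \<Rightarrow> real" and e
    using moderate_deviation_ratio_tendsto[OF that]
  proof eventually_elim
    case (elim N)
    show ?case
    proof (intro allI impI)
      fix n m z
      assume "0 < n" "0 < m" "\<eta> \<le> real n / real m" "real n / real m \<le> 1 / \<eta>"
        and N: "eff_size n m = N" and z: "0 < z \<and> z \<le> a N"
      then have bal: "balanced n m" by (simp add: balanced_def)
      show "\<bar>measure M {\<omega> \<in> space M. T n m \<omega> \<ge> z} / (1 - std_normal_cdf z) - 1\<bar> < e"
        using elim bal N z unfolding P_ge[OF bal] by blast
    qed
  qed
  show ?thesis
  proof (rule conjI[OF part1], intro allI impI conjI ballI)
    fix \<delta> :: "real \<Rightarrow> real" assume \<delta>: "\<forall>N>0. \<delta> N > 0"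
    show "\<exists>C2>0. \<forall>a \<in> o(\<lambda>N. min (1 / \<delta> N) (N powr (1/4) * sqrt (\<delta> N))).
           \<forall>\<^sub>F N in at_top. \<forall>n m. n > 0 \<longrightarrow> m > 0 \<longrightarrow>
             \<eta> \<le> real n / real m \<longrightarrow> real n / real m \<le> 1 / \<eta> \<longrightarrow> eff_size n m = N \<longrightarrow>
             (\<forall>z. 0 < z \<and> z \<le> a N \<longrightarrow>
               \<bar>measure M {\<omega> \<in> space M. T n m \<omega> \<ge> z} / (1 - std_normal_cdf z) - 1\<bar>
                 \<le> C2 * ((1 + z ^ 3) / sqrt N + (1 + z) * \<delta> N +
                     2 * max z 1 * sqrt (2 * pi) * exp (z\<^sup>2 / 2 - sqrt N * \<delta> N)))"
      by (rule exI[of _ C2], rule conjI[OF C2], rule ballI, rule part2[OF \<delta>])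
  next
    fix a :: "real \<Rightarrow> real" and e :: real
    assume "a \<in> o(\<lambda>N. N powr (1/6))" "0 < e"
    then show "\<forall>\<^sub>F N in at_top. \<forall>n m. n > 0 \<longrightarrow> m > 0 \<longrightarrow>
               \<eta> \<le> real n / real m \<longrightarrow> real n / real m \<le> 1 / \<eta> \<longrightarrow> eff_size n m = N \<longrightarrow>
               (\<forall>z. 0 < z \<and> z \<le> a N \<longrightarrow>
                 \<bar>measure M {\<omega> \<in> space M. T n m \<omega> \<ge> z} / (1 - std_normal_cdf z) - 1\<bar> < e)"
      by (rule part3)
  qed
qed

end
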